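(* Let $\Bbbk\in\{\mathbb{R},\mathbb{C}\}$, let $\mathcal{X}\subseteq\Bbbk^n$ be a model given as in (IS) or (ES), let $d=\dim\mathcal{X}>0$, let $s>0$, and let $\mu=\hat\mu|_{\mathcal X}:\mathcal{X}\to\Bbbk^s$ be the restriction to $\mathcal X$ of a generic linear map $\hat\mu:\Bbbk^n\to\Bbbk^s$. (1) If $\mathcal{X}$ is a linear space, then $\mu$ is generically identifiable if and only if $s\ge d$. (2) If $\mathcal{X}$ is not a linear subspace and $s\ge d+1$, then $\mu$ is generically identifiable. (3) If $\Bbbk=\mathbb{C}$ and $\mathcal{X}$ is not a linear subspace, then the condition $s\ge d+1$ is also necessary for $\mu$ to be generically identifiable.
   Context: The model is given in one of two ways. (IS): $\mathcal{X}=\{x\in\Bbbk^n: f_1(x)=\dots=f_k(x)=0\}$ for polynomials $f_i\in\Bbbk[x_1,\dots,x_n]$. (ES): $\mathcal{X}=\phi(\Bbbk^\ell)$ for a polynomial map $\phi:\Bbbk^\ell\to\Bbbk^n$. The model is assumed irreducible, meaning that its Zariski closure $\overline{\mathcal X}\subseteq\Bbbk^n$ is not a union of two proper algebraic subvarieties (this is automatic in (ES)). $\dim\mathcal{X}$ is the dimension of $\overline{\mathcal X}$ as an algebraic variety over $\Bbbk$ (real dimension if $\Bbbk=\mathbb R$, complex dimension if $\Bbbk=\mathbb C$; in (ES) it is the maximal rank of the Jacobian matrix of $\phi$). The map $\mu$ is identifiable at $x\in\mathcal{X}$ if the fiber $\mu^{-1}(\mu(x))$ equals $\{x\}$. It is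 generically identifiable if it is identifiable at generic points of $\mathcal X$, that is, at all points of $\mathcal{X}\cap U$ for some nonempty Zariski open subset $U$ of $\overline{\mathcal{X}}$. A statement holds for a generic linear map $\Bbbk^n\to\Bbbk^s$ if it holds for all linear maps in some nonempty Zariski open subset of the vector space $\Bbbk^{s\times n}$ of all such maps.
   Formalization: In (3), "X is not a linear subspace" is replaced by "the Zariski closure of X is not an affine-linear subspace"; as stated (3) fails for the image of (u,v) -> (u,uv) in C^2, where d=2 and s=2 suffices. (1) is proved for all X with affine-linear closure. *)

theory Defs
  imports "HOL-Analysis.Analysis"
begin

(* Polynomials enter only through their values, which loses nothing over the infinite fields
   real and complex.  Coordinate functions C are a parameter because polynomials are needed on
   vectors, on matrices and in m variables with m not fixed by a type. *)
inductive_set poly_functions :: "('v \<Rightarrow> 'k::comm_ring_1) set \<Rightarrow> ('v \<Rightarrow> 'k) set"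
  for C :: "('v \<Rightarrow> 'k) set" where
  const: "(\<lambda>_. c) \<in> poly_functions C"
| coord: "f \<in> C \<Longrightarrow> f \<in> poly_functions C"
| add: "f \<in> poly_functions C \<Longrightarrow> g \<in> poly_functions C \<Longrightarrow> (\<lambda>v. f v + g v) \<in> poly_functions C"
| mult: "f \<in> poly_functions C \<Longrightarrow> g \<in> poly_functions C \<Longrightarrow> (\<lambda>v. f v * g v) \<in> poly_functions C"

definition vec_coords :: "('k::field ^ 'n \<Rightarrow> 'k) set" where
  "vec_coords = {\<lambda>x. x $ i | i. True}"

definition mat_coords :: "('k::field ^ 'n ^ 's \<Rightarrow> 'k) set" where
  "mat_coords = {\<lambda>A. A $ i $ j | i j. True}"

(* Coordinates of k^m, points of k^m being the first m values of a sequence. *)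
definition seq_coords :: "nat \<Rightarrow> ((nat \<Rightarrow> 'k::field) \<Rightarrow> 'k) set" where
  "seq_coords m = {\<lambda>t. t i | i. i < m}"

definition zariski_closed :: "('v \<Rightarrow> 'k::field) set \<Rightarrow> 'v set \<Rightarrow> bool" where
  "zariski_closed C Z \<longleftrightarrow> (\<exists>F \<subseteq> poly_functions C. Z = {v. \<forall>f\<in>F. f v = 0})"

definition zariski_open :: "('v \<Rightarrow> 'k::field) set \<Rightarrow> 'v set \<Rightarrow> bool" where
  "zariski_open C U \<longleftrightarrow> zariski_closed C (- U)"

definition zariski_closure :: "('k::field ^ 'n) set \<Rightarrow> ('k ^ 'n) set" where
  "zariski_closure X = \<Inter>{Z. zariski_closed vec_coords Z \<and> X \<subseteq> Z}"

definition zariski_irreducible :: "('k::field ^ 'n) set \<Rightarrow> bool" where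
  "zariski_irreducible V \<longleftrightarrow>
     \<not> (\<exists>A B. zariski_closed vec_coords A \<and> zariski_closed vec_coords B \<and>
            A \<subset> V \<and> B \<subset> V \<and> V = A \<union> B)"

definition implicit_model :: "('k::field ^ 'n) set \<Rightarrow> bool" where
  "implicit_model X \<longleftrightarrow>
     (\<exists>F. finite F \<and> F \<subseteq> poly_functions vec_coords \<and> X = {x. \<forall>f\<in>F. f x = 0})"

definition explicit_model :: "('k::field ^ 'n) set \<Rightarrow> bool" where
  "explicit_model X \<longleftrightarrow>
     (\<exists>l (\<phi> :: (nat \<Rightarrow> 'k) \<Rightarrow> 'k ^ 'n).
        (\<forall>i. (\<lambda>t. \<phi> t $ i) \<in> poly_functions (seq_coords l)) \<and> X = range \<phi>)"

definition model :: "('k::field ^ 'n) set \<Rightarrow> bool" where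
  "model X \<longleftrightarrow>
     (implicit_model X \<or> explicit_model X) \<and> zariski_irreducible (zariski_closure X)"

(* The dimension of an irreducible variety V is the transcendence degree over k of its function
   field.  This is the fraction field of the coordinate ring k[V], so the degree is the largest
   number m of elements g 0, ..., g (m - 1) of k[V] satisfying no nontrivial polynomial
   relation p; "nontrivial" is "not identically zero", k being infinite.
   Such m are bounded by the number of coordinates. *)
definition alg_independent_on :: "('k::field ^ 'n) set \<Rightarrow> nat \<Rightarrow> (nat \<Rightarrow> 'k ^ 'n \<Rightarrow> 'k) \<Rightarrow> bool" where
  "alg_independent_on V m g \<longleftrightarrow>
     (\<forall>p \<in> poly_functions (seq_coords m).
        (\<forall>x\<in>V. p (\<lambda>i. g i x) = 0) \<longrightarrow> (\<forall>t. p t = 0))"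

definition variety_dim :: "('k::field ^ 'n) set \<Rightarrow> nat" where
  "variety_dim V =
     Sup {m. \<exists>g. (\<forall>i<m. g i \<in> poly_functions vec_coords) \<and> alg_independent_on V m g}"

definition model_dim :: "('k::field ^ 'n) set \<Rightarrow> nat" where
  "model_dim X = variety_dim (zariski_closure X)"

(* The closure of X is a translate of a linear subspace.  Asking instead whether X itself is a
   linear subspace makes necessity of s >= d + 1 over the complex numbers false: a line off the
   origin in C^2, and the image {(0,0)} Un {(x,y). x ~= 0} of (u,v) |-> (u,u*v), are injectively
   mapped by a generic linear map already for s = d. *)
definition linear_closure :: "('k::field ^ 'n) set \<Rightarrow> bool" where
  "linear_closure X \<longleftrightarrow> (\<exists>a. vec.subspace ((\<lambda>x. x - a) ` zariski_closure X))"

definition identifiable_at :: "('v \<Rightarrow> 'w) \<Rightarrow> 'v set \<Rightarrow> 'v \<Rightarrow> bool" where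
  "identifiable_at \<mu> X x \<longleftrightarrow> {y \<in> X. \<mu> y = \<mu> x} = {x}"

definition generically_identifiable :: "('k::field ^ 'n \<Rightarrow> 'w) \<Rightarrow> ('k ^ 'n) set \<Rightarrow> bool" where
  "generically_identifiable \<mu> X \<longleftrightarrow>
     (\<exists>U. zariski_open vec_coords U \<and> zariski_closure X \<inter> U \<noteq> {} \<and>
          (\<forall>x \<in> X \<inter> U. identifiable_at \<mu> X x))"

definition for_generic_matrix :: "('k::field ^ 'n ^ 's \<Rightarrow> bool) \<Rightarrow> bool" where
  "for_generic_matrix P \<longleftrightarrow> (\<exists>W. zariski_open mat_coords W \<and> W \<noteq> {} \<and> (\<forall>A\<in>W. P A))"

end

theory Submission
  imports Defs "HOL-Computational_Algebra.Fundamental_Theorem_Algebra" "HOL-Library.Function_Algebras"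
begin

text \<open>
  All algebra takes place in rings of polynomial functions. A surjection onto the model \<open>X\<close> pulls
  polynomial functions back to an honest ring of functions, equality on \<open>X\<close> becoming equality, and
  irreducibility of the closure says that this ring has no zero divisors. The algebraic lemmas are
  therefore stated for a subring without zero divisors of a commutative ring (locale
  \<open>subdomain\<close>), and write \<open>adjoin K G\<close> for the subring generated by \<open>G\<close> over \<open>K\<close>.

  \<^bold>\<open>Dimension.\<close> Write \<open>d\<close> for the dimension, a transcendence degree. The key fact is
  \<open>independent_seq_bound\<close>: in a ring algebraic over \<open>m\<close> generators, any \<open>m + 1\<close> elements are
  dependent. It is a count. The monomials in \<open>m + 1\<close> elements with exponents below \<open>N\<close> number
  \<open>N ^ (m + 1)\<close>, whereas after clearing one common denominator they all lie in a space of dimension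
  \<open>O(N ^ m)\<close>.

  \<^bold>\<open>At least \<open>d + 1\<close> measurements.\<close> For a matrix \<open>A\<close> of \<open>d + 1\<close> indeterminate rows, the same count over
  the polynomials in the entries of \<open>A\<close> gives a nonzero polynomial with \<open>F(A, A x) = 0\<close> for all
  \<open>x\<close> in \<open>X\<close>. Take \<open>F\<close> of least degree in the values \<open>Y = A x\<close>. Differentiating the identity by the
  entry \<open>A i j\<close> gives \<open>dF/dA i j + x j * dF/dY i = 0\<close>, and by minimality some \<open>dF/dY i\<close> is not
  identically zero on the pairs \<open>(A, A x)\<close>. Hence \<open>A x\<close> determines every coordinate of \<open>x\<close>, wherever
  that single denominator does not vanish (\<open>generic_matrix_identifies\<close>).

  \<^bold>\<open>Linear closure.\<close> A generic matrix with at least \<open>d\<close> rows is injective on a \<open>d\<close>-dimensional linear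
  space. A matrix with fewer rows has a kernel there, and two points of \<open>X\<close> differing by a kernel
  vector exist because \<open>X\<close> contains a ball of its closure: for an image of a polynomial map
  this is the Jacobian criterion together with an open mapping theorem.

  \<^bold>\<open>Nonlinear closure over the complex numbers, at most \<open>d\<close> measurements.\<close> Extend the given rows to
  \<open>d\<close> rows \<open>B\<close> and put \<open>y = B x\<close>. The leading form of \<open>F\<close> shows that a general linear form \<open>z\<close> in \<open>x\<close>
  satisfies an equation of some degree \<open>N\<close> over the polynomials in \<open>y\<close> that is monic up to a
  constant and whose coefficient of \<open>z ^ i\<close> has degree at most \<open>N - i\<close>. If the minimal polynomial of
  \<open>z\<close> over the polynomials in \<open>y\<close> has degree at least two, then two points of \<open>X\<close>, one of them
  outside any prescribed hypersurface not containing \<open>X\<close>, have the same \<open>y\<close> and different \<open>z\<close>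
  (\<open>two_points_over_generic_value\<close>), which contradicts identifiability. So \<open>z\<close> is a quotient of polynomials
  in \<open>y\<close>; by the bounded equation it is affine in \<open>y\<close> (\<open>rational_function_is_affine\<close>).
  Then all coordinates of \<open>x\<close> are affine in \<open>y\<close>, and the closure of \<open>X\<close> is a linear space after all.
\<close>

section \<open>Subrings generated by a set, with degrees\<close>

definition subring :: "'a::comm_ring_1 set \<Rightarrow> bool" where
  "subring S \<longleftrightarrow> 1 \<in> S \<and> (\<forall>x\<in>S. \<forall>y\<in>S. x - y \<in> S \<and> x * y \<in> S)"

lemma subring_1: "subring S \<Longrightarrow> 1 \<in> S"
  by (simp add: subring_def)

lemma subring_diff: "subring S \<Longrightarrow> x \<in> S \<Longrightarrow> y \<in> S \<Longrightarrow> x - y \<in> S"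
  by (simp add: subring_def)

lemma subring_mult: "subring S \<Longrightarrow> x \<in> S \<Longrightarrow> y \<in> S \<Longrightarrow> x * y \<in> S"
  by (simp add: subring_def)

lemma subring_0: "subring S \<Longrightarrow> 0 \<in> S"
  using subring_diff[of S 1 1] by (simp add: subring_1)

lemma subring_uminus: "subring S \<Longrightarrow> x \<in> S \<Longrightarrow> - x \<in> S"
  using subring_diff[of S 0 x] by (simp add: subring_0)

lemma subring_add: "subring S \<Longrightarrow> x \<in> S \<Longrightarrow> y \<in> S \<Longrightarrow> x + y \<in> S"
  using subring_diff[of S x "- y"] by (simp add: subring_uminus)

lemma subring_sum: "subring S \<Longrightarrow> (\<And>i. i \<in> I \<Longrightarrow> f i \<in> S) \<Longrightarrow> sum f I \<in> S"
  by (induction I rule: infinite_finite_induct) (auto intro: subring_0 subring_add)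

lemma subring_prod: "subring S \<Longrightarrow> (\<And>i. i \<in> I \<Longrightarrow> f i \<in> S) \<Longrightarrow> prod f I \<in> S"
  by (induction I rule: infinite_finite_induct) (auto intro: subring_1 subring_mult)

lemma subring_power: "subring S \<Longrightarrow> x \<in> S \<Longrightarrow> x ^ n \<in> S"
  by (induction n) (auto intro: subring_1 subring_mult)

lemma subring_of_nat: "subring S \<Longrightarrow> of_nat n \<in> S"
  by (induction n) (auto intro: subring_0 subring_1 subring_add)

lemmas subring_closed = subring_0 subring_1 subring_diff subring_mult subring_uminus subring_add
  subring_sum subring_prod subring_power subring_of_nat

lemma subring_UNIV: "subring UNIV"
  by (simp add: subring_def)

text \<open>
  The degree refers to a presentation: \<open>a\<close> is some polynomial expression of degree at most \<open>n\<close> in the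
  elements of \<open>G\<close> with coefficients in \<open>K\<close>. Relations between the elements of \<open>G\<close> are allowed, so no
  normal form is involved.
\<close>
inductive degree_le :: "'a::comm_ring_1 set \<Rightarrow> 'a set \<Rightarrow> nat \<Rightarrow> 'a \<Rightarrow> bool" for K G where
  base: "k \<in> K \<Longrightarrow> degree_le K G 0 k"
| gen: "g \<in> G \<Longrightarrow> degree_le K G 1 g"
| add: "degree_le K G n a \<Longrightarrow> degree_le K G n b \<Longrightarrow> degree_le K G n (a + b)"
| mult: "degree_le K G m a \<Longrightarrow> degree_le K G n b \<Longrightarrow> degree_le K G (m + n) (a * b)"
| mono: "degree_le K G m a \<Longrightarrow> m \<le> n \<Longrightarrow> degree_le K G n a"

lemma degree_le_base: "k \<in> K \<Longrightarrow> degree_le K G n k"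
  using degree_le.base degree_le.mono by blast

lemma degree_le_scale: "k \<in> K \<Longrightarrow> degree_le K G n a \<Longrightarrow> degree_le K G n (k * a)"
  using degree_le.mult[of K G 0 k n a] by (simp add: degree_le.base)

lemma degree_le_sum:
  "subring K \<Longrightarrow> (\<And>i. i \<in> I \<Longrightarrow> degree_le K G n (f i)) \<Longrightarrow> degree_le K G n (sum f I)"
  by (induction I rule: infinite_finite_induct)
    (auto intro: degree_le_base subring_0 degree_le.add)

definition adjoin :: "'a::comm_ring_1 set \<Rightarrow> 'a set \<Rightarrow> 'a set" where
  "adjoin K G = {a. \<exists>n. degree_le K G n a}"

lemma adjoin_base: "K \<subseteq> adjoin K G"
  by (auto simp: adjoin_def intro: degree_le.base)

lemma adjoin_gen: "G \<subseteq> adjoin K G"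
  by (auto simp: adjoin_def intro: degree_le.gen)

lemma subring_adjoin:
  assumes "subring K"
  shows "subring (adjoin K G)"
  unfolding subring_def
proof (intro conjI ballI)
  show "1 \<in> adjoin K G"
    using adjoin_base subring_1[OF assms] by blast
next
  fix x y assume "x \<in> adjoin K G" "y \<in> adjoin K G"
  then obtain m n where mn: "degree_le K G m x" "degree_le K G n y"
    by (auto simp: adjoin_def)
  have "degree_le K G n (- 1 * y)"
    by (rule degree_le_scale[OF _ mn(2)]) (intro subring_closed assms)
  then have "degree_le K G (max m n) (x + - 1 * y)"
    using mn by (intro degree_le.add) (auto intro: degree_le.mono)
  then show "x - y \<in> adjoin K G"
    by (auto simp: adjoin_def)
  show "x * y \<in> adjoin K G"
    using degree_le.mult[OF mn] by (auto simp: adjoin_def)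
qed

lemma adjoin_least:
  assumes "subring S" "K \<subseteq> S" "G \<subseteq> S"
  shows "adjoin K G \<subseteq> S"
proof
  fix a assume "a \<in> adjoin K G"
  then obtain n where "degree_le K G n a"
    by (auto simp: adjoin_def)
  then show "a \<in> S"
    by induction (use assms in \<open>auto intro: subring_closed\<close>)
qed

lemma adjoin_mono:
  assumes "subring K'" "K \<subseteq> K'" "G \<subseteq> G'"
  shows "adjoin K G \<subseteq> adjoin K' G'"
  by (intro adjoin_least[OF subring_adjoin[OF assms(1)]] subset_trans[OF assms(2) adjoin_base]
      subset_trans[OF assms(3) adjoin_gen])

lemma adjoin_adjoin:
  assumes "subring K"
  shows "adjoin (adjoin K G) H = adjoin K (G \<union> H)"
proof
  show "adjoin (adjoin K G) H \<subseteq> adjoin K (G \<union> H)"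
    by (intro adjoin_least[OF subring_adjoin[OF assms]] adjoin_mono[OF assms])
      (use adjoin_gen[of "G \<union> H" K] in auto)
  show "adjoin K (G \<union> H) \<subseteq> adjoin (adjoin K G) H"
    using adjoin_base[of K G] adjoin_gen[of G K] adjoin_base[of "adjoin K G" H] adjoin_gen[of H "adjoin K G"]
    by (intro adjoin_least subring_adjoin assms) auto
qed

section \<open>Polynomials over a subring and algebraic elements\<close>

definition polys_over :: "'a::comm_ring_1 set \<Rightarrow> 'a poly set" where
  "polys_over S = {p. \<forall>i. coeff p i \<in> S}"

lemma subring_polys_over:
  assumes "subring S"
  shows "subring (polys_over S)"
  unfolding subring_def[of "polys_over S"]
  by (auto simp: polys_over_def coeff_mult intro!: subring_closed assms)

lemma polys_over_pCons:
  "pCons a p \<in> polys_over S \<longleftrightarrow> a \<in> S \<and> p \<in> polys_over S"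
  unfolding polys_over_def
  by (auto simp: coeff_pCons split: nat.splits)

lemma polys_over_monom: "subring S \<Longrightarrow> a \<in> S \<Longrightarrow> monom a n \<in> polys_over S"
  by (auto simp: polys_over_def intro: subring_0)

lemma polys_over_smult: "subring S \<Longrightarrow> a \<in> S \<Longrightarrow> p \<in> polys_over S \<Longrightarrow> smult a p \<in> polys_over S"
  by (auto simp: polys_over_def intro: subring_mult)

lemma polys_over_mono: "S \<subseteq> T \<Longrightarrow> polys_over S \<subseteq> polys_over T"
  by (auto simp: polys_over_def)

lemma coeff_polys_over: "p \<in> polys_over S \<Longrightarrow> coeff p i \<in> S"
  by (auto simp: polys_over_def)

lemma poly_in_subring:
  assumes "subring M" "p \<in> polys_over M" "c \<in> M"
  shows "poly p c \<in> M"
  using assms(2) by (induction p) (auto simp: polys_over_pCons intro!: subring_closed assms)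

lemma adjoin_insert_poly:
  assumes "subring K" "a \<in> adjoin K (insert c G)"
  shows "\<exists>p \<in> polys_over (adjoin K G). a = poly p c"
proof -
  let ?S = "adjoin K G"
  have S: "subring ?S"
    by (rule subring_adjoin[OF assms(1)])
  have P: "subring (polys_over ?S)"
    by (rule subring_polys_over[OF S])
  let ?T = "(\<lambda>p. poly p c) ` polys_over ?S"
  have const: "x \<in> ?S \<Longrightarrow> x \<in> ?T" for x
    using polys_over_monom[OF S, of x 0] by (auto simp: poly_monom intro!: image_eqI[of _ _ "monom x 0"])
  have "subring ?T"
    unfolding subring_def
  proof (intro conjI ballI)
    show "1 \<in> ?T" using const subring_1[OF S] by auto
  next
    fix x y assume "x \<in> ?T" "y \<in> ?T"
    then obtain p q where "p \<in> polys_over ?S" "x = poly p c" "q \<in> polys_over ?S" "y = poly q c"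
      by auto
    then have "x - y = poly (p - q) c" "x * y = poly (p * q) c" "p - q \<in> polys_over ?S" "p * q \<in> polys_over ?S"
      using subring_diff[OF P, of p q] subring_mult[OF P, of p q] by auto
    then show "x - y \<in> ?T" "x * y \<in> ?T" by blast+
  qed
  moreover have "c \<in> ?T"
    using polys_over_monom[OF S subring_1[OF S], of 1]
    by (auto simp: poly_monom intro!: image_eqI[of _ _ "monom 1 1"])
  moreover have "K \<subseteq> ?T" "G \<subseteq> ?T"
    using const adjoin_base[of K G] adjoin_gen[of G K] by blast+
  ultimately have "adjoin K (insert c G) \<subseteq> ?T"
    by (intro adjoin_least) auto
  with assms(2) show ?thesis by auto
qed

definition algebraic_over :: "'a::comm_ring_1 set \<Rightarrow> 'a \<Rightarrow> bool" where
  "algebraic_over S v \<longleftrightarrow> (\<exists>p \<in> polys_over S. p \<noteq> 0 \<and> poly p v = 0)"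

lemma algebraic_over_mono: "S \<subseteq> T \<Longrightarrow> algebraic_over S v \<Longrightarrow> algebraic_over T v"
  unfolding algebraic_over_def using polys_over_mono by blast

lemma algebraic_over_mem:
  assumes "subring S" "v \<in> S" "(1::'a::comm_ring_1) \<noteq> 0"
  shows "algebraic_over S (v::'a)"
  unfolding algebraic_over_def
proof (rule bexI[of _ "[:- v, 1:]"])
  show "[:- v, 1:] \<in> polys_over S"
    using assms subring_0[OF subring_polys_over[OF assms(1)]]
    by (auto simp: polys_over_pCons intro: subring_closed)
qed (use assms in auto)

section \<open>Modules of finite rank over a subring\<close>

text \<open>
  The set \<open>E\<close> is meant to be finite. A set serves as well as a family, since only its span matters.
\<close>
definition lin_span :: "'a::comm_ring_1 set \<Rightarrow> 'a set \<Rightarrow> 'a set" where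
  "lin_span S E = {x. \<exists>a. (\<forall>e\<in>E. a e \<in> S) \<and> x = (\<Sum>e\<in>E. a e * e)}"

lemma lin_span_0: "subring S \<Longrightarrow> 0 \<in> lin_span S E"
  by (auto simp: lin_span_def subring_0 intro!: exI[of _ "\<lambda>_. 0"])

lemma lin_span_add: "subring S \<Longrightarrow> x \<in> lin_span S E \<Longrightarrow> y \<in> lin_span S E \<Longrightarrow> x + y \<in> lin_span S E"
proof -
  assume S: "subring S" and "x \<in> lin_span S E" "y \<in> lin_span S E"
  then obtain a b where "\<forall>e\<in>E. a e \<in> S" "x = (\<Sum>e\<in>E. a e * e)" "\<forall>e\<in>E. b e \<in> S" "y = (\<Sum>e\<in>E. b e * e)"
    by (auto simp: lin_span_def)
  then show ?thesis
    using S by (auto simp: lin_span_def sum.distrib ring_distribs intro!: exI[of _ "\<lambda>e. a e + b e"] subring_add)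
qed

lemma lin_span_scale: "subring S \<Longrightarrow> s \<in> S \<Longrightarrow> x \<in> lin_span S E \<Longrightarrow> s * x \<in> lin_span S E"
proof -
  assume S: "subring S" "s \<in> S" and "x \<in> lin_span S E"
  then obtain a where "\<forall>e\<in>E. a e \<in> S" "x = (\<Sum>e\<in>E. a e * e)"
    by (auto simp: lin_span_def)
  then show ?thesis
    using S by (auto simp: lin_span_def sum_distrib_left mult.assoc intro!: exI[of _ "\<lambda>e. s * a e"] subring_mult)
qed

lemma lin_span_mem:
  assumes "subring S" "finite E" "e \<in> E"
  shows "e \<in> lin_span S E"
proof -
  have "(\<Sum>f\<in>E. (if f = e then 1 else 0) * f) = (\<Sum>f\<in>E. if f = e then e else 0)"
    by (rule sum.cong) auto
  also have "\<dots> = e" using assms by simp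
  finally show ?thesis
    using assms subring_closed(1,2)[OF assms(1)]
    by (auto simp: lin_span_def intro!: exI[of _ "\<lambda>f. if f = e then 1 else 0"])
qed

lemma lin_span_sum:
  "subring S \<Longrightarrow> (\<And>i. i \<in> I \<Longrightarrow> f i \<in> lin_span S E) \<Longrightarrow> sum f I \<in> lin_span S E"
  by (induction I rule: infinite_finite_induct) (auto intro: lin_span_0 lin_span_add)

lemma lin_span_mult_left:
  assumes "subring S" "x \<in> lin_span S A" "\<And>a. a \<in> A \<Longrightarrow> y * a \<in> lin_span S C"
  shows "y * x \<in> lin_span S C"
proof -
  obtain a where a: "\<forall>e\<in>A. a e \<in> S" and x: "x = (\<Sum>e\<in>A. a e * e)"
    using assms(2) by (auto simp: lin_span_def)
  have "y * x = (\<Sum>e\<in>A. a e * (y * e))"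
    unfolding x by (simp add: sum_distrib_left mult_ac)
  then show ?thesis
    using a assms by (auto intro!: lin_span_sum intro: lin_span_scale[OF assms(1)])
qed

lemma lin_span_mult:
  assumes "subring S" "x \<in> lin_span S A" "y \<in> lin_span S B"
    and "finite C" "\<And>a b. a \<in> A \<Longrightarrow> b \<in> B \<Longrightarrow> a * b \<in> C"
  shows "x * y \<in> lin_span S C"
proof (rule lin_span_mult_left[OF assms(1,3)])
  fix b assume b: "b \<in> B"
  have "b * x \<in> lin_span S C"
    by (rule lin_span_mult_left[OF assms(1,2)]) (use b assms in \<open>auto intro!: lin_span_mem simp: mult.commute\<close>)
  then show "x * b \<in> lin_span S C" by (simp add: mult.commute)
qed

text \<open>
  The elements of the vector space spanned by \<open>E\<close> over the fraction field of \<open>S\<close>, with the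
  denominators cleared: this replaces working in a fraction field.
\<close>
definition sat_span :: "'a::comm_ring_1 set \<Rightarrow> 'a set \<Rightarrow> 'a set" where
  "sat_span S E = {x. \<exists>s\<in>S. s \<noteq> 0 \<and> s * x \<in> lin_span S E}"

definition finite_over :: "'a::comm_ring_1 set \<Rightarrow> 'a set \<Rightarrow> bool" where
  "finite_over S M \<longleftrightarrow> (\<exists>E. finite E \<and> E \<subseteq> M \<and> M \<subseteq> sat_span S E)"

text \<open>
  Algebraic independence over \<open>K\<close>, stated one element at a time. The equivalence with the
  absence of a polynomial relation between all of the elements is
  \<open>injective_of_independent_image\<close> with \<open>independent_image_of_injective\<close>.
\<close>
definition independent_seq :: "'a::comm_ring_1 set \<Rightarrow> nat \<Rightarrow> (nat \<Rightarrow> 'a) \<Rightarrow> bool" where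
  "independent_seq K m g \<longleftrightarrow> (\<forall>i<m. \<not> algebraic_over (adjoin K (g ` {..<i})) (g i))"

text \<open>
  Minimal over the fraction field of \<open>S\<close>, but with coefficients in \<open>S\<close>, hence not monic.
\<close>
definition minimal_poly :: "'a::comm_ring_1 set \<Rightarrow> 'a \<Rightarrow> 'a poly \<Rightarrow> bool" where
  "minimal_poly S c P \<longleftrightarrow> P \<in> polys_over S \<and> P \<noteq> 0 \<and> poly P c = 0 \<and>
     (\<forall>p \<in> polys_over S. p \<noteq> 0 \<longrightarrow> poly p c = 0 \<longrightarrow> degree P \<le> degree p)"

lemma minimal_poly_exists:
  assumes "algebraic_over S c"
  obtains P where "minimal_poly S c P"
proof -
  let ?Q = "\<lambda>p. p \<in> polys_over S \<and> p \<noteq> 0 \<and> poly p c = 0"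
  obtain p where "?Q p" using assms by (auto simp: algebraic_over_def)
  then have "?Q (arg_min degree ?Q)" "\<forall>q. ?Q q \<longrightarrow> degree (arg_min degree ?Q) \<le> degree q"
    using arg_min_nat_lemma[of ?Q p degree] by auto
  then show thesis
    by (intro that[of "arg_min degree ?Q"]) (auto simp: minimal_poly_def)
qed

locale subdomain =
  fixes R :: "'a::comm_ring_1 set"
  assumes subring: "subring R"
    and domain: "x \<in> R \<Longrightarrow> y \<in> R \<Longrightarrow> x * y = 0 \<Longrightarrow> x = 0 \<or> y = 0"
    and char_0: "of_nat (Suc n) \<noteq> (0::'a)"
begin

lemma one_neq_0: "(1::'a) \<noteq> 0"
  using char_0[of 0] by simp

lemma mult_neq_0: "x \<in> R \<Longrightarrow> y \<in> R \<Longrightarrow> x \<noteq> 0 \<Longrightarrow> y \<noteq> 0 \<Longrightarrow> x * y \<noteq> 0"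
  using domain by blast

lemma power_neq_0: "x \<in> R \<Longrightarrow> x \<noteq> 0 \<Longrightarrow> x ^ n \<noteq> 0"
  by (induction n) (auto simp: one_neq_0 dest: domain[OF _ subring_power[OF subring]])

lemma prod_neq_0: "finite I \<Longrightarrow> (\<And>i. i \<in> I \<Longrightarrow> f i \<in> R \<and> f i \<noteq> 0) \<Longrightarrow> prod f I \<noteq> 0"
proof (induction I rule: finite_induct)
  case (insert i I)
  then show ?case
    using subring_prod[OF subring, of I f] mult_neq_0[of "f i" "prod f I"] by simp
qed (simp add: one_neq_0)

text \<open>
  Elimination of one equation at a time. Working over a domain avoids fractions: an equation is eliminated by
  cross-multiplication with its pivot. The lemma serves both for coefficients in a field of
  constants and for coefficients in a ring of functions.
\<close>
lemma linear_system_nontrivial_solution: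
  assumes S: "subring S" "S \<subseteq> R"
    and "finite J" "finite I" "card J < card I" "\<And>i j. i \<in> I \<Longrightarrow> j \<in> J \<Longrightarrow> a i j \<in> S"
  shows "\<exists>c. (\<forall>i\<in>I. c i \<in> S) \<and> (\<exists>i\<in>I. c i \<noteq> 0) \<and> (\<forall>j\<in>J. (\<Sum>i\<in>I. c i * a i j) = 0)"
  using assms(3-)
proof (induction J arbitrary: I a rule: finite_induct)
  case empty
  then have "I \<noteq> {}" by auto
  then show ?case
    using one_neq_0 by (intro exI[of _ "\<lambda>_. 1"]) (auto intro: subring_1[OF S(1)])
next
  case (insert j J)
  show ?case
  proof (cases "\<forall>i\<in>I. a i j = 0")
    case True
    have "\<exists>c. (\<forall>i\<in>I. c i \<in> S) \<and> (\<exists>i\<in>I. c i \<noteq> 0) \<and> (\<forall>j\<in>J. (\<Sum>i\<in>I. c i * a i j) = 0)"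
      using insert.prems insert.hyps by (intro insert.IH) auto
    then show ?thesis using True by auto
  next
    case False
    then obtain p where p: "p \<in> I" "a p j \<noteq> 0" by auto
    define I' where "I' = I - {p}"
    have I: "finite I'" "I = insert p I'" "p \<notin> I'" "card J < card I'"
      using p insert.prems insert.hyps by (auto simp: I'_def card_Diff_singleton)
    define a' where "a' i k = a p j * a i k - a i j * a p k" for i k
    have a'S: "a' i k \<in> S" if "i \<in> I'" "k \<in> J" for i k
      unfolding a'_def using that insert.prems p I by (auto intro!: subring_closed S)
    obtain c where c: "\<forall>i\<in>I'. c i \<in> S" "\<exists>i\<in>I'. c i \<noteq> 0" "\<forall>k\<in>J. (\<Sum>i\<in>I'. c i * a' i k) = 0"
      using insert.IH[OF I(1,4), of a'] a'S by blast
    define b where "b i = (if i = p then - (\<Sum>i\<in>I'. c i * a i j) else c i * a p j)" for i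
    have bsum: "(\<Sum>i\<in>I. b i * x i) = (\<Sum>i\<in>I'. c i * (a p j * x i - a i j * x p))" for x
    proof -
      have "(\<Sum>i\<in>I'. b i * x i) = (\<Sum>i\<in>I'. c i * a p j * x i)"
        using I(3) by (intro sum.cong) (auto simp: b_def)
      then have "(\<Sum>i\<in>I. b i * x i) = - (\<Sum>i\<in>I'. c i * a i j) * x p + (\<Sum>i\<in>I'. c i * a p j * x i)"
        using I by (simp add: b_def)
      then show ?thesis
        by (simp add: algebra_simps sum_subtractf sum_distrib_left sum_distrib_right)
    qed
    show ?thesis
    proof (intro exI[of _ b] conjI ballI)
      fix i assume "i \<in> I"
      then show "b i \<in> S"
        using c insert.prems p I by (auto simp: b_def intro!: subring_closed S)
    next
      obtain i where i: "i \<in> I'" "c i \<noteq> 0" using c by auto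
      then have "b i \<noteq> 0"
        using c(1) p insert.prems I(3) S mult_neq_0[of "c i" "a p j"] by (auto simp: b_def)
      then show "\<exists>i\<in>I. b i \<noteq> 0" using i I by auto
    next
      fix k assume "k \<in> insert j J"
      then show "(\<Sum>i\<in>I. b i * a i k) = 0"
        unfolding bsum using c(3) by (auto simp: a'_def mult.commute)
    qed
  qed
qed

lemma sat_span_add:
  assumes S: "subring S" "S \<subseteq> R" and "x \<in> sat_span S E" "y \<in> sat_span S E"
  shows "x + y \<in> sat_span S E"
proof -
  obtain s t where st: "s \<in> S" "s \<noteq> 0" "s * x \<in> lin_span S E" "t \<in> S" "t \<noteq> 0" "t * y \<in> lin_span S E"
    using assms by (auto simp: sat_span_def)
  have "(s * t) * (x + y) = t * (s * x) + s * (t * y)"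
    by (simp add: algebra_simps)
  then have "(s * t) * (x + y) \<in> lin_span S E"
    using st S by (auto intro!: lin_span_add lin_span_scale)
  moreover have "s * t \<in> S" "s * t \<noteq> 0"
    using st S mult_neq_0[of s t] by (auto intro: subring_mult)
  ultimately show ?thesis by (auto simp: sat_span_def)
qed

lemma sat_span_scale:
  assumes S: "subring S" "t \<in> S" and "x \<in> sat_span S E"
  shows "t * x \<in> sat_span S E"
proof -
  obtain s where s: "s \<in> S" "s \<noteq> 0" "s * x \<in> lin_span S E"
    using assms by (auto simp: sat_span_def)
  have "s * (t * x) = t * (s * x)" by (simp add: algebra_simps)
  then have "s * (t * x) \<in> lin_span S E"
    using lin_span_scale[OF S s(3)] by metis
  then show ?thesis
    using s unfolding sat_span_def by blast
qed

lemma sat_span_cancel: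
  assumes S: "subring S" "S \<subseteq> R" and "s \<in> S" "s \<noteq> 0" "s * x \<in> sat_span S E"
  shows "x \<in> sat_span S E"
proof -
  obtain t where t: "t \<in> S" "t \<noteq> 0" "t * (s * x) \<in> lin_span S E"
    using assms by (auto simp: sat_span_def)
  have "t * s * x \<in> lin_span S E"
    using t by (simp add: mult.assoc)
  moreover have "t * s \<in> S" "t * s \<noteq> 0"
    using t assms mult_neq_0[of t s] by (auto intro: subring_mult)
  ultimately show ?thesis
    unfolding sat_span_def by blast
qed

lemma lin_span_sat: "subring S \<Longrightarrow> x \<in> lin_span S E \<Longrightarrow> x \<in> sat_span S E"
  using one_neq_0 by (auto simp: sat_span_def intro!: bexI[of _ 1] subring_1)

lemma sat_span_mem: "subring S \<Longrightarrow> finite E \<Longrightarrow> e \<in> E \<Longrightarrow> e \<in> sat_span S E"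
  by (intro lin_span_sat lin_span_mem)

lemma sat_span_sum:
  "subring S \<Longrightarrow> S \<subseteq> R \<Longrightarrow> (\<And>i. i \<in> I \<Longrightarrow> f i \<in> sat_span S E) \<Longrightarrow> sum f I \<in> sat_span S E"
  by (induction I rule: infinite_finite_induct) (auto intro: lin_span_sat lin_span_0 sat_span_add)

lemma sat_span_mult:
  assumes S: "subring S" "S \<subseteq> R" and "x \<in> sat_span S E" "\<And>e. e \<in> E \<Longrightarrow> v * e \<in> sat_span S E'"
  shows "v * x \<in> sat_span S E'"
proof -
  obtain s a where s: "s \<in> S" "s \<noteq> 0" "\<forall>e\<in>E. a e \<in> S" "s * x = (\<Sum>e\<in>E. a e * e)"
    using assms by (auto simp: sat_span_def lin_span_def)
  have "s * (v * x) = v * (s * x)" by (simp add: algebra_simps)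
  also have "\<dots> = (\<Sum>e\<in>E. a e * (v * e))"
    unfolding s(4) by (simp add: sum_distrib_left mult_ac)
  also have "\<dots> \<in> sat_span S E'"
    using s by (intro sat_span_sum[OF S] sat_span_scale[OF S(1)] assms(4)) auto
  finally show ?thesis using s S by (auto intro: sat_span_cancel)
qed

lemma finite_over_refl:
  assumes "subring S" "S \<subseteq> R"
  shows "finite_over S S"
proof -
  have "s \<in> lin_span S {1}" if "s \<in> S" for s
    using that by (auto simp: lin_span_def intro!: exI[of _ "\<lambda>_. s"])
  then show ?thesis
    unfolding finite_over_def
    by (intro exI[of _ "{1}"]) (auto intro: subring_1[OF assms(1)] lin_span_sat[OF assms(1)])
qed

text \<open>
  More powers of \<open>v\<close> than spanning elements are linearly dependent.
\<close>
lemma finite_over_imp_algebraic: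
  assumes S: "subring S" "S \<subseteq> R" and M: "subring M" "finite_over S M" and v: "v \<in> M"
  shows "algebraic_over S v"
proof -
  obtain E where E: "finite E" "M \<subseteq> sat_span S E"
    using M by (auto simp: finite_over_def)
  have "\<forall>i. \<exists>s a. s \<in> S \<and> s \<noteq> 0 \<and> (\<forall>e\<in>E. a e \<in> S) \<and> s * v ^ i = (\<Sum>e\<in>E. a e * e)"
    using E subring_power[OF M(1) v] by (force simp: sat_span_def lin_span_def)
  then obtain s a where sa: "\<And>i. s i \<in> S" "\<And>i. s i \<noteq> 0" "\<And>i e. e \<in> E \<Longrightarrow> a i e \<in> S"
      "\<And>i. s i * v ^ i = (\<Sum>e\<in>E. a i e * e)"
    by metis
  obtain c where c: "\<forall>i\<in>{..card E}. c i \<in> S" "\<exists>i\<in>{..card E}. c i \<noteq> 0"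
      "\<forall>e\<in>E. (\<Sum>i\<in>{..card E}. c i * a i e) = 0"
    using linear_system_nontrivial_solution[OF S E(1), of "{..card E}" a] sa by auto
  define p where "p = (\<Sum>i\<le>card E. monom (c i * s i) i)"
  have coeff: "coeff p i = (if i \<le> card E then c i * s i else 0)" for i
    by (simp add: p_def coeff_sum)
  have "poly p v = (\<Sum>i\<le>card E. c i * (s i * v ^ i))"
    by (simp add: p_def poly_sum poly_monom mult.assoc)
  also have "\<dots> = (\<Sum>i\<le>card E. \<Sum>e\<in>E. c i * a i e * e)"
    unfolding sa by (simp add: sum_distrib_left mult.assoc)
  also have "\<dots> = (\<Sum>e\<in>E. (\<Sum>i\<le>card E. c i * a i e) * e)"
    by (subst sum.swap) (simp add: sum_distrib_right)
  also have "\<dots> = 0" using c by simp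
  finally have "poly p v = 0" .
  moreover have "p \<in> polys_over S"
    using c sa by (auto simp: polys_over_def coeff intro!: subring_closed S)
  moreover obtain i where "i \<le> card E" "c i \<noteq> 0" using c by auto
  then have "coeff p i \<noteq> 0"
    using c(1) sa(1,2) S mult_neq_0[of "c i" "s i"] by (simp add: coeff subset_iff)
  then have "p \<noteq> 0" by auto
  ultimately show ?thesis by (auto simp: algebraic_over_def)
qed

text \<open>
  A nonzero algebraic element divides a nonzero element of \<open>S\<close>: cancel \<open>v\<close> from an equation for \<open>v\<close>
  until its constant term is nonzero. This is how a condition that a function does not vanish is
  moved down to the base ring.
\<close>
lemma algebraic_over_inverse:
  assumes S: "subring S" "S \<subseteq> R" and v: "v \<in> R" "v \<noteq> 0" "algebraic_over S v"
  shows "\<exists>q \<in> polys_over S. v * poly q v \<in> S \<and> v * poly q v \<noteq> 0"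
proof -
  obtain p where "p \<in> polys_over S" "p \<noteq> 0" "poly p v = 0"
    using v by (auto simp: algebraic_over_def)
  then show ?thesis
  proof (induction p)
    case (pCons a p)
    then have a: "a \<in> S" "p \<in> polys_over S" by (auto simp: polys_over_pCons)
    show ?case
    proof (cases "a = 0")
      case True
      have "poly p v \<in> R"
        using a S v polys_over_mono[of S R] by (intro poly_in_subring subring) auto
      then have "poly p v = 0"
        using pCons True v domain[of v "poly p v"] by auto
      then show ?thesis using pCons True a by auto
    next
      case False
      have "v * poly (- p) v = a"
        using pCons.prems(3) by (simp add: neg_eq_iff_add_eq_0 add.commute)
      then show ?thesis
        using False a subring_uminus[OF subring_polys_over[OF S(1)], of p]
        by (intro bexI[of _ "- p"]) auto
    qed
  qed auto
qed

text \<open>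
  Transitivity of algebraic extensions. With \<open>r\<close> the degree of an equation of \<open>c\<close> over \<open>M\<close>, the products of a spanning
  set of \<open>M\<close> with the powers of \<open>c\<close> below \<open>r\<close> span; the leading coefficient is
  inverted by means of \<open>algebraic_over_inverse\<close>.
\<close>
lemma finite_over_adjoin_algebraic:
  assumes S: "subring S" "S \<subseteq> M" and M: "subring M" "M \<subseteq> R" "finite_over S M"
    and c: "algebraic_over M c"
  shows "finite_over S (adjoin M {c})"
proof -
  have SR: "S \<subseteq> R" using S M by auto
  obtain E where E: "finite E" "E \<subseteq> M" "M \<subseteq> sat_span S E"
    using M by (auto simp: finite_over_def)
  obtain p where p: "p \<in> polys_over M" "p \<noteq> 0" "poly p c = 0"
    using c by (auto simp: algebraic_over_def)
  define r where "r = degree p"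
  define l where "l = coeff p r"
  have l: "l \<in> M" "l \<noteq> 0"
    using p by (auto simp: l_def r_def polys_over_def)
  have "algebraic_over S l"
    using finite_over_imp_algebraic[OF S(1) SR M(1,3)] l by auto
  then obtain q where q: "q \<in> polys_over S" "l * poly q l \<in> S" "l * poly q l \<noteq> 0"
    using algebraic_over_inverse[OF S(1) SR] l M by blast
  define w where "w = poly q l"
  have w: "w \<in> M" "l * w \<in> S" "l * w \<noteq> 0"
    using q l S polys_over_mono[OF S(2)] by (auto simp: w_def intro!: poly_in_subring M)
  have r0: "r > 0"
  proof (rule ccontr)
    assume "\<not> r > 0"
    then have "poly p c = l"
      by (simp add: poly_altdef l_def r_def)
    then show False using p l by simp
  qed
  define E' where "E' = (\<lambda>(e, i). e * c ^ i) ` (E \<times> {..<r})"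
  have E': "finite E'" using E by (simp add: E'_def)
  have low: "m * c ^ i \<in> sat_span S E'" if "m \<in> M" "i < r" for m i
  proof -
    have "c ^ i * m \<in> sat_span S E'"
    proof (rule sat_span_mult[OF S(1) SR])
      show "m \<in> sat_span S E" using that E by auto
    next
      fix e assume "e \<in> E"
      then have "e * c ^ i \<in> E'" using that by (auto simp: E'_def)
      then show "c ^ i * e \<in> sat_span S E'"
        by (subst mult.commute) (rule sat_span_mem[OF S(1) E'])
    qed
    then show ?thesis by (simp add: mult.commute)
  qed
  have top: "m * c ^ r \<in> sat_span S E'" if m: "m \<in> M" for m
  proof -
    have "(\<Sum>i<r. coeff p i * c ^ i) + l * c ^ r = 0"
      using p(3) unfolding poly_altdef r_def[symmetric] l_def
      by (simp add: lessThan_Suc_atMost[symmetric] del: lessThan_Suc_atMost)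
    then have "l * c ^ r = - (\<Sum>i<r. coeff p i * c ^ i)"
      by (simp add: eq_neg_iff_add_eq_0 add.commute)
    moreover have "(l * w) * (m * c ^ r) = (w * m) * (l * c ^ r)"
      by (simp add: mult_ac)
    ultimately have "(l * w) * (m * c ^ r) = (w * m) * - (\<Sum>i<r. coeff p i * c ^ i)"
      by simp
    also have "\<dots> = (\<Sum>i<r. (- (w * m * coeff p i)) * c ^ i)"
      by (simp add: sum_distrib_left sum_negf mult.assoc)
    also have "\<dots> \<in> sat_span S E'"
      using m w p by (intro sat_span_sum[OF S(1) SR] low)
        (auto intro!: subring_closed M simp: polys_over_def)
    finally show ?thesis
      using w by (auto intro: sat_span_cancel[OF S(1) SR])
  qed
  have step: "c * x \<in> sat_span S E'" if "x \<in> sat_span S E'" for x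
  proof (rule sat_span_mult[OF S(1) SR that])
    fix e' assume "e' \<in> E'"
    then obtain e i where e: "e \<in> E" "i < r" "e' = e * c ^ i"
      by (auto simp: E'_def)
    have "e * c ^ Suc i \<in> sat_span S E'"
      using low[of e "Suc i"] top[of e] e E
      by (cases "Suc i = r") (simp_all add: subset_iff del: power_Suc)
    moreover have "c * e' = e * c ^ Suc i"
      unfolding e(3) by (simp add: mult.left_commute)
    ultimately show "c * e' \<in> sat_span S E'" by simp
  qed
  have all: "m * c ^ k \<in> sat_span S E'" if "m \<in> M" for m k
  proof (induction k)
    case 0
    then show ?case using low[of m 0] that r0 by auto
  next
    case (Suc k)
    then show ?case using step[OF Suc] by (simp add: algebra_simps)
  qed
  have "adjoin M {c} \<subseteq> sat_span S E'"
  proof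
    fix x assume "x \<in> adjoin M {c}"
    then obtain f where f: "f \<in> polys_over (adjoin M {})" "x = poly f c"
      using adjoin_insert_poly[OF M(1), of x c "{}"] by auto
    have "adjoin M {} = M"
      using adjoin_least[OF M(1), of M "{}"] adjoin_base[of M "{}"] by auto
    then show "x \<in> sat_span S E'"
      using f unfolding f(2) poly_altdef
      by (intro sat_span_sum[OF S(1) SR] all) (auto simp: polys_over_def)
  qed
  moreover have "E' \<subseteq> adjoin M {c}"
  proof
    fix x assume "x \<in> E'"
    then obtain e i where e: "e \<in> E" "x = e * c ^ i"
      by (auto simp: E'_def)
    have "e \<in> adjoin M {c}" "c \<in> adjoin M {c}"
      using e(1) E(2) adjoin_base[of M "{c}"] adjoin_gen[of "{c}" M] by auto
    then show "x \<in> adjoin M {c}"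
      unfolding e(2) using subring_adjoin[OF M(1)] by (simp add: subring_mult subring_power)
  qed
  ultimately show ?thesis
    using E' by (auto simp: finite_over_def)
qed

end

section \<open>The transcendence degree bound\<close>

text \<open>
  The bound \<open>n\<close> is on each exponent separately, which makes the count a plain power.
\<close>
definition monomials :: "'a::comm_ring_1 set \<Rightarrow> nat \<Rightarrow> 'a set" where
  "monomials B n = (\<lambda>\<beta>. \<Prod>b\<in>B. b ^ \<beta> b) ` (B \<rightarrow>\<^sub>E {..n})"

lemma monomials_iff: "\<mu> \<in> monomials B n \<longleftrightarrow> (\<exists>\<beta>. (\<forall>b\<in>B. \<beta> b \<le> n) \<and> \<mu> = (\<Prod>b\<in>B. b ^ \<beta> b))"
proof
  assume "\<exists>\<beta>. (\<forall>b\<in>B. \<beta> b \<le> n) \<and> \<mu> = (\<Prod>b\<in>B. b ^ \<beta> b)"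
  then obtain \<beta> where "\<forall>b\<in>B. \<beta> b \<le> n" "\<mu> = (\<Prod>b\<in>B. b ^ \<beta> b)" by auto
  then show "\<mu> \<in> monomials B n"
    unfolding monomials_def by (intro image_eqI[of _ _ "restrict \<beta> B"]) (auto intro: prod.cong)
qed (auto simp: monomials_def)

lemma finite_monomials: "finite B \<Longrightarrow> finite (monomials B n)"
  by (auto simp: monomials_def intro: finite_PiE)

lemma card_monomials_le: "finite B \<Longrightarrow> card (monomials B n) \<le> Suc n ^ card B"
  unfolding monomials_def
  by (rule order.trans[OF card_image_le]) (auto simp: card_PiE intro: finite_PiE)

lemma degree_le_imp_span_monomials:
  assumes K: "subring K" and B: "finite B" and "degree_le K B n a"
  shows "a \<in> lin_span K (monomials B n)"
  using assms(3)
proof induction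
  case (base k)
  have "1 \<in> monomials B 0"
    by (auto simp: monomials_iff intro!: exI[of _ "\<lambda>_. 0"])
  then have "1 \<in> lin_span K (monomials B 0)"
    by (intro lin_span_mem[OF K finite_monomials[OF B]])
  from lin_span_scale[OF K base this] show ?case by simp
next
  case (gen g)
  have "(\<Prod>b\<in>B. b ^ (if b = g then 1 else 0)) = (\<Prod>b\<in>B. if b = g then b else 1)"
    by (rule prod.cong) auto
  also have "\<dots> = g" using gen B by simp
  finally have "g \<in> monomials B 1"
    by (auto simp: monomials_iff intro!: exI[of _ "\<lambda>b. if b = g then 1 else 0"])
  then show ?case
    by (intro lin_span_mem[OF K finite_monomials[OF B]])
next
  case (add n a b)
  then show ?case by (intro lin_span_add[OF K])
next
  case (mult m a n b)
  show ?case
  proof (rule lin_span_mult[OF K mult.IH finite_monomials[OF B]])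
    fix x y assume "x \<in> monomials B m" "y \<in> monomials B n"
    then obtain \<beta> \<gamma> where "\<forall>b\<in>B. \<beta> b \<le> m" "x = (\<Prod>b\<in>B. b ^ \<beta> b)" "\<forall>b\<in>B. \<gamma> b \<le> n" "y = (\<Prod>b\<in>B. b ^ \<gamma> b)"
      by (auto simp: monomials_iff)
    then show "x * y \<in> monomials B (m + n)"
      unfolding monomials_iff
      by (intro exI[of _ "\<lambda>b. \<beta> b + \<gamma> b"]) (auto simp: power_add prod.distrib intro: add_mono)
  qed
next
  case (mono m a n)
  have "monomials B m \<subseteq> monomials B n"
  proof
    fix x assume "x \<in> monomials B m"
    then obtain \<beta> where "\<forall>b\<in>B. \<beta> b \<le> m" "x = (\<Prod>b\<in>B. b ^ \<beta> b)" by (auto simp: monomials_iff)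
    then show "x \<in> monomials B n"
      unfolding monomials_iff using mono.hyps(2) by (intro exI[of _ \<beta>]) auto
  qed
  then have "1 * a \<in> lin_span K (monomials B n)"
    using mono.IH by (intro lin_span_mult_left[OF K mono.IH] lin_span_mem[OF K finite_monomials[OF B]]) auto
  then show ?case by simp
qed

lemma degree_le_bounded_on_finite:
  assumes "finite Y" "Y \<subseteq> adjoin K G"
  shows "\<exists>\<kappa>. \<forall>y\<in>Y. degree_le K G \<kappa> y"
  using assms
proof (induction Y rule: finite_induct)
  case (insert y Y)
  then obtain \<kappa> n where "\<forall>y\<in>Y. degree_le K G \<kappa> y" "degree_le K G n y"
    by (auto simp: adjoin_def)
  then show ?case
    by (intro exI[of _ "max \<kappa> n"]) (auto intro: degree_le.mono)
qed auto

lemma independent_seq_mono: "independent_seq K m g \<Longrightarrow> n \<le> m \<Longrightarrow> independent_seq K n g"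
  by (auto simp: independent_seq_def)

lemma independent_seq_Suc:
  "independent_seq K (Suc m) g \<longleftrightarrow> independent_seq K m g \<and> \<not> algebraic_over (adjoin K (g ` {..<m})) (g m)"
  by (auto simp: independent_seq_def less_Suc_eq)

lemma independent_seq_cong:
  assumes "\<And>i. i < n \<Longrightarrow> g i = h i"
  shows "independent_seq K n g \<longleftrightarrow> independent_seq K n h"
proof -
  have "g ` {..<i} = h ` {..<i}" if "i < n" for i
    using that assms by (intro image_cong) auto
  then show ?thesis using assms by (auto simp: independent_seq_def)
qed

text \<open>
  Read a vanishing sum as a polynomial in the last element \<open>g m\<close>; its coefficients vanish because
  \<open>g m\<close> is not algebraic over the earlier ones.
\<close>
lemma independent_seq_monomials:
  assumes K: "subring K" and "independent_seq K m g"
    and "\<And>\<alpha>. \<alpha> \<in> {..<m} \<rightarrow>\<^sub>E {..<N} \<Longrightarrow> c \<alpha> \<in> K"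
    and "(\<Sum>\<alpha> \<in> {..<m} \<rightarrow>\<^sub>E {..<N}. c \<alpha> * (\<Prod>i<m. g i ^ \<alpha> i)) = 0"
  shows "\<forall>\<alpha> \<in> {..<m} \<rightarrow>\<^sub>E {..<N}. c \<alpha> = 0"
  using assms(2-)
proof (induction m arbitrary: c)
  case (Suc m)
  let ?B = "{..<m} \<rightarrow>\<^sub>E {..<N}"
  let ?S = "adjoin K (g ` {..<m})"
  have ind: "independent_seq K m g" "\<not> algebraic_over ?S (g m)"
    using Suc.prems(1) by (auto simp: independent_seq_Suc)
  have box: "{..<Suc m} \<rightarrow>\<^sub>E {..<N} = (\<lambda>(j, \<alpha>). \<alpha>(m := j)) ` ({..<N} \<times> ?B)"
    unfolding lessThan_Suc by (rule PiE_insert_eq)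
  have inj: "inj_on (\<lambda>(j, \<alpha>). \<alpha>(m := j)) ({..<N} \<times> ?B)"
    by (rule inj_combinator) auto
  define q where "q j = (\<Sum>\<alpha>\<in>?B. c (\<alpha>(m := j)) * (\<Prod>i<m. g i ^ \<alpha> i))" for j
  have cK: "c (\<alpha>(m := j)) \<in> K" if "j < N" "\<alpha> \<in> ?B" for j \<alpha>
  proof (rule Suc.prems(2))
    show "\<alpha>(m := j) \<in> {..<Suc m} \<rightarrow>\<^sub>E {..<N}"
      unfolding box by (rule image_eqI[of _ _ "(j, \<alpha>)"]) (use that in auto)
  qed
  have "0 = (\<Sum>(j, \<alpha>) \<in> {..<N} \<times> ?B. c (\<alpha>(m := j)) * (\<Prod>i<Suc m. g i ^ (\<alpha>(m := j)) i))"
    using Suc.prems(3) unfolding box sum.reindex[OF inj] by (simp add: case_prod_beta)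
  also have "\<dots> = (\<Sum>j<N. \<Sum>\<alpha>\<in>?B. c (\<alpha>(m := j)) * (\<Prod>i<Suc m. g i ^ (\<alpha>(m := j)) i))"
    by (rule sum.cartesian_product[symmetric])
  also have "\<dots> = (\<Sum>j<N. q j * g m ^ j)"
  proof (rule sum.cong[OF refl])
    fix j
    have "(\<Prod>i<m. g i ^ (\<alpha>(m := j)) i) = (\<Prod>i<m. g i ^ \<alpha> i)" for \<alpha>
      by (rule prod.cong) auto
    then show "(\<Sum>\<alpha>\<in>?B. c (\<alpha>(m := j)) * (\<Prod>i<Suc m. g i ^ (\<alpha>(m := j)) i)) = q j * g m ^ j"
      by (simp add: q_def sum_distrib_right mult.assoc)
  qed
  finally have sum0: "(\<Sum>j<N. q j * g m ^ j) = 0" by simp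
  have qS: "q j \<in> ?S" if "j < N" for j
    unfolding q_def
  proof (intro subring_sum subring_mult subring_prod subring_power subring_adjoin K)
    fix \<alpha> assume "\<alpha> \<in> ?B"
    then show "c (\<alpha>(m := j)) \<in> ?S" using cK[OF that] adjoin_base by blast
  next
    fix i assume "i \<in> {..<m}"
    then have "g i \<in> g ` {..<m}" by auto
    then show "g i \<in> ?S" using adjoin_gen[of "g ` {..<m}" K] by auto
  qed
  define p where "p = (\<Sum>j<N. monom (q j) j)"
  have coeff: "coeff p j = (if j < N then q j else 0)" for j
    by (simp add: p_def coeff_sum)
  have "p \<in> polys_over ?S"
    using qS subring_0[OF subring_adjoin[OF K]] by (auto simp: polys_over_def coeff)
  moreover have "poly p (g m) = 0"
    using sum0 by (simp add: p_def poly_sum poly_monom)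
  ultimately have "p = 0"
    using ind by (auto simp: algebraic_over_def)
  then have q0: "q j = 0" if "j < N" for j
    using coeff[of j] that by simp
  show ?case
  proof
    fix \<alpha> assume "\<alpha> \<in> {..<Suc m} \<rightarrow>\<^sub>E {..<N}"
    then obtain j \<beta> where "j < N" "\<beta> \<in> ?B" "\<alpha> = \<beta>(m := j)"
      unfolding box by auto
    then show "c \<alpha> = 0"
      using Suc.IH[OF ind(1), of "\<lambda>\<beta>. c (\<beta>(m := j))"] cK q0[of j] by (auto simp: q_def)
  qed
qed auto

context subdomain
begin

lemma independent_seq_inj_on:
  fixes g :: "nat \<Rightarrow> 'a"
  assumes "subring K" "independent_seq K m g"
  shows "inj_on g {..<m}"
proof (rule linorder_inj_onI)
  fix i j assume ij: "i < j" "j \<in> {..<m}"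
  then have "g i \<in> adjoin K (g ` {..<j})"
    using adjoin_gen[of "g ` {..<j}" K] by auto
  then have "algebraic_over (adjoin K (g ` {..<j})) (g i)"
    by (intro algebraic_over_mem subring_adjoin assms(1) one_neq_0)
  then show "g i \<noteq> g j"
    using assms(2) ij by (auto simp: independent_seq_def)
qed auto

text \<open>
  Greedy choice: an element of \<open>G\<close> is appended when it is not algebraic over those chosen so far.
\<close>
lemma extend_to_transcendence_basis:
  fixes g0 :: "nat \<Rightarrow> 'a"
  assumes K: "subring K" and "finite G" "independent_seq K m0 g0"
  shows "\<exists>m g. m0 \<le> m \<and> (\<forall>i<m0. g i = g0 i) \<and> (\<forall>i. m0 \<le> i \<and> i < m \<longrightarrow> g i \<in> G) \<and>
    independent_seq K m g \<and> (\<forall>c\<in>G. algebraic_over (adjoin K (g ` {..<m})) c)"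
  using assms(2)
proof (induction G rule: finite_induct)
  case empty
  then show ?case using assms(3) by (intro exI[of _ m0] exI[of _ g0]) auto
next
  case (insert c G)
  then obtain m g where g: "m0 \<le> m" "\<forall>i<m0. g i = g0 i" "\<forall>i. m0 \<le> i \<and> i < m \<longrightarrow> g i \<in> G"
    "independent_seq K m g" "\<forall>c\<in>G. algebraic_over (adjoin K (g ` {..<m})) c"
    by blast
  show ?case
  proof (cases "algebraic_over (adjoin K (g ` {..<m})) c")
    case True
    then show ?thesis using g by (intro exI[of _ m] exI[of _ g]) auto
  next
    case False
    define h where "h = g(m := c)"
    have img: "h ` {..<m} = g ` {..<m}" "h ` {..<Suc m} = insert c (g ` {..<m})"
      by (auto simp: h_def lessThan_Suc)
    have img': "h ` {..<i} = g ` {..<i}" if "i < m" for i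
      using that by (auto simp: h_def)
    have "independent_seq K m h"
      unfolding independent_seq_def[of K m h]
    proof (intro allI impI)
      fix i assume "i < m"
      then show "\<not> algebraic_over (adjoin K (h ` {..<i})) (h i)"
        using g(4) img'[of i] by (auto simp: independent_seq_def h_def)
    qed
    then have "independent_seq K (Suc m) h"
      using False by (simp add: independent_seq_Suc img) (simp add: h_def)
    moreover have "algebraic_over (adjoin K (h ` {..<Suc m})) x" if "x \<in> insert c G" for x
    proof (cases "x = c")
      case True
      then show ?thesis
        using adjoin_gen[of "insert c (g ` {..<m})" K] unfolding img
        by (intro algebraic_over_mem subring_adjoin K one_neq_0) auto
    next
      case False
      then have "algebraic_over (adjoin K (g ` {..<m})) x" using g that by auto
      then show ?thesis
        unfolding img by (rule algebraic_over_mono[rotated]) (intro adjoin_mono K, auto)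
    qed
    moreover have "m0 \<le> Suc m" "\<forall>i<m0. h i = g0 i" "\<forall>i. m0 \<le> i \<and> i < Suc m \<longrightarrow> h i \<in> insert c G"
      using g(1-3) by (auto simp: h_def less_Suc_eq)
    ultimately show ?thesis by blast
  qed
qed

text \<open>
  The iterated form of \<open>finite_over_adjoin_algebraic\<close>. The base \<open>S\<close> stays fixed while \<open>H\<close> grows, so
  that towers of algebraic extensions can be climbed.
\<close>
lemma finite_over_adjoin_finite:
  assumes K: "subring K" and S: "subring S" "S \<subseteq> adjoin K H"
    and R: "adjoin K (H \<union> E) \<subseteq> R" and "finite_over S (adjoin K H)"
    and "finite E" "\<And>c. c \<in> E \<Longrightarrow> algebraic_over (adjoin K H) c"
  shows "finite_over S (adjoin K (H \<union> E))"
  using assms(6,4,7)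
proof (induction E rule: finite_induct)
  case (insert c E)
  let ?M = "adjoin K (H \<union> E)"
  have MR: "?M \<subseteq> R"
    using adjoin_mono[OF K, of K "H \<union> E" "H \<union> insert c E"] insert.prems(1) by blast
  have HM: "adjoin K H \<subseteq> ?M"
    by (rule adjoin_mono[OF K]) auto
  have "finite_over S (adjoin ?M {c})"
  proof (rule finite_over_adjoin_algebraic)
    show "finite_over S ?M" using MR insert by auto
    show "algebraic_over ?M c"
      using insert.prems(2)[of c] HM by (auto intro: algebraic_over_mono)
  qed (use S HM MR subring_adjoin[OF K] in auto)
  then show ?case by (simp add: adjoin_adjoin[OF K])
qed (use assms in auto)

text \<open>
  The count described at the top. Let \<open>D\<close> be a denominator such that multiplication by \<open>D * g i\<close> maps
  the spanning set \<open>E\<close> to combinations of \<open>E\<close> with coefficients of bounded degree \<open>\<kappa>\<close> in \<open>B\<close>. Then \<open>D ^ Suc Q\<close> times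
  any monomial of total degree at most \<open>Q\<close> has coefficients of degree at most \<open>\<kappa> * Suc Q\<close>, and these
  are combinations over \<open>K\<close> of \<open>O(Q ^ card B)\<close> monomials in \<open>B\<close>.
\<close>
lemma independent_seq_bound:
  assumes K: "subring K" "K \<subseteq> R" and B: "finite B" "adjoin K B \<subseteq> M"
    and M: "subring M" "M \<subseteq> R" and fin: "finite_over (adjoin K B) M"
    and ind: "independent_seq K m g" and gM: "\<And>i. i < m \<Longrightarrow> g i \<in> M"
  shows "m \<le> card B"
proof (rule ccontr)
  assume "\<not> m \<le> card B"
  define n where "n = Suc (card B)"
  have nm: "n \<le> m" using \<open>\<not> m \<le> card B\<close> by (simp add: n_def)
  define S where "S = adjoin K B"
  have S: "subring S" "S \<subseteq> R" "S \<subseteq> M"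
    using subring_adjoin[OF K(1)] B M by (auto simp: S_def)
  obtain E where E: "finite E" "E \<subseteq> M" "M \<subseteq> sat_span S E"
    using fin by (auto simp: finite_over_def S_def)
  have "\<forall>x\<in>M. \<exists>s a. s \<in> S \<and> s \<noteq> 0 \<and> (\<forall>e\<in>E. a e \<in> S) \<and> s * x = (\<Sum>e\<in>E. a e * e)"
    using E by (force simp: sat_span_def lin_span_def)
  then obtain s a where sa: "\<And>x. x \<in> M \<Longrightarrow> s x \<in> S" "\<And>x. x \<in> M \<Longrightarrow> s x \<noteq> 0"
      "\<And>x e. x \<in> M \<Longrightarrow> e \<in> E \<Longrightarrow> a x e \<in> S" "\<And>x. x \<in> M \<Longrightarrow> s x * x = (\<Sum>e\<in>E. a x e * e)"
    by metis
  \<comment> \<open>The unit is included to start the induction: it provides \<open>D * 1\<close> as a combination of \<open>E\<close>.\<close>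
  define X where "X = insert 1 ((\<lambda>(i, e). g i * e) ` ({..<n} \<times> E))"
  have X: "finite X" "X \<subseteq> M"
    using E gM nm by (auto simp: X_def intro!: subring_1 M subring_mult[OF M(1)])
  define D where "D = (\<Prod>x\<in>X. s x)"
  have D: "D \<in> S" "D \<noteq> 0"
    using X sa(1,2) S unfolding D_def by (auto intro!: subring_prod S(1)) (metis (no_types, lifting) prod_neq_0 subsetD)
  define b where "b x e = (\<Prod>y\<in>X - {x}. s y) * a x e" for x e
  have b: "b x e \<in> S" if "x \<in> X" "e \<in> E" for x e
    unfolding b_def using that X sa by (auto intro!: subring_mult subring_prod S(1))
  have Dx: "D * x = (\<Sum>e\<in>E. b x e * e)" if x: "x \<in> X" for x
  proof -
    have "D * x = (\<Prod>y\<in>X - {x}. s y) * (s x * x)"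
      unfolding D_def using prod.remove[OF X(1) x, of s] by (simp add: mult_ac)
    also have "\<dots> = (\<Sum>e\<in>E. b x e * e)"
      using sa(4)[of x] X x by (auto simp: b_def sum_distrib_left mult.assoc)
    finally show ?thesis .
  qed
  have "finite (insert D ((\<lambda>(x, e). b x e) ` (X \<times> E)))" "insert D ((\<lambda>(x, e). b x e) ` (X \<times> E)) \<subseteq> adjoin K B"
    using X E D b by (auto simp: S_def)
  from degree_le_bounded_on_finite[OF this] obtain \<kappa>
    where \<kappa>: "degree_le K B \<kappa> D" "\<And>x e. x \<in> X \<Longrightarrow> e \<in> E \<Longrightarrow> degree_le K B \<kappa> (b x e)"
    by force
  \<comment> \<open>The filtration: each factor \<open>D\<close>, with or without a factor \<open>g i\<close>, raises the level by one.\<close>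
  define T where "T j = {x. \<exists>f. (\<forall>e\<in>E. degree_le K B (\<kappa> * j) (f e)) \<and> x = (\<Sum>e\<in>E. f e * e)}" for j
  have T1: "D \<in> T 1"
    unfolding T_def using \<kappa>(2)[of 1] Dx[of 1] by (auto simp: X_def intro!: exI[of _ "b 1"])
  have Tg: "D * (g i * x) \<in> T (Suc j)" if xT: "x \<in> T j" and "i < n" for x i j
  proof -
    obtain f where f: "\<forall>e\<in>E. degree_le K B (\<kappa> * j) (f e)" "x = (\<Sum>e\<in>E. f e * e)"
      using xT by (auto simp: T_def)
    have gX: "g i * e \<in> X" if "e \<in> E" for e
      using that \<open>i < n\<close> by (auto simp: X_def)
    have "D * (g i * x) = (\<Sum>e\<in>E. f e * (D * (g i * e)))"
      unfolding f(2) by (simp add: sum_distrib_left mult_ac)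
    also have "\<dots> = (\<Sum>e\<in>E. \<Sum>h\<in>E. f e * b (g i * e) h * h)"
      using Dx[OF gX] by (simp add: sum_distrib_left mult.assoc)
    also have "\<dots> = (\<Sum>h\<in>E. (\<Sum>e\<in>E. f e * b (g i * e) h) * h)"
      by (subst sum.swap) (simp add: sum_distrib_right)
    finally show ?thesis
      unfolding T_def
      using f(1) \<kappa>(2)[OF gX] degree_le.mult[of K B "\<kappa> * j" _ \<kappa>]
      by (auto simp: add.commute intro!: exI[of _ "\<lambda>h. \<Sum>e\<in>E. f e * b (g i * e) h"] degree_le_sum K)
  qed
  have TD: "D * x \<in> T (Suc j)" if xT: "x \<in> T j" for x j
  proof -
    obtain f where f: "\<forall>e\<in>E. degree_le K B (\<kappa> * j) (f e)" "x = (\<Sum>e\<in>E. f e * e)"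
      using xT by (auto simp: T_def)
    have "D * x = (\<Sum>e\<in>E. (D * f e) * e)"
      unfolding f(2) by (simp add: sum_distrib_left mult_ac)
    then show ?thesis
      unfolding T_def using f(1) degree_le.mult[OF \<kappa>(1)]
      by (auto intro!: exI[of _ "\<lambda>e. D * f e"])
  qed
  have TDk: "D ^ k * x \<in> T (k + j)" if "x \<in> T j" for x j k
    by (induction k) (use that TD in \<open>auto simp: mult.assoc\<close>)
  have Tgk: "D ^ k * (g i ^ k * x) \<in> T (k + j)" if "x \<in> T j" "i < n" for x i j k
  proof (induction k)
    case (Suc k)
    have "D ^ Suc k * (g i ^ Suc k * x) = D * (g i * (D ^ k * (g i ^ k * x)))"
      by (simp add: mult_ac)
    then show ?case using Tg[OF Suc \<open>i < n\<close>] by (simp only: add_Suc)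
  qed (use that in auto)
  have Tprod: "D ^ (\<Sum>i\<in>I. \<alpha> i) * ((\<Prod>i\<in>I. g i ^ \<alpha> i) * x) \<in> T ((\<Sum>i\<in>I. \<alpha> i) + j)"
    if "x \<in> T j" "finite I" "I \<subseteq> {..<n}" for x j I and \<alpha> :: "nat \<Rightarrow> nat"
    using that(2,3)
  proof (induction I rule: finite_induct)
    case (insert i I)
    have "D ^ \<alpha> i * (g i ^ \<alpha> i * (D ^ (\<Sum>i\<in>I. \<alpha> i) * ((\<Prod>i\<in>I. g i ^ \<alpha> i) * x))) \<in> T (\<alpha> i + ((\<Sum>i\<in>I. \<alpha> i) + j))"
      using insert by (intro Tgk) auto
    moreover have "D ^ \<alpha> i * (g i ^ \<alpha> i * (D ^ (\<Sum>i\<in>I. \<alpha> i) * ((\<Prod>i\<in>I. g i ^ \<alpha> i) * x))) =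
        D ^ (\<Sum>i\<in>insert i I. \<alpha> i) * ((\<Prod>i\<in>insert i I. g i ^ \<alpha> i) * x)"
      using insert(1,2) by (simp add: power_add mult_ac)
    ultimately show ?case using insert(1,2) by (simp add: add.assoc)
  qed (use that in auto)
  \<comment> \<open>With \<open>N\<close> exponents per element, there are at most \<open>card E * (h * N) ^ card B\<close> coordinates,
    fewer than the \<open>N ^ Suc (card B)\<close> monomials for this choice of \<open>N\<close>.\<close>
  define h where "h = \<kappa> * Suc n + 1"
  define N where "N = card E * h ^ card B + 1"
  define Q where "Q = n * N"
  define \<B> where "\<B> = {..<n} \<rightarrow>\<^sub>E {..<N}"
  have \<B>: "finite \<B>" "card \<B> = N ^ n"
    by (auto simp: \<B>_def card_PiE intro: finite_PiE)
  have TQ: "D ^ Suc Q * (\<Prod>i<n. g i ^ \<alpha> i) \<in> T (Suc Q)" if "\<alpha> \<in> \<B>" for \<alpha>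
  proof -
    have "\<alpha> i \<le> N" if "i < n" for i
      using \<open>\<alpha> \<in> \<B>\<close> that by (force simp: \<B>_def PiE_iff)
    then have le: "(\<Sum>i<n. \<alpha> i) \<le> Q"
      using sum_bounded_above[of "{..<n}" \<alpha> N] by (simp add: Q_def)
    have "D ^ (Q - (\<Sum>i<n. \<alpha> i)) * (D ^ (\<Sum>i<n. \<alpha> i) * ((\<Prod>i<n. g i ^ \<alpha> i) * D))
        \<in> T ((Q - (\<Sum>i<n. \<alpha> i)) + ((\<Sum>i<n. \<alpha> i) + 1))"
      by (intro TDk Tprod T1) auto
    moreover have "D ^ (Q - (\<Sum>i<n. \<alpha> i)) * (D ^ (\<Sum>i<n. \<alpha> i) * ((\<Prod>i<n. g i ^ \<alpha> i) * D)) =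
        (D ^ (Q - (\<Sum>i<n. \<alpha> i)) * D ^ (\<Sum>i<n. \<alpha> i)) * D * (\<Prod>i<n. g i ^ \<alpha> i)"
      by (simp add: mult_ac)
    moreover have "D ^ (Q - (\<Sum>i<n. \<alpha> i)) * D ^ (\<Sum>i<n. \<alpha> i) * D = D ^ Suc Q"
      using le by (simp add: power_add[symmetric])
    ultimately show ?thesis using le by simp
  qed
  define L where "L = monomials B (\<kappa> * Suc Q)"
  have L: "finite L" "card L \<le> Suc (\<kappa> * Suc Q) ^ card B"
    using finite_monomials[OF B(1)] card_monomials_le[OF B(1)] by (auto simp: L_def)
  have "\<forall>\<alpha>\<in>\<B>. \<exists>k. (\<forall>e\<in>E. \<forall>\<mu>\<in>L. k e \<mu> \<in> K) \<and>
      D ^ Suc Q * (\<Prod>i<n. g i ^ \<alpha> i) = (\<Sum>e\<in>E. (\<Sum>\<mu>\<in>L. k e \<mu> * \<mu>) * e)"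
  proof
    fix \<alpha> assume "\<alpha> \<in> \<B>"
    from TQ[OF this] obtain f where f: "\<forall>e\<in>E. degree_le K B (\<kappa> * Suc Q) (f e)"
        "D ^ Suc Q * (\<Prod>i<n. g i ^ \<alpha> i) = (\<Sum>e\<in>E. f e * e)"
      unfolding T_def by auto
    have "\<forall>e\<in>E. \<exists>k. (\<forall>\<mu>\<in>L. k \<mu> \<in> K) \<and> f e = (\<Sum>\<mu>\<in>L. k \<mu> * \<mu>)"
      using degree_le_imp_span_monomials[OF K(1) B(1)] f(1) by (auto simp: L_def lin_span_def)
    then obtain k where "\<forall>e\<in>E. (\<forall>\<mu>\<in>L. k e \<mu> \<in> K) \<and> f e = (\<Sum>\<mu>\<in>L. k e \<mu> * \<mu>)"
      by metis
    then show "\<exists>k. (\<forall>e\<in>E. \<forall>\<mu>\<in>L. k e \<mu> \<in> K) \<and>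
      D ^ Suc Q * (\<Prod>i<n. g i ^ \<alpha> i) = (\<Sum>e\<in>E. (\<Sum>\<mu>\<in>L. k e \<mu> * \<mu>) * e)"
      using f(2) by (intro exI[of _ k]) (auto intro!: sum.cong)
  qed
  from bchoice[OF this] obtain k where k: "\<And>\<alpha> e \<mu>. \<alpha> \<in> \<B> \<Longrightarrow> e \<in> E \<Longrightarrow> \<mu> \<in> L \<Longrightarrow> k \<alpha> e \<mu> \<in> K"
      "\<And>\<alpha>. \<alpha> \<in> \<B> \<Longrightarrow> D ^ Suc Q * (\<Prod>i<n. g i ^ \<alpha> i) = (\<Sum>e\<in>E. (\<Sum>\<mu>\<in>L. k \<alpha> e \<mu> * \<mu>) * e)"
    by auto
  have "card (E \<times> L) < card \<B>"
  proof -
    have "Suc (\<kappa> * Suc Q) \<le> h * N"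
    proof -
      have "1 \<le> N" by (simp add: N_def)
      from add_le_mono[OF this mult_le_mono2[OF this, of \<kappa>]]
      show ?thesis by (simp add: h_def Q_def algebra_simps)
    qed
    then have "card L \<le> (h * N) ^ card B"
      using L(2) power_mono[of "Suc (\<kappa> * Suc Q)" "h * N" "card B"] by linarith
    then have "card (E \<times> L) \<le> card E * (h * N) ^ card B"
      by (simp add: card_cartesian_product)
    also have "\<dots> = (card E * h ^ card B) * N ^ card B"
      by (simp add: power_mult_distrib)
    also have "\<dots> < N * N ^ card B"
      by (intro mult_strict_right_mono) (auto simp: N_def)
    also have "\<dots> = card \<B>" by (simp add: \<B> n_def)
    finally show ?thesis .
  qed
  then have "\<exists>c. (\<forall>\<alpha>\<in>\<B>. c \<alpha> \<in> K) \<and> (\<exists>\<alpha>\<in>\<B>. c \<alpha> \<noteq> 0) \<and>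
      (\<forall>x\<in>E \<times> L. (\<Sum>\<alpha>\<in>\<B>. c \<alpha> * (case x of (e, \<mu>) \<Rightarrow> k \<alpha> e \<mu>)) = 0)"
    by (intro linear_system_nontrivial_solution[OF K]) (use E L \<B> k(1) in auto)
  then obtain c where c: "\<forall>\<alpha>\<in>\<B>. c \<alpha> \<in> K" "\<exists>\<alpha>\<in>\<B>. c \<alpha> \<noteq> 0"
      "\<forall>x\<in>E \<times> L. (\<Sum>\<alpha>\<in>\<B>. c \<alpha> * (case x of (e, \<mu>) \<Rightarrow> k \<alpha> e \<mu>)) = 0"
    by blast
  have "D ^ Suc Q * (\<Sum>\<alpha>\<in>\<B>. c \<alpha> * (\<Prod>i<n. g i ^ \<alpha> i)) = (\<Sum>\<alpha>\<in>\<B>. c \<alpha> * (D ^ Suc Q * (\<Prod>i<n. g i ^ \<alpha> i)))"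
    by (simp add: sum_distrib_left mult_ac)
  also have "\<dots> = (\<Sum>\<alpha>\<in>\<B>. \<Sum>e\<in>E. \<Sum>\<mu>\<in>L. c \<alpha> * k \<alpha> e \<mu> * \<mu> * e)"
  proof (rule sum.cong[OF refl])
    fix \<alpha> assume \<alpha>: "\<alpha> \<in> \<B>"
    show "c \<alpha> * (D ^ Suc Q * (\<Prod>i<n. g i ^ \<alpha> i)) = (\<Sum>e\<in>E. \<Sum>\<mu>\<in>L. c \<alpha> * k \<alpha> e \<mu> * \<mu> * e)"
      unfolding k(2)[OF \<alpha>] by (simp add: sum_distrib_left sum_distrib_right mult.assoc)
  qed
  also have "\<dots> = (\<Sum>e\<in>E. \<Sum>\<alpha>\<in>\<B>. \<Sum>\<mu>\<in>L. c \<alpha> * k \<alpha> e \<mu> * \<mu> * e)"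
    by (rule sum.swap)
  also have "\<dots> = (\<Sum>e\<in>E. \<Sum>\<mu>\<in>L. \<Sum>\<alpha>\<in>\<B>. c \<alpha> * k \<alpha> e \<mu> * \<mu> * e)"
    by (intro sum.cong refl sum.swap)
  also have "\<dots> = (\<Sum>e\<in>E. \<Sum>\<mu>\<in>L. (\<Sum>\<alpha>\<in>\<B>. c \<alpha> * k \<alpha> e \<mu>) * \<mu> * e)"
    by (simp add: sum_distrib_right)
  also have "\<dots> = 0"
    using c(3) by (intro sum.neutral) auto
  finally have "D ^ Suc Q * (\<Sum>\<alpha>\<in>\<B>. c \<alpha> * (\<Prod>i<n. g i ^ \<alpha> i)) = 0" .
  moreover have "D \<in> R" using D(1) S(2) by auto
  then have "D ^ Suc Q \<noteq> 0" "D ^ Suc Q \<in> R"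
    using power_neq_0[OF _ D(2)] subring_power[OF subring] by blast+
  moreover have "(\<Sum>\<alpha>\<in>\<B>. c \<alpha> * (\<Prod>i<n. g i ^ \<alpha> i)) \<in> R"
  proof (intro subring_sum subring_mult subring_prod subring_power subring)
    show "c \<alpha> \<in> R" if "\<alpha> \<in> \<B>" for \<alpha> using c(1) K(2) that by auto
    show "g i \<in> R" if "i \<in> {..<n}" for i using gM[of i] that nm M(2) by auto
  qed
  ultimately have sum0: "(\<Sum>\<alpha>\<in>\<B>. c \<alpha> * (\<Prod>i<n. g i ^ \<alpha> i)) = 0"
    using domain by blast
  have "\<forall>\<alpha>\<in>\<B>. c \<alpha> = 0"
    unfolding \<B>_def
  proof (rule independent_seq_monomials[OF K(1) independent_seq_mono[OF ind nm]])
    show "c \<alpha> \<in> K" if "\<alpha> \<in> {..<n} \<rightarrow>\<^sub>E {..<N}" for \<alpha>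
      using c(1) that by (simp add: \<B>_def)
    show "(\<Sum>\<alpha>\<in>{..<n} \<rightarrow>\<^sub>E {..<N}. c \<alpha> * (\<Prod>i<n. g i ^ \<alpha> i)) = 0"
      using sum0 unfolding \<B>_def .
  qed
  with c(2) show False by blast
qed

end

section \<open>Ring homomorphisms on subrings\<close>

definition hom_on :: "'a::comm_ring_1 set \<Rightarrow> ('a \<Rightarrow> 'b::comm_ring_1) \<Rightarrow> bool" where
  "hom_on S \<psi> \<longleftrightarrow> \<psi> 1 = 1 \<and> (\<forall>x\<in>S. \<forall>y\<in>S. \<psi> (x + y) = \<psi> x + \<psi> y \<and> \<psi> (x * y) = \<psi> x * \<psi> y)"

lemma hom_on_1: "hom_on S \<psi> \<Longrightarrow> \<psi> 1 = 1"
  and hom_on_add: "hom_on S \<psi> \<Longrightarrow> x \<in> S \<Longrightarrow> y \<in> S \<Longrightarrow> \<psi> (x + y) = \<psi> x + \<psi> y"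
  and hom_on_mult: "hom_on S \<psi> \<Longrightarrow> x \<in> S \<Longrightarrow> y \<in> S \<Longrightarrow> \<psi> (x * y) = \<psi> x * \<psi> y"
  by (auto simp: hom_on_def)

lemma hom_on_0: "hom_on S \<psi> \<Longrightarrow> subring S \<Longrightarrow> \<psi> 0 = 0"
  using hom_on_add[of S \<psi> 0 0] by (simp add: subring_0)

lemma hom_on_uminus: "hom_on S \<psi> \<Longrightarrow> subring S \<Longrightarrow> x \<in> S \<Longrightarrow> \<psi> (- x) = - \<psi> x"
  using hom_on_add[of S \<psi> x "- x"] by (simp add: subring_uminus hom_on_0 eq_neg_iff_add_eq_0 add.commute)

lemma hom_on_diff: "hom_on S \<psi> \<Longrightarrow> subring S \<Longrightarrow> x \<in> S \<Longrightarrow> y \<in> S \<Longrightarrow> \<psi> (x - y) = \<psi> x - \<psi> y"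
  using hom_on_add[of S \<psi> x "- y"] by (simp add: subring_uminus hom_on_uminus)

lemma hom_on_sum:
  "hom_on S \<psi> \<Longrightarrow> subring S \<Longrightarrow> (\<And>i. i \<in> I \<Longrightarrow> f i \<in> S) \<Longrightarrow> \<psi> (sum f I) = (\<Sum>i\<in>I. \<psi> (f i))"
proof (induction I rule: infinite_finite_induct)
  case (insert i I)
  then show ?case by (simp add: hom_on_add[of S \<psi>] subring_sum)
qed (auto simp: hom_on_0)

lemma hom_on_of_nat: "hom_on S \<psi> \<Longrightarrow> subring S \<Longrightarrow> \<psi> (of_nat n) = of_nat n"
  by (induction n) (auto simp: hom_on_0 hom_on_1 hom_on_add subring_1 subring_of_nat)

lemma coeff_map_hom: "hom_on S \<psi> \<Longrightarrow> subring S \<Longrightarrow> coeff (map_poly \<psi> p) i = \<psi> (coeff p i)"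
  by (simp add: coeff_map_poly hom_on_0)

lemma map_hom_add:
  "hom_on S \<psi> \<Longrightarrow> subring S \<Longrightarrow> p \<in> polys_over S \<Longrightarrow> q \<in> polys_over S \<Longrightarrow>
    map_poly \<psi> (p + q) = map_poly \<psi> p + map_poly \<psi> q"
  by (rule poly_eqI) (simp add: coeff_map_hom hom_on_add coeff_polys_over)

lemma map_hom_diff:
  "hom_on S \<psi> \<Longrightarrow> subring S \<Longrightarrow> p \<in> polys_over S \<Longrightarrow> q \<in> polys_over S \<Longrightarrow>
    map_poly \<psi> (p - q) = map_poly \<psi> p - map_poly \<psi> q"
  by (rule poly_eqI) (simp add: coeff_map_hom hom_on_diff coeff_polys_over)

lemma map_hom_mult:
  "hom_on S \<psi> \<Longrightarrow> subring S \<Longrightarrow> p \<in> polys_over S \<Longrightarrow> q \<in> polys_over S \<Longrightarrow>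
    map_poly \<psi> (p * q) = map_poly \<psi> p * map_poly \<psi> q"
  by (rule poly_eqI)
    (simp add: coeff_map_hom coeff_mult hom_on_sum[of S] hom_on_mult coeff_polys_over subring_mult)

lemma map_hom_smult:
  "hom_on S \<psi> \<Longrightarrow> subring S \<Longrightarrow> a \<in> S \<Longrightarrow> p \<in> polys_over S \<Longrightarrow>
    map_poly \<psi> (smult a p) = smult (\<psi> a) (map_poly \<psi> p)"
  by (rule poly_eqI) (simp add: coeff_map_hom hom_on_mult coeff_polys_over)

text \<open>
  Polynomials here have coefficients in a ring of functions, which has zero divisors. Hence the
  derivative is spelled out, as \<open>pderiv\<close> needs their absence.
\<close>
definition formal_deriv :: "'a::comm_ring_1 poly \<Rightarrow> 'a poly" where
  "formal_deriv p = (\<Sum>i\<le>degree p. monom (of_nat (Suc i) * coeff p (Suc i)) i)"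

lemma coeff_formal_deriv: "coeff (formal_deriv p) i = of_nat (Suc i) * coeff p (Suc i)"
  by (auto simp: formal_deriv_def coeff_sum coeff_eq_0 simp del: of_nat_Suc)

lemma formal_deriv_0: "formal_deriv 0 = 0"
  by (rule poly_eqI) (simp add: coeff_formal_deriv)

lemma formal_deriv_pCons: "formal_deriv (pCons a p) = p + pCons 0 (formal_deriv p)"
  by (rule poly_eqI) (auto simp: coeff_formal_deriv coeff_pCons algebra_simps split: nat.split)

lemma map_hom_formal_deriv:
  fixes \<psi> :: "'a::comm_ring_1 \<Rightarrow> 'b::idom"
  shows "hom_on S \<psi> \<Longrightarrow> subring S \<Longrightarrow> p \<in> polys_over S \<Longrightarrow>
    map_poly \<psi> (formal_deriv p) = pderiv (map_poly \<psi> p)"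
  by (rule poly_eqI)
    (simp add: coeff_map_hom coeff_pderiv coeff_formal_deriv hom_on_mult coeff_polys_over subring_of_nat hom_on_of_nat
      del: of_nat_Suc)

lemma hom_on_poly:
  assumes h: "hom_on S \<psi>" "subring S" and "p \<in> polys_over S" "c \<in> S"
  shows "\<psi> (poly p c) = poly (map_poly \<psi> p) (\<psi> c)"
  using assms(3)
proof (induction p)
  case (pCons a p)
  then have a: "a \<in> S" "p \<in> polys_over S" by (auto simp: polys_over_pCons)
  have "map_poly \<psi> (pCons a p) = pCons (\<psi> a) (map_poly \<psi> p)"
    using pCons.hyps hom_on_0[OF h] by (rule_tac map_poly_pCons) auto
  then show ?case
    using pCons a h assms(4) by (simp add: hom_on_add[OF h(1)] hom_on_mult[OF h(1)] subring_mult poly_in_subring)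
qed (simp add: hom_on_0[OF h])

lemma polys_over_formal_deriv:
  "subring S \<Longrightarrow> p \<in> polys_over S \<Longrightarrow> formal_deriv p \<in> polys_over S"
  by (auto simp: polys_over_def coeff_formal_deriv intro!: subring_mult subring_of_nat simp del: of_nat_Suc)

text \<open>
  Pseudo-division by \<open>P\<close>: a remainder of smaller degree vanishes by minimality.
\<close>
lemma minimal_poly_divides:
  assumes S: "subring S" and P: "minimal_poly S c P" and "p \<in> polys_over S" "poly p c = 0"
  shows "\<exists>e. \<exists>q\<in>polys_over S. smult (lead_coeff P ^ e) p = P * q"
  using assms(3-)
proof (induction "degree p" arbitrary: p rule: less_induct)
  case less
  have P': "P \<in> polys_over S" "P \<noteq> 0" "poly P c = 0"
    using P by (auto simp: minimal_poly_def)
  show ?case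
  proof (cases "p = 0")
    case True
    then show ?thesis using subring_0[OF subring_polys_over[OF S]] by (intro exI[of _ 0] bexI[of _ 0]) auto
  next
    case False
    then have le: "degree P \<le> degree p"
      using P less.prems by (auto simp: minimal_poly_def)
    define m where "m = monom (lead_coeff p) (degree p - degree P)"
    define p' where "p' = smult (lead_coeff P) p - m * P"
    have m: "m \<in> polys_over S"
      unfolding m_def by (intro polys_over_monom S coeff_polys_over less.prems)
    have p': "p' \<in> polys_over S"
      unfolding p'_def
      by (intro subring_diff subring_mult subring_polys_over polys_over_smult S m P' coeff_polys_over less.prems)
    have "poly p' c = 0"
      using less.prems P' by (simp add: p'_def)
    have "coeff p' i = 0" if "i \<ge> degree p" for i
    proof (cases "i = degree p")
      case True
      then show ?thesis using le by (simp add: p'_def m_def coeff_monom_mult)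
    next
      case False
      then have "i > degree p" using that by auto
      moreover have "i - (degree p - degree P) > degree P"
        using le calculation by arith
      ultimately show ?thesis
        by (simp add: p'_def m_def coeff_monom_mult coeff_eq_0)
    qed
    then have "p' = 0 \<or> degree p' < degree p"
      by (metis leading_coeff_0_iff not_less)
    then have "\<exists>e. \<exists>q\<in>polys_over S. smult (lead_coeff P ^ e) p' = P * q"
    proof
      assume "p' = 0"
      then show ?thesis using subring_0[OF subring_polys_over[OF S]] by (intro exI[of _ 0] bexI[of _ 0]) auto
    qed (use less.hyps p' \<open>poly p' c = 0\<close> in auto)
    then obtain e q where q: "q \<in> polys_over S" "smult (lead_coeff P ^ e) p' = P * q"
      by auto
    have "smult (lead_coeff P ^ Suc e) p = smult (lead_coeff P ^ e) p' + smult (lead_coeff P ^ e) (m * P)"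
      by (simp add: p'_def smult_diff_right mult.commute)
    also have "\<dots> = P * (q + smult (lead_coeff P ^ e) m)"
      unfolding q(2) by (simp add: ring_distribs mult.commute)
    finally show ?thesis
      using q(1) m P' S by (intro exI[of _ "Suc e"] bexI[of _ "q + smult (lead_coeff P ^ e) m"])
        (auto intro!: subring_add subring_polys_over polys_over_smult subring_power coeff_polys_over)
  qed
qed

text \<open>
  A homomorphism extends with the value \<open>b\<close> at \<open>c\<close> as soon as \<open>b\<close> satisfies the images of all relations
  of \<open>c\<close>. Each element is a polynomial in \<open>c\<close>, and the assumption makes the choice of the polynomial
  irrelevant.
\<close>
lemma extend_hom_by_value:
  fixes \<psi> :: "'a::comm_ring_1 \<Rightarrow> 'b::field"
  assumes K: "subring K" and \<psi>: "hom_on (adjoin K G) \<psi>"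
    and rel: "\<And>p. p \<in> polys_over (adjoin K G) \<Longrightarrow> poly p c = 0 \<Longrightarrow> poly (map_poly \<psi> p) b = 0"
  shows "\<exists>\<psi>'. hom_on (adjoin K (insert c G)) \<psi>' \<and> (\<forall>p\<in>polys_over (adjoin K G). \<psi>' (poly p c) = poly (map_poly \<psi> p) b)"
proof -
  let ?S = "adjoin K G"
  have S: "subring ?S" by (rule subring_adjoin[OF K])
  have P: "subring (polys_over ?S)" by (rule subring_polys_over[OF S])
  define \<psi>' where "\<psi>' f = poly (map_poly \<psi> (SOME p. p \<in> polys_over ?S \<and> poly p c = f)) b" for f
  have val: "\<psi>' (poly p c) = poly (map_poly \<psi> p) b" if p: "p \<in> polys_over ?S" for p
  proof -
    define q where "q = (SOME q. q \<in> polys_over ?S \<and> poly q c = poly p c)"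
    have q: "q \<in> polys_over ?S" "poly q c = poly p c"
      using someI[of "\<lambda>q. q \<in> polys_over ?S \<and> poly q c = poly p c" p] p by (auto simp: q_def)
    have "poly (map_poly \<psi> (q - p)) b = 0"
      using p q by (intro rel subring_diff P) auto
    then show ?thesis
      using p q by (simp add: map_hom_diff[OF \<psi> S] \<psi>'_def q_def[symmetric])
  qed
  have "hom_on (adjoin K (insert c G)) \<psi>'"
    unfolding hom_on_def
  proof (intro conjI ballI)
    have "1 \<in> polys_over ?S" by (rule subring_1[OF P])
    from val[OF this] show "\<psi>' 1 = 1"
      using hom_on_1[OF \<psi>] hom_on_0[OF \<psi> S] by (simp add: map_poly_1)
  next
    fix x y assume "x \<in> adjoin K (insert c G)" "y \<in> adjoin K (insert c G)"
    then obtain p q where pq: "p \<in> polys_over ?S" "x = poly p c" "q \<in> polys_over ?S" "y = poly q c"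
      using adjoin_insert_poly[OF K] by metis
    have "\<psi>' (x + y) = poly (map_poly \<psi> (p + q)) b" "\<psi>' (x * y) = poly (map_poly \<psi> (p * q)) b"
      using val[of "p + q"] val[of "p * q"] pq by (simp_all add: subring_add[OF P] subring_mult[OF P])
    then show "\<psi>' (x + y) = \<psi>' x + \<psi>' y" "\<psi>' (x * y) = \<psi>' x * \<psi>' y"
      using pq val by (simp_all add: map_hom_add[OF \<psi> S] map_hom_mult[OF \<psi> S])
  qed
  with val show ?thesis by blast
qed

lemma extension_extends:
  assumes K: "subring K" and \<psi>: "hom_on (adjoin K G) \<psi>"
    and "\<forall>p\<in>polys_over (adjoin K G). \<psi>' (poly p c) = poly (map_poly \<psi> p) b"
  shows "\<forall>x\<in>adjoin K G. \<psi>' x = \<psi> x" and "\<psi>' c = b"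
proof -
  let ?S = "adjoin K G"
  have S: "subring ?S" by (rule subring_adjoin[OF K])
  show "\<forall>x\<in>?S. \<psi>' x = \<psi> x"
  proof
    fix x assume "x \<in> ?S"
    then have "[:x:] \<in> polys_over ?S"
      using subring_0[OF subring_polys_over[OF S]] by (simp add: polys_over_pCons)
    then show "\<psi>' x = \<psi> x"
      using assms(3) hom_on_0[OF \<psi> S] by (force simp: map_poly_pCons)
  qed
  have "[:0, 1:] \<in> polys_over ?S"
    using subring_0[OF subring_polys_over[OF S]] by (simp add: polys_over_pCons subring_closed[OF S])
  then show "\<psi>' c = b"
    using assms(3) hom_on_0[OF \<psi> S] hom_on_1[OF \<psi>] by (force simp: map_poly_pCons)
qed

section \<open>Extending homomorphisms into the complex numbers\<close>

context subdomain
begin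

lemma minimal_poly_degree_pos: "minimal_poly S c P \<Longrightarrow> degree P > 0"
proof (rule ccontr)
  assume P: "minimal_poly S c P" "\<not> degree P > 0"
  then obtain a where "P = [:a:]" by (auto elim: degree_eq_zeroE)
  then show False using P by (auto simp: minimal_poly_def)
qed

text \<open>
  Separability in characteristic zero: the derivative is a nonzero polynomial of smaller degree.
\<close>
lemma minimal_poly_formal_deriv:
  assumes S: "subring S" "S \<subseteq> R" and P: "minimal_poly S c P"
  shows "poly (formal_deriv P) c \<noteq> 0"
proof
  assume 0: "poly (formal_deriv P) c = 0"
  obtain r where r: "degree P = Suc r"
    using minimal_poly_degree_pos[OF P] by (auto simp: gr0_conv_Suc)
  have PS: "P \<in> polys_over S" "P \<noteq> 0" using P by (auto simp: minimal_poly_def)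
  have "coeff (formal_deriv P) r = of_nat (Suc r) * coeff P (Suc r)"
    by (simp add: coeff_formal_deriv del: of_nat_Suc)
  moreover have "coeff P (Suc r) \<noteq> 0" "coeff P (Suc r) \<in> R"
    using PS r S coeff_polys_over by (auto simp flip: r)
  moreover have "of_nat (Suc r) \<in> R" by (rule subring_of_nat[OF subring])
  ultimately have "coeff (formal_deriv P) r \<noteq> 0"
    using mult_neq_0 char_0 by metis
  then have "formal_deriv P \<noteq> 0" by auto
  moreover have "formal_deriv P \<in> polys_over S" by (rule polys_over_formal_deriv[OF S(1) PS(1)])
  ultimately have "degree P \<le> degree (formal_deriv P)"
    using P 0 by (auto simp: minimal_poly_def)
  moreover have "degree (formal_deriv P) \<le> r"
    by (rule degree_le) (simp add: coeff_formal_deriv coeff_eq_0 r del: of_nat_Suc)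
  ultimately show False using r by simp
qed

lemma extend_hom_to_root:
  fixes \<psi> :: "'a \<Rightarrow> 'b::field"
  assumes K: "subring K" and \<psi>: "hom_on (adjoin K G) \<psi>"
    and P: "minimal_poly (adjoin K G) c P" "\<psi> (lead_coeff P) \<noteq> 0" "poly (map_poly \<psi> P) b = 0"
  shows "\<exists>\<psi>'. hom_on (adjoin K (insert c G)) \<psi>' \<and> (\<forall>p\<in>polys_over (adjoin K G). \<psi>' (poly p c) = poly (map_poly \<psi> p) b)"
proof (rule extend_hom_by_value[OF K \<psi>])
  let ?S = "adjoin K G"
  have S: "subring ?S" by (rule subring_adjoin[OF K])
  fix p assume p: "p \<in> polys_over ?S" "poly p c = 0"
  obtain e q where q: "q \<in> polys_over ?S" "smult (lead_coeff P ^ e) p = P * q"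
    using minimal_poly_divides[OF S P(1) p] by auto
  have PS: "P \<in> polys_over ?S" using P by (auto simp: minimal_poly_def)
  have l: "lead_coeff P \<in> ?S" using PS by (rule coeff_polys_over)
  have le: "\<psi> (lead_coeff P ^ e) = \<psi> (lead_coeff P) ^ e"
    by (induction e) (auto simp: hom_on_1[OF \<psi>] hom_on_mult[OF \<psi>] l subring_power[OF S])
  have "smult (\<psi> (lead_coeff P ^ e)) (map_poly \<psi> p) = map_poly \<psi> P * map_poly \<psi> q"
    using map_hom_smult[OF \<psi> S subring_power[OF S l] p(1), of e] map_hom_mult[OF \<psi> S PS q(1)] q(2) by simp
  then have "\<psi> (lead_coeff P) ^ e * poly (map_poly \<psi> p) b = 0"
    using P(3) unfolding le by (metis mult_zero_left poly_mult poly_smult)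
  then show "poly (map_poly \<psi> p) b = 0"
    using P(2) by simp
qed

lemma degree_map_hom:
  assumes "hom_on S \<psi>" "subring S" "\<psi> (lead_coeff P) \<noteq> 0"
  shows "degree (map_poly \<psi> P) = degree P"
proof (rule antisym)
  show "degree (map_poly \<psi> P) \<le> degree P"
    by (rule degree_le) (simp add: coeff_map_hom[OF assms(1,2)] coeff_eq_0 hom_on_0[OF assms(1,2)])
  show "degree P \<le> degree (map_poly \<psi> P)"
    by (rule le_degree) (simp add: coeff_map_hom[OF assms(1,2)] assms(3))
qed

text \<open>
  \<open>algebraic_over_inverse\<close> for every element of the extension, not only for the generator.
\<close>
lemma algebraic_over_adjoin_insert:
  assumes K: "subring K" and R: "adjoin K (insert c G) \<subseteq> R"
    and c: "algebraic_over (adjoin K G) c" and u: "u \<in> adjoin K (insert c G)" "u \<noteq> 0"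
  shows "\<exists>w\<in>adjoin K (insert c G). u * w \<in> adjoin K G \<and> u * w \<noteq> 0"
proof -
  let ?S = "adjoin K G" and ?T = "adjoin K (insert c G)"
  have S: "subring ?S" "subring ?T" by (auto intro: subring_adjoin[OF K])
  have ST: "?S \<subseteq> ?T" by (rule adjoin_mono[OF K]) auto
  have SR: "?S \<subseteq> R" using ST R by auto
  have T: "adjoin ?S {c} = ?T" by (simp add: adjoin_adjoin[OF K])
  have "finite_over ?S ?T"
    unfolding T[symmetric]
    by (rule finite_over_adjoin_algebraic[OF S(1) order.refl S(1) SR finite_over_refl[OF S(1) SR] c])
  then have "algebraic_over ?S u"
    by (rule finite_over_imp_algebraic[OF S(1) SR S(2) _ u(1)])
  then obtain q where q: "q \<in> polys_over ?S" "u * poly q u \<in> ?S" "u * poly q u \<noteq> 0"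
    using algebraic_over_inverse[OF S(1) SR _ u(2)] u R by blast
  moreover have "poly q u \<in> ?T"
    using q(1) polys_over_mono[OF ST] by (intro poly_in_subring S u) auto
  ultimately show ?thesis by blast
qed

text \<open>
  A homomorphism to the complex numbers extends to one more generator, and stays nonzero at \<open>u\<close>,
  outside the zeros of some \<open>h\<close>. If \<open>c\<close> is algebraic, its value is a root of the
  minimal polynomial, and \<open>u\<close> divides an element of the base, which \<open>h\<close> contains as a factor.
  If \<open>c\<close> is transcendental, its value is free and only has to avoid the roots of \<open>u\<close>.
\<close>
lemma generic_hom_extension_insert:
  assumes K: "subring K" and R: "adjoin K (insert c G) \<subseteq> R"
    and u: "u \<in> adjoin K (insert c G)" "u \<noteq> 0"
  shows "\<exists>h\<in>adjoin K G. h \<noteq> 0 \<and> (\<forall>\<psi>::'a \<Rightarrow> complex. hom_on (adjoin K G) \<psi> \<longrightarrow> \<psi> h \<noteq> 0 \<longrightarrow>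
    (\<exists>\<psi>'. hom_on (adjoin K (insert c G)) \<psi>' \<and> (\<forall>x\<in>adjoin K G. \<psi>' x = \<psi> x) \<and> \<psi>' u \<noteq> 0))"
proof -
  let ?S = "adjoin K G" and ?T = "adjoin K (insert c G)"
  have S: "subring ?S" "subring ?T" by (auto intro: subring_adjoin[OF K])
  have ST: "?S \<subseteq> ?T" by (rule adjoin_mono[OF K]) auto
  show ?thesis
  proof (cases "algebraic_over ?S c")
    case True
    then obtain P where P: "minimal_poly ?S c P" by (rule minimal_poly_exists)
    obtain w where w: "w \<in> ?T" "u * w \<in> ?S" "u * w \<noteq> 0"
      using algebraic_over_adjoin_insert[OF K R True u] by auto
    have l: "lead_coeff P \<in> ?S" "lead_coeff P \<noteq> 0"
      using P coeff_polys_over by (auto simp: minimal_poly_def)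
    show ?thesis
    proof (intro bexI[of _ "lead_coeff P * (u * w)"] conjI allI impI)
      show "lead_coeff P * (u * w) \<in> ?S" by (rule subring_mult[OF S(1) l(1) w(2)])
      show "lead_coeff P * (u * w) \<noteq> 0" by (rule mult_neq_0) (use l w ST R in auto)
    next
      fix \<psi> :: "'a \<Rightarrow> complex"
      assume \<psi>: "hom_on ?S \<psi>" "\<psi> (lead_coeff P * (u * w)) \<noteq> 0"
      then have nz: "\<psi> (lead_coeff P) \<noteq> 0" "\<psi> (u * w) \<noteq> 0"
        using hom_on_mult[OF \<psi>(1) l(1) w(2)] by auto
      have "degree (map_poly \<psi> P) > 0"
        using degree_map_hom[OF \<psi>(1) S(1) nz(1)] minimal_poly_degree_pos[OF P] by simp
      then obtain b where "poly (map_poly \<psi> P) b = 0"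
        using fundamental_theorem_of_algebra[of "map_poly \<psi> P"] by (auto simp: constant_degree)
      then obtain \<psi>' where \<psi>': "hom_on ?T \<psi>'" "\<forall>p\<in>polys_over ?S. \<psi>' (poly p c) = poly (map_poly \<psi> p) b"
        using extend_hom_to_root[OF K \<psi>(1) P nz(1)] by blast
      have ext: "\<forall>x\<in>?S. \<psi>' x = \<psi> x"
        by (rule extension_extends[OF K \<psi>(1) \<psi>'(2)])
      have "\<psi>' u * \<psi>' w = \<psi> (u * w)"
        using hom_on_mult[OF \<psi>'(1) u(1) w(1)] ext w by auto
      then have "\<psi>' u \<noteq> 0" using nz by auto
      with \<psi>' ext show "\<exists>\<psi>'. hom_on ?T \<psi>' \<and> (\<forall>x\<in>?S. \<psi>' x = \<psi> x) \<and> \<psi>' u \<noteq> 0" by blast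
    qed
  next
    case False
    obtain p where p: "p \<in> polys_over ?S" "u = poly p c"
      using adjoin_insert_poly[OF K u(1)] by auto
    then have "p \<noteq> 0" using u by auto
    then have l: "lead_coeff p \<in> ?S" "lead_coeff p \<noteq> 0"
      using p coeff_polys_over by auto
    show ?thesis
    proof (intro bexI[of _ "lead_coeff p"] conjI allI impI)
      fix \<psi> :: "'a \<Rightarrow> complex"
      assume \<psi>: "hom_on ?S \<psi>" "\<psi> (lead_coeff p) \<noteq> 0"
      then have "coeff (map_poly \<psi> p) (degree p) \<noteq> 0"
        by (simp add: coeff_map_hom[OF \<psi>(1) S(1)])
      then have "map_poly \<psi> p \<noteq> 0" by auto
      then obtain b where b: "poly (map_poly \<psi> p) b \<noteq> 0"
        using poly_all_0_iff_0 by blast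
      have "poly (map_poly \<psi> q) b = 0" if "q \<in> polys_over ?S" "poly q c = 0" for q
        using False that by (auto simp: algebraic_over_def)
      then obtain \<psi>' where \<psi>': "hom_on ?T \<psi>'" "\<forall>p\<in>polys_over ?S. \<psi>' (poly p c) = poly (map_poly \<psi> p) b"
        using extend_hom_by_value[OF K \<psi>(1)] by blast
      then show "\<exists>\<psi>'. hom_on ?T \<psi>' \<and> (\<forall>x\<in>?S. \<psi>' x = \<psi> x) \<and> \<psi>' u \<noteq> 0"
        using extension_extends[OF K \<psi>(1) \<psi>'(2)] b p by auto
    qed (use l in auto)
  qed
qed

text \<open>
  Applied to the coordinate ring of a variety this is Chevalley's theorem in the form used here: the image of
  a dominant map contains the complement of a hypersurface.
\<close>
lemma generic_hom_extension:
  assumes K: "subring K" and "finite E" and "adjoin K (G \<union> E) \<subseteq> R"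
    and "u \<in> adjoin K (G \<union> E)" "u \<noteq> 0"
  shows "\<exists>h\<in>adjoin K G. h \<noteq> 0 \<and> (\<forall>\<psi>::'a \<Rightarrow> complex. hom_on (adjoin K G) \<psi> \<longrightarrow> \<psi> h \<noteq> 0 \<longrightarrow>
    (\<exists>\<psi>'. hom_on (adjoin K (G \<union> E)) \<psi>' \<and> (\<forall>x\<in>adjoin K G. \<psi>' x = \<psi> x) \<and> \<psi>' u \<noteq> 0))"
  using assms(2-)
proof (induction E arbitrary: u rule: finite_induct)
  case empty
  then show ?case by (intro bexI[of _ u]) auto
next
  case (insert c E)
  let ?M = "adjoin K (G \<union> E)"
  have U: "G \<union> insert c E = insert c (G \<union> E)" by auto
  have MR: "?M \<subseteq> R"
    using adjoin_mono[OF K, of K "G \<union> E" "G \<union> insert c E"] insert.prems(1) by blast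
  have GM: "adjoin K G \<subseteq> ?M" by (rule adjoin_mono[OF K]) auto
  obtain v where v: "v \<in> ?M" "v \<noteq> 0" "\<And>\<psi>::'a \<Rightarrow> complex. hom_on ?M \<psi> \<Longrightarrow> \<psi> v \<noteq> 0 \<Longrightarrow>
    (\<exists>\<psi>'. hom_on (adjoin K (G \<union> insert c E)) \<psi>' \<and> (\<forall>x\<in>?M. \<psi>' x = \<psi> x) \<and> \<psi>' u \<noteq> 0)"
    using generic_hom_extension_insert[OF K, of c "G \<union> E" u] insert.prems unfolding U by blast
  obtain h where h: "h \<in> adjoin K G" "h \<noteq> 0" "\<And>\<psi>::'a \<Rightarrow> complex. hom_on (adjoin K G) \<psi> \<Longrightarrow> \<psi> h \<noteq> 0 \<Longrightarrow>
    (\<exists>\<psi>'. hom_on ?M \<psi>' \<and> (\<forall>x\<in>adjoin K G. \<psi>' x = \<psi> x) \<and> \<psi>' v \<noteq> 0)"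
    using insert.IH[OF MR v(1,2)] by blast
  show ?case
  proof (intro bexI[OF _ h(1)] conjI allI impI h(2))
    fix \<psi> :: "'a \<Rightarrow> complex"
    assume "hom_on (adjoin K G) \<psi>" "\<psi> h \<noteq> 0"
    then obtain \<psi>1 where \<psi>1: "hom_on ?M \<psi>1" "\<forall>x\<in>adjoin K G. \<psi>1 x = \<psi> x" "\<psi>1 v \<noteq> 0"
      using h(3) by blast
    then obtain \<psi>2 where "hom_on (adjoin K (G \<union> insert c E)) \<psi>2" "\<forall>x\<in>?M. \<psi>2 x = \<psi>1 x" "\<psi>2 u \<noteq> 0"
      using v(3) by blast
    then show "\<exists>\<psi>'. hom_on (adjoin K (G \<union> insert c E)) \<psi>' \<and> (\<forall>x\<in>adjoin K G. \<psi>' x = \<psi> x) \<and> \<psi>' u \<noteq> 0"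
      using \<psi>1 GM by (intro exI[of _ \<psi>2]) auto
  qed
qed

lemma two_simple_roots:
  fixes p :: "complex poly"
  assumes "degree p \<ge> 2" "\<And>b. poly p b = 0 \<Longrightarrow> poly (pderiv p) b \<noteq> 0"
  shows "\<exists>b b'. b \<noteq> b' \<and> poly p b = 0 \<and> poly p b' = 0"
proof -
  have "\<not> constant (poly p)" using assms(1) by (simp add: constant_degree)
  then obtain b where b: "poly p b = 0" using fundamental_theorem_of_algebra by blast
  then obtain q where q: "p = [:-b, 1:] * q" by (auto simp: poly_eq_0_iff_dvd elim: dvdE)
  have "q \<noteq> 0" using assms(1) q by auto
  then have "degree p = Suc (degree q)"
    unfolding q by (subst degree_mult_eq) auto
  then have "\<not> constant (poly q)" using assms(1) by (simp add: constant_degree)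
  then obtain b' where b': "poly q b' = 0" using fundamental_theorem_of_algebra by blast
  have "b' \<noteq> b"
  proof
    assume "b' = b"
    then have "poly (pderiv p) b = 0"
      using b' unfolding q pderiv_mult by simp
    then show False using assms(2) b by auto
  qed
  then show ?thesis using b b' q by (intro exI[of _ b] exI[of _ b']) auto
qed

text \<open>
  Where the leading coefficient of \<open>P\<close> and a multiple of the derivative \<open>d\<close> of \<open>P\<close> at \<open>z\<close> do not vanish, the
  specialised polynomial keeps its degree and has only simple roots, hence at least two roots; each is a
  possible value of \<open>z\<close>.
\<close>
lemma two_homs_over_generic_point:
  assumes K: "subring K" and R: "adjoin K (insert z G) \<subseteq> R"
    and P: "minimal_poly (adjoin K G) z P" "degree P \<ge> 2"
    and u: "u \<in> adjoin K (insert z G)" "u \<noteq> 0"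
  shows "\<exists>h\<in>adjoin K G. h \<noteq> 0 \<and> (\<forall>\<psi>::'a \<Rightarrow> complex. hom_on (adjoin K G) \<psi> \<longrightarrow> \<psi> h \<noteq> 0 \<longrightarrow>
    (\<exists>\<psi>1 \<psi>2. hom_on (adjoin K (insert z G)) \<psi>1 \<and> hom_on (adjoin K (insert z G)) \<psi>2 \<and>
      (\<forall>x\<in>adjoin K G. \<psi>1 x = \<psi> x \<and> \<psi>2 x = \<psi> x) \<and> \<psi>1 z \<noteq> \<psi>2 z \<and> \<psi>1 u \<noteq> 0 \<and> \<psi>2 u \<noteq> 0))"
proof -
  let ?S = "adjoin K G" and ?T = "adjoin K (insert z G)"
  have S: "subring ?S" "subring ?T" by (auto intro: subring_adjoin[OF K])
  have ST: "?S \<subseteq> ?T" by (rule adjoin_mono[OF K]) auto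
  have SR: "?S \<subseteq> R" using ST R by auto
  have zT: "z \<in> ?T" using adjoin_gen[of "insert z G" K] by auto
  have PS: "P \<in> polys_over ?S" "P \<noteq> 0" "poly P z = 0"
    using P by (auto simp: minimal_poly_def)
  then have l: "lead_coeff P \<in> ?S" "lead_coeff P \<noteq> 0"
    using coeff_polys_over by auto
  have alg: "algebraic_over ?S z" using PS by (auto simp: algebraic_over_def)
  \<comment> \<open>One element \<open>w\<close> clears both \<open>d\<close> and \<open>u\<close>, so a single condition on the base controls both.\<close>
  define d where "d = poly (formal_deriv P) z"
  have dS: "formal_deriv P \<in> polys_over ?S" by (rule polys_over_formal_deriv[OF S(1) PS(1)])
  have d: "d \<in> ?T" "d \<noteq> 0"
    using minimal_poly_formal_deriv[OF S(1) SR P(1)] dS polys_over_mono[OF ST]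
    by (auto simp: d_def intro!: poly_in_subring S zT)
  have "d * u \<in> ?T" "d * u \<noteq> 0"
    using d u R mult_neq_0[of d u] by (auto intro!: subring_mult S)
  then obtain w where w: "w \<in> ?T" "d * u * w \<in> ?S" "d * u * w \<noteq> 0"
    using algebraic_over_adjoin_insert[OF K R alg] by blast
  show ?thesis
  proof (intro bexI[of _ "lead_coeff P * (d * u * w)"] conjI allI impI)
    show "lead_coeff P * (d * u * w) \<in> ?S" by (rule subring_mult[OF S(1) l(1) w(2)])
    show "lead_coeff P * (d * u * w) \<noteq> 0" by (rule mult_neq_0) (use l w SR in auto)
  next
    fix \<psi> :: "'a \<Rightarrow> complex"
    assume \<psi>: "hom_on ?S \<psi>" "\<psi> (lead_coeff P * (d * u * w)) \<noteq> 0"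
    then have nz: "\<psi> (lead_coeff P) \<noteq> 0" "\<psi> (d * u * w) \<noteq> 0"
      using hom_on_mult[OF \<psi>(1) l(1) w(2)] by auto
    let ?p = "map_poly \<psi> P"
    have ext: "\<exists>\<psi>'. hom_on ?T \<psi>' \<and> (\<forall>x\<in>?S. \<psi>' x = \<psi> x) \<and> \<psi>' z = b \<and> \<psi>' u \<noteq> 0 \<and> poly (pderiv ?p) b \<noteq> 0"
      if b: "poly ?p b = 0" for b
    proof -
      obtain \<psi>' where \<psi>': "hom_on ?T \<psi>'" "\<forall>p\<in>polys_over ?S. \<psi>' (poly p z) = poly (map_poly \<psi> p) b"
        using extend_hom_to_root[OF K \<psi>(1) P(1) nz(1) b] by blast
      have e: "\<forall>x\<in>?S. \<psi>' x = \<psi> x" "\<psi>' z = b"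
        by (rule extension_extends[OF K \<psi>(1) \<psi>'(2)])+
      have "\<psi>' d * \<psi>' u * \<psi>' w = \<psi> (d * u * w)"
        using hom_on_mult[OF \<psi>'(1)] e(1) w d u by (metis subring_mult[OF S(2)])
      then have "\<psi>' d \<noteq> 0" "\<psi>' u \<noteq> 0" using nz by auto
      moreover have "\<psi>' d = poly (pderiv ?p) b"
        unfolding d_def using \<psi>'(2) dS map_hom_formal_deriv[OF \<psi>(1) S(1) PS(1)] by simp
      ultimately show ?thesis using \<psi>' e by (intro exI[of _ \<psi>']) auto
    qed
    have "degree ?p \<ge> 2"
      using degree_map_hom[OF \<psi>(1) S(1) nz(1)] P(2) by simp
    then obtain b b' where "b \<noteq> b'" "poly ?p b = 0" "poly ?p b' = 0"
      using two_simple_roots[of ?p] ext by blast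
    then show "\<exists>\<psi>1 \<psi>2. hom_on ?T \<psi>1 \<and> hom_on ?T \<psi>2 \<and> (\<forall>x\<in>?S. \<psi>1 x = \<psi> x \<and> \<psi>2 x = \<psi> x) \<and>
        \<psi>1 z \<noteq> \<psi>2 z \<and> \<psi>1 u \<noteq> 0 \<and> \<psi>2 u \<noteq> 0"
      using ext[of b] ext[of b'] by metis
  qed
qed

end

section \<open>Transport along ring homomorphisms\<close>

lemma adjoin_empty: "subring K \<Longrightarrow> adjoin K {} = K"
  using adjoin_least[of K K "{}"] adjoin_base[of K "{}"] by auto

lemma hom_degree_le:
  assumes "hom_on UNIV \<theta>" "\<And>k. k \<in> K \<Longrightarrow> \<theta> k \<in> K'" "\<And>g. g \<in> G \<Longrightarrow> degree_le K' G' 1 (\<theta> g)"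
  shows "degree_le K G n a \<Longrightarrow> degree_le K' G' n (\<theta> a)"
proof (induction rule: degree_le.induct)
  case (base k) then show ?case by (intro degree_le.base assms)
next
  case (gen g) then show ?case by (intro assms)
next
  case (add n a b) then show ?case by (simp add: hom_on_add[OF assms(1)] degree_le.add)
next
  case (mult m a n b) then show ?case by (simp add: hom_on_mult[OF assms(1)] degree_le.mult)
next
  case (mono m a n) then show ?case by (rule_tac degree_le.mono)
qed

lemma hom_adjoin:
  assumes \<theta>: "hom_on UNIV \<theta>" and S: "subring S"
    and "\<And>k. k \<in> K \<Longrightarrow> \<theta> k \<in> S" "\<And>g. g \<in> G \<Longrightarrow> \<theta> g \<in> S" "a \<in> adjoin K G"
  shows "\<theta> a \<in> S"
proof -
  have "subring {a. \<theta> a \<in> S}"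
    using hom_on_1[OF \<theta>] hom_on_diff[OF \<theta> subring_UNIV] hom_on_mult[OF \<theta>] S
    by (auto simp: subring_def)
  then have "adjoin K G \<subseteq> {a. \<theta> a \<in> S}"
    using assms by (intro adjoin_least) auto
  then show ?thesis using assms by auto
qed

lemma degree_le_image:
  assumes \<theta>: "hom_on UNIV \<theta>"
  shows "degree_le (\<theta> ` K) (\<theta> ` G) n b \<Longrightarrow> \<exists>a. degree_le K G n a \<and> \<theta> a = b"
proof (induction rule: degree_le.induct)
  case (add n a b) then show ?case by (metis UNIV_I degree_le.add hom_on_add[OF \<theta>])
next
  case (mult m a n b) then show ?case by (metis UNIV_I degree_le.mult hom_on_mult[OF \<theta>])
next
  case (gen x)
  then obtain g where "g \<in> G" "x = \<theta> g" by auto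
  then show ?case using degree_le.gen[of g G K] by blast
qed (auto intro: degree_le.base degree_le.mono)

lemma adjoin_image:
  assumes \<theta>: "hom_on UNIV \<theta>"
  shows "adjoin (\<theta> ` K) (\<theta> ` G) = \<theta> ` adjoin K G"
proof
  show "adjoin (\<theta> ` K) (\<theta> ` G) \<subseteq> \<theta> ` adjoin K G"
    using degree_le_image[OF \<theta>, of K G] by (fastforce simp: adjoin_def)
next
  have "degree_le (\<theta> ` K) (\<theta> ` G) n (\<theta> a)" if "degree_le K G n a" for n a
    by (rule hom_degree_le[OF \<theta> _ _ that]) (rule imageI, assumption, rule degree_le.gen, rule imageI)
  then show "\<theta> ` adjoin K G \<subseteq> adjoin (\<theta> ` K) (\<theta> ` G)"
    by (auto simp: adjoin_def)
qed

lemma subring_image: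
  assumes \<theta>: "hom_on UNIV \<theta>" and K: "subring K"
  shows "subring (\<theta> ` K)"
  unfolding subring_def
proof (intro conjI ballI)
  show "1 \<in> \<theta> ` K" using hom_on_1[OF \<theta>] subring_1[OF K] by (metis imageI)
next
  fix x y assume "x \<in> \<theta> ` K" "y \<in> \<theta> ` K"
  then obtain a b where ab: "a \<in> K" "x = \<theta> a" "b \<in> K" "y = \<theta> b" by auto
  then have "x - y = \<theta> (a - b)" "x * y = \<theta> (a * b)"
    by (simp_all add: hom_on_diff[OF \<theta> subring_UNIV] hom_on_mult[OF \<theta>])
  then show "x - y \<in> \<theta> ` K" "x * y \<in> \<theta> ` K"
    using ab K by (auto intro: subring_diff subring_mult)
qed

lemma polys_over_image:
  assumes \<theta>: "hom_on UNIV \<theta>" and S: "subring S" and "p \<in> polys_over (\<theta> ` S)"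
  shows "\<exists>q \<in> polys_over S. map_poly \<theta> q = p"
  using assms(3)
proof (induction p)
  case 0
  show ?case using subring_0[OF subring_polys_over[OF S]] by (intro bexI[of _ 0]) auto
next
  case (pCons a p)
  then obtain b q where bq: "b \<in> S" "a = \<theta> b" "q \<in> polys_over S" "map_poly \<theta> q = p"
    by (auto simp: polys_over_pCons)
  have "map_poly \<theta> (pCons b q) = pCons a p"
    using bq hom_on_0[OF \<theta> subring_UNIV] by (intro poly_eqI) (auto simp: coeff_map_poly coeff_pCons split: nat.split)
  then show ?case using bq by (intro bexI[of _ "pCons b q"]) (auto simp: polys_over_pCons)
qed

lemma map_poly_hom_eq_0:
  assumes \<theta>: "hom_on UNIV \<theta>" and "\<And>a. a \<in> S \<Longrightarrow> \<theta> a = 0 \<Longrightarrow> a = 0"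
    and "p \<in> polys_over S" "map_poly \<theta> p = 0"
  shows "p = 0"
proof (rule poly_eqI)
  fix i
  have "\<theta> (coeff p i) = 0"
    using assms(4) coeff_map_hom[OF \<theta> subring_UNIV, of p i] by simp
  then show "coeff p i = coeff 0 i" using assms by (simp add: coeff_polys_over)
qed

lemma algebraic_over_image:
  assumes \<theta>: "hom_on UNIV \<theta>" and "\<And>a. a \<in> S \<Longrightarrow> \<theta> a = 0 \<Longrightarrow> a = 0" and "algebraic_over S c"
  shows "algebraic_over (\<theta> ` S) (\<theta> c)"
proof -
  obtain p where p: "p \<in> polys_over S" "p \<noteq> 0" "poly p c = 0"
    using assms(3) by (auto simp: algebraic_over_def)
  have "poly (map_poly \<theta> p) (\<theta> c) = 0"
    using hom_on_poly[OF \<theta> subring_UNIV, of p c] p hom_on_0[OF \<theta> subring_UNIV] by (auto simp: polys_over_def)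
  moreover have "map_poly \<theta> p \<in> polys_over (\<theta> ` S)"
    using p by (auto simp: polys_over_def coeff_map_hom[OF \<theta> subring_UNIV])
  moreover have "map_poly \<theta> p \<noteq> 0"
    using map_poly_hom_eq_0[OF \<theta> assms(2) p(1)] p by auto
  ultimately show ?thesis by (auto simp: algebraic_over_def)
qed

text \<open>
  For \<open>t\<close> the free variables and \<open>\<theta>\<close> the evaluation of polynomials at a tuple, injectivity of \<open>\<theta>\<close> says
  that the tuple satisfies no polynomial relation. This lemma and the next identify that with
  \<open>independent_seq\<close>.
\<close>
lemma injective_of_independent_image:
  assumes \<theta>: "hom_on UNIV \<theta>" and K: "subring K" and inj: "\<And>a. a \<in> K \<Longrightarrow> \<theta> a = 0 \<Longrightarrow> a = 0"
    and "independent_seq (\<theta> ` K) m (\<lambda>i. \<theta> (t i))"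
    and "a \<in> adjoin K (t ` {..<m})" "\<theta> a = 0"
  shows "a = 0"
  using assms(4-)
proof (induction m arbitrary: a)
  case 0
  then show ?case using inj by (simp add: adjoin_empty K)
next
  case (Suc m)
  let ?S = "adjoin K (t ` {..<m})"
  have im: "\<theta> ` ?S = adjoin (\<theta> ` K) ((\<lambda>i. \<theta> (t i)) ` {..<m})"
    by (simp add: adjoin_image[OF \<theta>, symmetric] image_image)
  have ind: "independent_seq (\<theta> ` K) m (\<lambda>i. \<theta> (t i))" "\<not> algebraic_over (\<theta> ` ?S) (\<theta> (t m))"
    using Suc.prems(1) by (auto simp: independent_seq_Suc im)
  obtain p where p: "p \<in> polys_over ?S" "a = poly p (t m)"
    using Suc.prems(2) adjoin_insert_poly[OF K, of a "t m"] by (auto simp: lessThan_Suc)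
  have "poly (map_poly \<theta> p) (\<theta> (t m)) = 0"
    using hom_on_poly[OF \<theta> subring_UNIV, of p "t m"] p Suc.prems(3) by (auto simp: polys_over_def)
  moreover have "map_poly \<theta> p \<in> polys_over (\<theta> ` ?S)"
    using p by (auto simp: polys_over_def coeff_map_hom[OF \<theta> subring_UNIV])
  ultimately have "map_poly \<theta> p = 0"
    using ind(2) by (auto simp: algebraic_over_def)
  then have "p = 0"
    using map_poly_hom_eq_0[OF \<theta> Suc.IH[OF ind(1)] p(1)] by blast
  then show ?case using p by simp
qed

lemma independent_image_of_injective:
  assumes \<theta>: "hom_on UNIV \<theta>" and K: "subring K" and ind: "independent_seq K m t"
    and inj: "\<And>a. a \<in> adjoin K (t ` {..<m}) \<Longrightarrow> \<theta> a = 0 \<Longrightarrow> a = 0"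
  shows "independent_seq (\<theta> ` K) m (\<lambda>i. \<theta> (t i))"
  unfolding independent_seq_def
proof (intro allI impI notI)
  fix i assume i: "i < m" and "algebraic_over (adjoin (\<theta> ` K) ((\<lambda>i. \<theta> (t i)) ` {..<i})) (\<theta> (t i))"
  let ?S = "adjoin K (t ` {..<i})" and ?M = "adjoin K (t ` {..<m})"
  have S: "subring ?S" "subring ?M" by (auto intro: subring_adjoin K)
  have "\<theta> ` ?S = adjoin (\<theta> ` K) ((\<lambda>i. \<theta> (t i)) ` {..<i})"
    by (simp add: adjoin_image[OF \<theta>, symmetric] image_image)
  then have "algebraic_over (\<theta> ` ?S) (\<theta> (t i))"
    using \<open>algebraic_over _ _\<close> by simp
  then obtain p where p: "p \<in> polys_over (\<theta> ` ?S)" "p \<noteq> 0" "poly p (\<theta> (t i)) = 0"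
    by (auto simp: algebraic_over_def)
  obtain q where q: "q \<in> polys_over ?S" "map_poly \<theta> q = p"
    using polys_over_image[OF \<theta> S(1) p(1)] by auto
  have SM: "?S \<subseteq> ?M" using i by (intro adjoin_mono[OF K]) auto
  have "t i \<in> t ` {..<m}" using i by auto
  then have "t i \<in> ?M" using adjoin_gen[of "t ` {..<m}" K] by blast
  then have "poly q (t i) \<in> ?M"
    using q polys_over_mono[OF SM] by (intro poly_in_subring S) auto
  moreover have "\<theta> (poly q (t i)) = 0"
    using hom_on_poly[OF \<theta> subring_UNIV, of q "t i"] p q by (auto simp: polys_over_def)
  ultimately have "poly q (t i) = 0" using inj by blast
  moreover have "q \<noteq> 0" using q p by auto
  ultimately have "algebraic_over ?S (t i)" using q by (auto simp: algebraic_over_def)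
  then show False using ind i by (auto simp: independent_seq_def)
qed

section \<open>Rings of polynomial functions\<close>

definition constants :: "('v \<Rightarrow> 'k::comm_ring_1) set" where
  "constants = range (\<lambda>c _. c)"

lemma subring_constants: "subring constants"
  by (auto simp: subring_def constants_def one_fun_def fun_diff_def times_fun_def)

lemma hom_on_precompose: "hom_on S (\<lambda>f z. f (h z))"
  by (auto simp: hom_on_def one_fun_def plus_fun_def times_fun_def)

lemma hom_on_eval: "hom_on S (\<lambda>f. f v)"
  by (auto simp: hom_on_def)

lemma poly_functions_eq_adjoin: "poly_functions C = adjoin constants C"
proof
  have S: "subring (adjoin constants C)" by (intro subring_adjoin subring_constants)
  show "poly_functions C \<subseteq> adjoin constants C"
  proof
    fix f assume "f \<in> poly_functions C"
    then show "f \<in> adjoin constants C"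
    proof induction
      case (const c)
      have "(\<lambda>_. c) \<in> constants" by (auto simp: constants_def)
      then show ?case using adjoin_base by blast
    next
      case (coord f)
      then show ?case using adjoin_gen by blast
    next
      case (add f g)
      then show ?case using subring_add[OF S] by (simp add: plus_fun_def)
    next
      case (mult f g)
      then show ?case using subring_mult[OF S] by (simp add: times_fun_def)
    qed
  qed
  have "subring (poly_functions C)"
    unfolding subring_def
  proof (intro conjI ballI)
    show "1 \<in> poly_functions C" unfolding one_fun_def by (rule poly_functions.const)
  next
    fix f g assume fg: "f \<in> poly_functions C" "g \<in> poly_functions C"
    have "(\<lambda>v. f v + (- 1) * g v) \<in> poly_functions C"
      using poly_functions.add[OF fg(1) poly_functions.mult[OF poly_functions.const fg(2)]] .
    then show "f - g \<in> poly_functions C" by (simp add: fun_diff_def)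
    show "f * g \<in> poly_functions C"
      using poly_functions.mult[OF fg] by (simp add: times_fun_def)
  qed
  moreover have "constants \<subseteq> poly_functions C" by (auto simp: constants_def intro: poly_functions.const)
  moreover have "C \<subseteq> poly_functions C" by (auto intro: poly_functions.coord)
  ultimately show "adjoin constants C \<subseteq> poly_functions C" by (intro adjoin_least)
qed

lemma subring_poly_functions: "subring (poly_functions C)"
  unfolding poly_functions_eq_adjoin by (intro subring_adjoin subring_constants)

lemma poly_functions_comp:
  assumes "f \<in> poly_functions C" "\<And>c. c \<in> C \<Longrightarrow> (\<lambda>z. c (h z)) \<in> poly_functions D"
  shows "(\<lambda>z. f (h z)) \<in> poly_functions D"
  using assms(1) by induction (auto intro: poly_functions.intros assms(2))

lemma poly_functions_sum:
  assumes "\<And>i. i \<in> I \<Longrightarrow> (\<lambda>v. f i v) \<in> poly_functions C"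
  shows "(\<lambda>v. \<Sum>i\<in>I. f i v) \<in> poly_functions C"
  using assms
proof (induction I rule: infinite_finite_induct)
  case (insert i I)
  then show ?case by (simp add: poly_functions.add)
qed (auto intro: poly_functions.const)

lemma poly_functions_prod:
  assumes "\<And>i. i \<in> I \<Longrightarrow> (\<lambda>v. f i v) \<in> poly_functions C"
  shows "(\<lambda>v. \<Prod>i\<in>I. f i v) \<in> poly_functions C"
  using assms
proof (induction I rule: infinite_finite_induct)
  case (insert i I)
  then show ?case by (simp add: poly_functions.mult)
qed (auto intro: poly_functions.const)

lemma adjoin_agree:
  assumes "\<And>k. k \<in> K \<Longrightarrow> k v = k w" "\<And>g. g \<in> G \<Longrightarrow> g v = g w" "a \<in> adjoin K G"
  shows "a v = (a w :: 'k::comm_ring_1)"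
proof -
  have "subring {a :: _ \<Rightarrow> 'k. a v = a w}" by (auto simp: subring_def)
  then have "adjoin K G \<subseteq> {a. a v = a w}" using assms by (intro adjoin_least) auto
  then show ?thesis using assms by auto
qed

lemma seq_coords_eq: "seq_coords m = (\<lambda>i t. t i) ` {..<m}"
  by (auto simp: seq_coords_def)

lemma poly_functions_seq_agree:
  assumes "p \<in> poly_functions (seq_coords m)" "\<And>i. i < m \<Longrightarrow> s i = t i"
  shows "p s = p t"
  using assms(1) unfolding poly_functions_eq_adjoin
  by (rule adjoin_agree[rotated 2]) (auto simp: constants_def seq_coords_def assms(2))

text \<open>
  A function whose value can be changed at will, without changing the functions in \<open>S\<close>, is
  transcendental: an equation for it would hold for infinitely many values.
\<close>
lemma not_algebraic_of_free_value:
  fixes c :: "'v \<Rightarrow> 'k::field_char_0"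
  assumes "\<And>v s. c (upd v s) = s" "\<And>a v s. a \<in> S \<Longrightarrow> a (upd v s) = a v"
  shows "\<not> algebraic_over S c"
proof
  assume "algebraic_over S c"
  then obtain p where p: "p \<in> polys_over S" "p \<noteq> 0" "poly p c = 0"
    by (auto simp: algebraic_over_def)
  have "coeff p i v = 0" for i v
  proof -
    have "poly (map_poly (\<lambda>f. f v) p) s = 0" for s
    proof -
      have "map_poly (\<lambda>f. f v) p = map_poly (\<lambda>f. f (upd v s)) p"
        by (rule poly_eqI) (simp add: coeff_map_poly assms(2) coeff_polys_over[OF p(1)])
      then have "poly (map_poly (\<lambda>f. f v) p) s = (poly p c) (upd v s)"
        using hom_on_poly[OF hom_on_eval subring_UNIV, of p c "upd v s"]
        by (simp add: assms(1) polys_over_def)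
      then show ?thesis using p by simp
    qed
    then have "map_poly (\<lambda>f. f v) p = 0" using poly_all_0_iff_0 by blast
    then have "coeff (map_poly (\<lambda>f. f v) p) i = 0" by simp
    then show ?thesis by (simp add: coeff_map_poly)
  qed
  then have "p = 0" by (intro poly_eqI ext) auto
  with p show False by simp
qed

lemma independent_seq_coords:
  "independent_seq (constants :: ((nat \<Rightarrow> 'k::field_char_0) \<Rightarrow> 'k) set) m (\<lambda>i t. t i)"
  unfolding independent_seq_def
proof (intro allI impI)
  fix i
  show "\<not> algebraic_over (adjoin constants ((\<lambda>i t. t i) ` {..<i})) (\<lambda>t::nat \<Rightarrow> 'k. t i)"
  proof (rule not_algebraic_of_free_value[where upd = "\<lambda>t s. t(i := s)"])
    fix a :: "(nat \<Rightarrow> 'k) \<Rightarrow> 'k" and v s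
    assume "a \<in> adjoin constants ((\<lambda>i t. t i) ` {..<i})"
    then show "a (v(i := s)) = a v"
      by (rule adjoin_agree[rotated 2]) (auto simp: constants_def)
  qed simp
qed

lemma independent_seq_param_coords:
  assumes "subring F"
  shows "independent_seq ((\<lambda>f (v::'v \<times> (nat \<Rightarrow> 'k::field_char_0)). f (fst v)) ` F) m (\<lambda>i v. snd v i)"
  unfolding independent_seq_def
proof (intro allI impI)
  fix i
  let ?K = "(\<lambda>f (v::'v \<times> (nat \<Rightarrow> 'k)). f (fst v)) ` F"
  show "\<not> algebraic_over (adjoin ?K ((\<lambda>i v. snd v i) ` {..<i})) (\<lambda>v. snd v i)"
  proof (rule not_algebraic_of_free_value[where upd = "\<lambda>v s. (fst v, (snd v)(i := s))"])
    fix a :: "'v \<times> (nat \<Rightarrow> 'k) \<Rightarrow> 'k" and v s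
    assume "a \<in> adjoin ?K ((\<lambda>i v. snd v i) ` {..<i})"
    then show "a (fst v, (snd v)(i := s)) = a v"
      by (rule adjoin_agree[rotated 2]) auto
  qed simp
qed

lemma of_nat_fun_apply: "(of_nat n :: 'v \<Rightarrow> 'k::comm_ring_1) v = of_nat n"
  by (induction n) auto

lemma subdomain_functions:
  fixes R :: "('v \<Rightarrow> 'k::field_char_0) set"
  assumes "subring R" "\<And>f g v w. f \<in> R \<Longrightarrow> g \<in> R \<Longrightarrow> f v \<noteq> 0 \<Longrightarrow> g w \<noteq> 0 \<Longrightarrow> \<exists>z. f z * g z \<noteq> 0"
  shows "subdomain R"
proof
  show "subring R" by fact
next
  fix f g assume fg: "f \<in> R" "g \<in> R" "f * g = 0"
  show "f = 0 \<or> g = 0"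
  proof (rule ccontr)
    assume "\<not> (f = 0 \<or> g = 0)"
    then obtain v w where "f v \<noteq> 0" "g w \<noteq> 0" by (auto simp: fun_eq_iff)
    then obtain z where "f z * g z \<noteq> 0" using assms(2) fg by blast
    moreover have "(f * g) z = 0" using fg by simp
    ultimately show False by simp
  qed
next
  fix n
  have "(of_nat (Suc n) :: 'v \<Rightarrow> 'k) v \<noteq> 0" for v
    unfolding of_nat_fun_apply by (rule of_nat_neq_0)
  then show "of_nat (Suc n) \<noteq> (0 :: 'v \<Rightarrow> 'k)"
    by (metis zero_fun_apply)
qed

lemma poly_functions_on_curve:
  fixes C :: "('v \<Rightarrow> 'k::comm_ring_1) set"
  assumes "f \<in> poly_functions C" "\<And>c. c \<in> C \<Longrightarrow> \<exists>p. \<forall>s. c (\<gamma> s) = poly p s"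
  shows "\<exists>p. \<forall>s. f (\<gamma> s) = poly p s"
  using assms(1)
proof induction
  case (const c)
  show ?case by (rule exI[of _ "[:c:]"]) simp
next
  case (coord f)
  then show ?case by (rule assms(2))
next
  case (add f g)
  then obtain p q where "\<forall>s. f (\<gamma> s) = poly p s" "\<forall>s. g (\<gamma> s) = poly q s" by auto
  then show ?case by (intro exI[of _ "p + q"]) simp
next
  case (mult f g)
  then obtain p q where "\<forall>s. f (\<gamma> s) = poly p s" "\<forall>s. g (\<gamma> s) = poly q s" by auto
  then show ?case by (intro exI[of _ "p * q"]) simp
qed

text \<open>
  Polynomial functions that are nonzero at \<open>v\<close> and at \<open>w\<close> restrict to nonzero polynomials in one
  variable along a curve through both points, and nonzero polynomials have a nonzero product.
\<close>
lemma subdomain_poly_functions_of_curves: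
  fixes C :: "('v \<Rightarrow> 'k::field_char_0) set"
  assumes "\<And>v w. \<exists>\<gamma>. \<gamma> 0 = v \<and> \<gamma> 1 = w \<and> (\<forall>c\<in>C. \<exists>p. \<forall>s. c (\<gamma> s) = poly p s)"
  shows "subdomain (poly_functions C)"
proof (rule subdomain_functions[OF subring_poly_functions])
  fix f g v w
  assume fg: "f \<in> poly_functions C" "g \<in> poly_functions C" "f v \<noteq> 0" "g w \<noteq> 0"
  obtain \<gamma> where \<gamma>: "\<gamma> 0 = v" "\<gamma> 1 = w" "\<forall>c\<in>C. \<exists>p. \<forall>s. c (\<gamma> s) = poly p s"
    using assms[of v w] by auto
  obtain p q where pq: "\<forall>s. f (\<gamma> s) = poly p s" "\<forall>s. g (\<gamma> s) = poly q s"
    using poly_functions_on_curve[OF fg(1), of \<gamma>] poly_functions_on_curve[OF fg(2), of \<gamma>] \<gamma>(3) by blast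
  have "poly p 0 \<noteq> 0" "poly q 1 \<noteq> 0"
    using pq \<gamma> fg by metis+
  then have "p * q \<noteq> 0" by auto
  then obtain s where "poly (p * q) s \<noteq> 0" using poly_all_0_iff_0 by blast
  then show "\<exists>z. f z * g z \<noteq> 0"
    using pq by (intro exI[of _ "\<gamma> s"]) auto
qed

lemma subdomain_seq: "subdomain (poly_functions (seq_coords l :: ((nat \<Rightarrow> 'k::field_char_0) \<Rightarrow> 'k) set))"
proof (rule subdomain_poly_functions_of_curves)
  fix v w :: "nat \<Rightarrow> 'k"
  have "\<exists>p. \<forall>s. v i + s * (w i - v i) = poly p s" for i
    by (rule exI[of _ "[:v i, w i - v i:]"]) simp
  then show "\<exists>\<gamma>. \<gamma> 0 = v \<and> \<gamma> 1 = w \<and> (\<forall>c\<in>seq_coords l. \<exists>p. \<forall>s. c (\<gamma> s) = poly p s)"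
    by (intro exI[of _ "\<lambda>s i. v i + s * (w i - v i)"]) (auto simp: seq_coords_def)
qed

lemma alg_independent_on_iff:
  fixes g :: "nat \<Rightarrow> 'k::field_char_0 ^ 'n \<Rightarrow> 'k"
  assumes "range \<Phi> = X"
  shows "alg_independent_on X m g \<longleftrightarrow> independent_seq constants m (\<lambda>i z. g i (\<Phi> z))"
proof -
  define \<theta> where "\<theta> p z = p (\<lambda>i. g i (\<Phi> z))" for p :: "(nat \<Rightarrow> 'k) \<Rightarrow> 'k" and z
  have \<theta>: "hom_on UNIV \<theta>"
    unfolding \<theta>_def by (rule hom_on_precompose)
  have eq: "(\<forall>x\<in>X. p (\<lambda>i. g i x) = 0) \<longleftrightarrow> \<theta> p = 0" "(\<forall>t. p t = 0) \<longleftrightarrow> p = 0" for p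
    using assms by (auto simp: \<theta>_def fun_eq_iff)
  have c: "\<theta> ` constants = constants"
    by (auto simp: \<theta>_def constants_def image_def fun_eq_iff)
  have t: "(\<lambda>i. \<theta> (\<lambda>t. t i)) = (\<lambda>i z. g i (\<Phi> z))"
    by (intro ext) (simp add: \<theta>_def)
  have inj: "a = 0" if "a \<in> constants" "\<theta> a = 0" for a
    using that by (auto simp: \<theta>_def constants_def fun_eq_iff)
  have "alg_independent_on X m g \<longleftrightarrow> (\<forall>p\<in>adjoin constants ((\<lambda>i t. t i) ` {..<m}). \<theta> p = 0 \<longrightarrow> p = 0)"
    unfolding alg_independent_on_def eq poly_functions_eq_adjoin seq_coords_eq ..
  also have "\<dots> \<longleftrightarrow> independent_seq (\<theta> ` constants) m (\<lambda>i. \<theta> (\<lambda>t. t i))"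
    using injective_of_independent_image[OF \<theta> subring_constants inj, of m "\<lambda>i t. t i"]
      independent_image_of_injective[OF \<theta> subring_constants independent_seq_coords, of m] by blast
  finally show ?thesis unfolding c t .
qed

lemma vanishes_on_closure:
  assumes "f \<in> poly_functions vec_coords" "\<And>x. x \<in> X \<Longrightarrow> f x = 0" "x \<in> zariski_closure X"
  shows "f x = 0"
proof -
  have "zariski_closed vec_coords {x. f x = 0}"
    unfolding zariski_closed_def using assms(1) by (intro exI[of _ "{f}"]) auto
  then show ?thesis using assms(2,3) by (auto simp: zariski_closure_def)
qed

lemma closure_superset: "X \<subseteq> zariski_closure X"
  by (auto simp: zariski_closure_def)

lemma alg_independent_on_closure:
  assumes "\<And>i. i < m \<Longrightarrow> g i \<in> poly_functions vec_coords"
  shows "alg_independent_on (zariski_closure X) m g \<longleftrightarrow> alg_independent_on X m g"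
proof -
  have "(\<forall>x\<in>zariski_closure X. p (\<lambda>i. g i x) = 0) \<longleftrightarrow> (\<forall>x\<in>X. p (\<lambda>i. g i x) = 0)"
    if "p \<in> poly_functions (seq_coords m)" for p
  proof -
    have "(\<lambda>x. p (\<lambda>i. g i x)) \<in> poly_functions vec_coords"
      by (rule poly_functions_comp[OF that]) (auto simp: seq_coords_def assms)
    from vanishes_on_closure[OF this, of X] closure_superset[of X] show ?thesis by blast
  qed
  then show ?thesis by (auto simp: alg_independent_on_def)
qed

section \<open>The dimension of a model\<close>

lemma sum_fun_apply: "(\<Sum>i\<in>I. f i) v = (\<Sum>i\<in>I. f i v :: 'k::comm_ring_1)"
  by (induction I rule: infinite_finite_induct) auto

text \<open>
  The coordinate functions of a model, transported to the source of a map \<open>\<Phi>\<close> onto it. They generate a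
  copy of the coordinate ring in which equality is equality of functions. For an image of a
  polynomial map, \<open>\<Phi>\<close> is that map; otherwise \<open>\<Phi>\<close> is any retraction onto the model.
\<close>
definition pullback :: "('z \<Rightarrow> 'k ^ 'n) \<Rightarrow> ('z \<Rightarrow> 'k) set" where
  "pullback \<Phi> = range (\<lambda>j z. \<Phi> z $ j)"

lemma finite_pullback: "finite (pullback (\<Phi> :: 'z \<Rightarrow> 'k ^ 'n))"
  by (simp add: pullback_def)

lemma poly_functions_pullback:
  fixes \<Phi> :: "'z \<Rightarrow> 'k::field ^ 'n"
  shows "poly_functions (pullback \<Phi>) = (\<lambda>f z. f (\<Phi> z)) ` poly_functions vec_coords"
proof -
  have "pullback \<Phi> = (\<lambda>f z. f (\<Phi> z)) ` vec_coords"
    by (auto simp: pullback_def vec_coords_def)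
  moreover have c: "(constants :: ('z \<Rightarrow> 'k) set) = (\<lambda>f z. f (\<Phi> z)) ` constants"
    by (auto simp: constants_def image_def fun_eq_iff)
  ultimately have "poly_functions (pullback \<Phi>) =
      adjoin ((\<lambda>f z. f (\<Phi> z)) ` constants) ((\<lambda>f z. f (\<Phi> z)) ` vec_coords)"
    by (simp only: poly_functions_eq_adjoin)
  then show ?thesis
    by (simp only: adjoin_image[OF hom_on_precompose] poly_functions_eq_adjoin)
qed

lemma zariski_closed_closure: "zariski_closed vec_coords (zariski_closure X)"
proof -
  define I where "I = {f \<in> poly_functions vec_coords. \<forall>x\<in>X. f x = 0}"
  have "zariski_closure X = {x. \<forall>f\<in>I. f x = 0}"
  proof
    show "zariski_closure X \<subseteq> {x. \<forall>f\<in>I. f x = 0}"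
      using vanishes_on_closure by (force simp: I_def)
    have "zariski_closed vec_coords {x. \<forall>f\<in>I. f x = 0}"
      unfolding zariski_closed_def by (intro exI[of _ I]) (auto simp: I_def)
    moreover have "{x. \<forall>f\<in>I. f x = 0} \<subseteq> Z" if Z: "zariski_closed vec_coords Z" "X \<subseteq> Z" for Z
    proof -
      obtain F where F: "F \<subseteq> poly_functions vec_coords" "Z = {v. \<forall>f\<in>F. f v = 0}"
        using Z by (auto simp: zariski_closed_def)
      then have "F \<subseteq> I" using Z by (auto simp: I_def)
      then show ?thesis using F by auto
    qed
    ultimately show "{x. \<forall>f\<in>I. f x = 0} \<subseteq> zariski_closure X"
      by (auto simp: zariski_closure_def)
  qed
  then show ?thesis
    unfolding zariski_closed_def by (intro exI[of _ I]) (auto simp: I_def)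
qed

lemma zariski_closed_Int_zero:
  assumes "zariski_closed C V" "f \<in> poly_functions C"
  shows "zariski_closed C {x \<in> V. f x = 0}"
proof -
  obtain F where "F \<subseteq> poly_functions C" "V = {v. \<forall>f\<in>F. f v = 0}"
    using assms by (auto simp: zariski_closed_def)
  then show ?thesis
    unfolding zariski_closed_def using assms by (intro exI[of _ "insert f F"]) auto
qed

lemma subdomain_pullback:
  fixes X :: "('k::field_char_0 ^ 'n) set"
  assumes irr: "zariski_irreducible (zariski_closure X)" and \<Phi>: "range \<Phi> = X"
  shows "subdomain (poly_functions (pullback \<Phi>))"
proof (rule subdomain_functions[OF subring_poly_functions])
  fix f g v w
  assume fg: "f \<in> poly_functions (pullback \<Phi>)" "g \<in> poly_functions (pullback \<Phi>)" "f v \<noteq> 0" "g w \<noteq> 0"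
  obtain p q where pq: "p \<in> poly_functions vec_coords" "f = (\<lambda>z. p (\<Phi> z))"
      "q \<in> poly_functions vec_coords" "g = (\<lambda>z. q (\<Phi> z))"
    using fg(1,2) by (auto simp: poly_functions_pullback)
  let ?V = "zariski_closure X"
  show "\<exists>z. f z * g z \<noteq> 0"
  proof (rule ccontr)
    assume "\<not> (\<exists>z. f z * g z \<noteq> 0)"
    then have 0: "p x * q x = 0" if "x \<in> X" for x
      using that \<Phi> pq by auto
    have "p x * q x = 0" if "x \<in> ?V" for x
      by (rule vanishes_on_closure[OF poly_functions.mult[OF pq(1,3)] 0 that])
    then have "?V = {x \<in> ?V. p x = 0} \<union> {x \<in> ?V. q x = 0}" by auto
    moreover have "\<Phi> v \<in> ?V" "\<Phi> w \<in> ?V" using \<Phi> closure_superset[of X] by auto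
    then have "{x \<in> ?V. p x = 0} \<subset> ?V" "{x \<in> ?V. q x = 0} \<subset> ?V"
      using fg(3,4) pq by auto
    ultimately show False
      using irr zariski_closed_Int_zero[OF zariski_closed_closure pq(1), of X]
        zariski_closed_Int_zero[OF zariski_closed_closure pq(3), of X]
      unfolding zariski_irreducible_def by blast
  qed
qed

lemma variety_dim_eq_max:
  assumes "\<And>i. i < d \<Longrightarrow> g i \<in> poly_functions vec_coords" "alg_independent_on V d g"
    and "\<And>m g. (\<And>i. i < m \<Longrightarrow> g i \<in> poly_functions vec_coords) \<Longrightarrow> alg_independent_on V m g \<Longrightarrow> m \<le> d"
  shows "variety_dim V = d"
  unfolding variety_dim_def by (rule cSup_eq_maximum) (use assms in auto)

text \<open>
  The dimension is attained by coordinate functions: a maximal independent set of them has the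
  remaining ones algebraic over it, and \<open>independent_seq_bound\<close> excludes longer independent sequences.
  In particular the supremum in the definition of the dimension is a maximum.
\<close>
lemma transcendence_basis_of_coordinates:
  fixes X :: "('k::field_char_0 ^ 'n) set"
  assumes irr: "zariski_irreducible (zariski_closure X)" and \<Phi>: "range \<Phi> = X"
  shows "\<exists>b. independent_seq constants (model_dim X) b \<and> (\<forall>i<model_dim X. b i \<in> pullback \<Phi>) \<and>
      (\<forall>c\<in>pullback \<Phi>. algebraic_over (adjoin constants (b ` {..<model_dim X})) c)"
    and "\<And>m g. independent_seq constants m g \<Longrightarrow> (\<And>i. i < m \<Longrightarrow> g i \<in> poly_functions (pullback \<Phi>)) \<Longrightarrow> m \<le> model_dim X"
proof -
  let ?R = "poly_functions (pullback \<Phi>)"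
  interpret subdomain ?R by (rule subdomain_pullback[OF irr \<Phi>])
  note c = subring_constants
  obtain m b where b: "\<forall>i<m. b i \<in> pullback \<Phi>" "independent_seq constants m b"
      "\<forall>c\<in>pullback \<Phi>. algebraic_over (adjoin constants (b ` {..<m})) c"
    using extend_to_transcendence_basis[OF c finite_pullback[of \<Phi>], of 0 "\<lambda>_. 0"]
    by (auto simp: independent_seq_def)
  let ?S = "adjoin constants (b ` {..<m})"
  have bsub: "b ` {..<m} \<subseteq> pullback \<Phi>" using b by auto
  then have un: "b ` {..<m} \<union> pullback \<Phi> = pullback \<Phi>" by auto
  have SR: "?S \<subseteq> ?R"
    unfolding poly_functions_eq_adjoin by (rule adjoin_mono[OF c order.refl bsub])
  have KR: "constants \<subseteq> ?R" unfolding poly_functions_eq_adjoin by (rule adjoin_base)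
  have fin: "finite_over ?S ?R"
    using finite_over_adjoin_finite[OF c subring_adjoin[OF c] order.refl, of "b ` {..<m}" "pullback \<Phi>"]
      finite_over_refl[OF subring_adjoin[OF c] SR] finite_pullback[of \<Phi>] b(3)
    unfolding un poly_functions_eq_adjoin by auto
  have max: "n \<le> m" if "independent_seq constants n g" "\<And>i. i < n \<Longrightarrow> g i \<in> ?R" for n g
  proof -
    have "n \<le> card (b ` {..<m})"
      by (rule independent_seq_bound[OF c KR _ SR subring order.refl fin that]) auto
    also have "\<dots> \<le> m" using card_image_le[of "{..<m}" b] by simp
    finally show ?thesis .
  qed
  have "\<forall>i. \<exists>p. i < m \<longrightarrow> p \<in> poly_functions vec_coords \<and> b i = (\<lambda>z. p (\<Phi> z))"
    using SR bsub adjoin_gen[of "b ` {..<m}" constants] by (force simp: poly_functions_pullback)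
  then obtain p where p: "\<And>i. i < m \<Longrightarrow> p i \<in> poly_functions vec_coords \<and> b i = (\<lambda>z. p i (\<Phi> z))"
    by metis
  have dim: "model_dim X = m"
    unfolding model_dim_def
  proof (rule variety_dim_eq_max)
    show "p i \<in> poly_functions vec_coords" if "i < m" for i using p that by auto
    have "independent_seq constants m (\<lambda>i z. p i (\<Phi> z))"
      using independent_seq_cong[of m b "\<lambda>i z. p i (\<Phi> z)" constants] p b(2) by auto
    then show "alg_independent_on (zariski_closure X) m p"
      using p by (subst alg_independent_on_closure) (auto simp: alg_independent_on_iff[OF \<Phi>])
  next
    fix n and g :: "nat \<Rightarrow> 'k ^ 'n \<Rightarrow> 'k"
    assume g: "\<And>i. i < n \<Longrightarrow> g i \<in> poly_functions vec_coords" "alg_independent_on (zariski_closure X) n g"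
    then have "independent_seq constants n (\<lambda>i z. g i (\<Phi> z))"
      by (subst (asm) alg_independent_on_closure) (auto simp: alg_independent_on_iff[OF \<Phi>])
    then show "n \<le> m" by (rule max) (use g(1) in \<open>auto simp: poly_functions_pullback\<close>)
  qed
  show "\<exists>b. independent_seq constants (model_dim X) b \<and> (\<forall>i<model_dim X. b i \<in> pullback \<Phi>) \<and>
      (\<forall>c\<in>pullback \<Phi>. algebraic_over (adjoin constants (b ` {..<model_dim X})) c)"
    unfolding dim using b by auto
  show "\<And>m g. independent_seq constants m g \<Longrightarrow> (\<And>i. i < m \<Longrightarrow> g i \<in> ?R) \<Longrightarrow> m \<le> model_dim X"
    unfolding dim by (rule max)
qed

lemma model_dim_pos_imp_nonempty:
  assumes "model_dim X > 0"
  shows "X \<noteq> {}"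
proof
  assume "X = {}"
  have "zariski_closed vec_coords ({} :: ('a ^ 'b) set)"
    unfolding zariski_closed_def
    by (intro exI[of _ "{\<lambda>_. 1}"]) (auto intro: poly_functions.const)
  then have V: "zariski_closure X = {}" using \<open>X = {}\<close> by (auto simp: zariski_closure_def)
  have "\<not> alg_independent_on ({} :: ('a ^ 'b) set) m g" for m g
    by (auto simp: alg_independent_on_def intro!: bexI[of _ "\<lambda>_. 1"] poly_functions.const)
  then show False using assms by (simp add: model_dim_def V variety_dim_def)
qed

section \<open>The relation between a matrix and its measurements\<close>

text \<open>
  The rows of a matrix are a sequence of vectors, so that \<open>d + 1\<close> rows need no index type of that size.
\<close>
definition row_coords :: "((nat \<Rightarrow> 'k::field ^ 'n) \<Rightarrow> 'k) set" where
  "row_coords = {\<lambda>A. A i $ j | i j. True}"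

lemma subdomain_rows: "subdomain (poly_functions (row_coords :: ((nat \<Rightarrow> 'k::field_char_0 ^ 'n) \<Rightarrow> 'k) set))"
proof (rule subdomain_poly_functions_of_curves)
  fix v w :: "nat \<Rightarrow> 'k ^ 'n"
  have "\<exists>p. \<forall>s. v i $ j + (s * w i $ j - s * v i $ j) = poly p s" for i j
    by (rule exI[of _ "[:v i $ j, w i $ j - v i $ j:]"]) (simp add: algebra_simps)
  then show "\<exists>\<gamma>. \<gamma> 0 = v \<and> \<gamma> 1 = w \<and> (\<forall>c\<in>row_coords. \<exists>p. \<forall>s. c (\<gamma> s) = poly p s)"
    by (intro exI[of _ "\<lambda>s i. v i + s *s (w i - v i)"]) (auto simp: row_coords_def algebra_simps)
qed

definition dotp :: "'k::field ^ 'n \<Rightarrow> 'k ^ 'n \<Rightarrow> 'k" where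
  "dotp a x = (\<Sum>j\<in>UNIV. a $ j * x $ j)"

lemma matrix_vector_dotp: "(A *v x) $ i = dotp (A $ i) x"
  by (simp add: matrix_vector_mult_def dotp_def)

lemma dotp_add: "dotp (a + b) x = dotp a x + dotp b x"
  by (simp add: dotp_def sum.distrib distrib_right)

lemma dotp_scale: "dotp (c *s a) x = c * dotp a x"
  by (simp add: dotp_def sum_distrib_left mult.assoc)

lemma dotp_axis: "dotp (axis j 1) x = x $ j"
  by (simp add: dotp_def axis_def if_distrib[of "\<lambda>a. a * _"] cong: if_cong)

text \<open>
  Only the first \<open>d + 1\<close> rows are measured. The remaining values are zero, so that equality of
  measurements is equality of functions.
\<close>
definition measurements :: "nat \<Rightarrow> (nat \<Rightarrow> 'k::field ^ 'n) \<Rightarrow> 'k ^ 'n \<Rightarrow> nat \<Rightarrow> 'k" where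
  "measurements d A x = (\<lambda>i. if i \<le> d then dotp (A i) x else 0)"

text \<open>
  Polynomials in the entries of the rows, as functions of pairs of rows and a second argument. They are the
  ring of constants when a matrix with indeterminate entries is considered.
\<close>
definition row_params :: "((nat \<Rightarrow> 'k::field ^ 'n) \<times> 'w \<Rightarrow> 'k) set" where
  "row_params = (\<lambda>f v. f (fst v)) ` poly_functions row_coords"

definition value_coords :: "nat \<Rightarrow> ('v \<times> (nat \<Rightarrow> 'k) \<Rightarrow> 'k) set" where
  "value_coords d = (\<lambda>i v. snd v i) ` {..<Suc d}"

lemma subring_row_params: "subring row_params"
  unfolding row_params_def by (intro subring_image hom_on_precompose subring_poly_functions)

lemma constants_row_params: "constants \<subseteq> row_params"
  unfolding row_params_def constants_def by (auto intro!: image_eqI[of _ _ "\<lambda>_. c" for c] poly_functions.const)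

text \<open>
  Irreducibility of the product of an affine space with an irreducible variety. Two functions that do not vanish
  at some points do not vanish at a common point \<open>z\<close> of the model, each for its own matrix, and
  then not at a common matrix.
\<close>
lemma subdomain_rows_times_model:
  fixes X :: "('k::field_char_0 ^ 'n) set" and \<Phi> :: "'z \<Rightarrow> 'k ^ 'n"
  assumes irr: "zariski_irreducible (zariski_closure X)" and \<Phi>: "range \<Phi> = X"
  shows "subdomain (adjoin (row_params :: ((nat \<Rightarrow> 'k ^ 'n) \<times> 'z \<Rightarrow> 'k) set) ((\<lambda>f v. f (snd v)) ` pullback \<Phi>))"
    (is "subdomain ?R")
proof (rule subdomain_functions[OF subring_adjoin[OF subring_row_params]])
  fix f g :: "(nat \<Rightarrow> 'k ^ 'n) \<times> 'z \<Rightarrow> 'k" and v w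
  assume f: "f \<in> ?R" and g: "g \<in> ?R" and nz: "f v \<noteq> 0" "g w \<noteq> 0"
  have fixA: "(\<lambda>z. h (A, z)) \<in> poly_functions (pullback \<Phi>)" if "h \<in> ?R" for h A
    by (rule hom_adjoin[OF hom_on_precompose subring_poly_functions _ _ that])
      (auto simp: row_params_def intro: poly_functions.intros)
  have fixz: "(\<lambda>A. h (A, z)) \<in> poly_functions row_coords" if "h \<in> ?R" for h z
    by (rule hom_adjoin[OF hom_on_precompose subring_poly_functions _ _ that])
      (auto simp: row_params_def intro: poly_functions.intros)
  interpret P: subdomain "poly_functions (pullback \<Phi>)" by (rule subdomain_pullback[OF irr \<Phi>])
  interpret Q: subdomain "poly_functions (row_coords :: ((nat \<Rightarrow> 'k ^ 'n) \<Rightarrow> 'k) set)" by (rule subdomain_rows)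
  have "(\<lambda>z. f (fst v, z)) \<noteq> 0" "(\<lambda>z. g (fst w, z)) \<noteq> 0"
    using nz by (auto simp: fun_eq_iff intro: exI[of _ "snd v"] exI[of _ "snd w"])
  then have "(\<lambda>z. f (fst v, z)) * (\<lambda>z. g (fst w, z)) \<noteq> 0"
    by (intro P.mult_neq_0 fixA f g)
  then obtain z where "f (fst v, z) \<noteq> 0" "g (fst w, z) \<noteq> 0"
    by (auto simp: fun_eq_iff)
  then have "(\<lambda>A. f (A, z)) \<noteq> 0" "(\<lambda>A. g (A, z)) \<noteq> 0"
    by (auto simp: fun_eq_iff)
  then have "(\<lambda>A. f (A, z)) * (\<lambda>A. g (A, z)) \<noteq> 0"
    by (intro Q.mult_neq_0 fixz f g)
  then obtain A where "f (A, z) * g (A, z) \<noteq> 0"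
    by (auto simp: fun_eq_iff)
  then show "\<exists>v. f v * g v \<noteq> 0" by blast
qed

text \<open>
  Over the polynomials in \<open>A\<close>, the coordinate ring still has transcendence degree \<open>d\<close>. So the \<open>d + 1\<close>
  measurements are dependent over them, which is the relation \<open>F\<close>.
\<close>
lemma incidence_relation_exists:
  fixes X :: "('k::field_char_0 ^ 'n) set"
  assumes irr: "zariski_irreducible (zariski_closure X)" and X: "X \<noteq> {}"
  shows "\<exists>F \<in> adjoin row_params (value_coords (model_dim X)). F \<noteq> 0 \<and>
    (\<forall>A. \<forall>x\<in>X. F (A, measurements (model_dim X) A x) = 0)"
proof (rule ccontr)
  define d where "d = model_dim X"
  assume "\<not> ?thesis"
  then have none: "F = 0" if "F \<in> adjoin row_params (value_coords d)"
      "\<And>A x. x \<in> X \<Longrightarrow> F (A, measurements d A x) = 0" for F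
    using that by (auto simp: d_def)
  obtain x0 where x0: "x0 \<in> X" using X by auto
  define \<rho> where "\<rho> x = (if x \<in> X then x else x0)" for x
  have \<rho>: "range \<rho> = X" using x0 by (auto simp: \<rho>_def image_def)
  define K where "K = (row_params :: ((nat \<Rightarrow> 'k ^ 'n) \<times> ('k ^ 'n) \<Rightarrow> 'k) set)"
  define P where "P = (\<lambda>f (v :: (nat \<Rightarrow> 'k ^ 'n) \<times> ('k ^ 'n)). f (snd v)) ` pullback \<rho>"
  define R where "R = adjoin K P"
  have K: "subring K" unfolding K_def by (rule subring_row_params)
  interpret subdomain R
    unfolding R_def K_def P_def by (rule subdomain_rows_times_model[OF irr \<rho>])
  obtain b where b: "\<forall>i<d. b i \<in> pullback \<rho>"
      "\<forall>c\<in>pullback \<rho>. algebraic_over (adjoin constants (b ` {..<d})) c"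
    using transcendence_basis_of_coordinates(1)[OF irr \<rho>] unfolding d_def by auto
  define B where "B = (\<lambda>f (v :: (nat \<Rightarrow> 'k ^ 'n) \<times> ('k ^ 'n)). f (snd v)) ` b ` {..<d}"
  have B: "finite B" "card B \<le> d" "B \<subseteq> P"
    using b(1) card_image_le[of "{..<d}" "\<lambda>i (v :: (nat \<Rightarrow> 'k ^ 'n) \<times> ('k ^ 'n)). b i (snd v)"]
    by (auto simp: B_def P_def image_image)
  have BP: "B \<union> P = P" using B by auto
  have SR: "adjoin K B \<subseteq> R" unfolding R_def by (rule adjoin_mono[OF K order.refl B(3)])
  have alg: "algebraic_over (adjoin K B) c" if "c \<in> P" for c
  proof -
    let ?\<theta> = "\<lambda>f (v :: (nat \<Rightarrow> 'k ^ 'n) \<times> ('k ^ 'n)). f (snd v)"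
    obtain a where a: "a \<in> pullback \<rho>" "c = ?\<theta> a" using \<open>c \<in> P\<close> by (auto simp: P_def)
    have "algebraic_over (?\<theta> ` adjoin constants (b ` {..<d})) (?\<theta> a)"
      by (rule algebraic_over_image[OF hom_on_precompose]) (use a b in \<open>auto simp: fun_eq_iff\<close>)
    moreover have "?\<theta> ` adjoin constants (b ` {..<d}) = adjoin (?\<theta> ` constants) B"
      unfolding B_def by (rule adjoin_image[OF hom_on_precompose, symmetric])
    moreover have "?\<theta> ` constants \<subseteq> K"
      using constants_row_params unfolding K_def by (force simp: constants_def)
    then have "adjoin (?\<theta> ` constants) B \<subseteq> adjoin K B"
      by (intro adjoin_mono K order.refl)
    ultimately show ?thesis using a by (auto intro: algebraic_over_mono)
  qed
  have "finite_over (adjoin K B) (adjoin K (B \<union> P))"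
  proof (rule finite_over_adjoin_finite[OF K subring_adjoin[OF K] order.refl])
    show "finite P" unfolding P_def by (rule finite_imageI[OF finite_pullback])
  qed (use alg in \<open>simp_all add: BP R_def[symmetric] finite_over_refl[OF subring_adjoin[OF K] SR]\<close>)
  then have fin: "finite_over (adjoin K B) R"
    by (simp add: BP R_def)
  define \<theta> where "\<theta> F v = F (fst v, measurements d (fst v) (\<rho> (snd v)))"
    for F :: "(nat \<Rightarrow> 'k ^ 'n) \<times> (nat \<Rightarrow> 'k) \<Rightarrow> 'k" and v
  have \<theta>: "hom_on UNIV \<theta>"
    unfolding \<theta>_def by (rule hom_on_precompose)
  have \<theta>K: "\<theta> ` row_params = K"
  proof -
    have "\<theta> (\<lambda>v. f (fst v)) = (\<lambda>v. f (fst v))" for f by (simp add: \<theta>_def fun_eq_iff)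
    then show ?thesis by (simp add: K_def row_params_def image_image)
  qed
  have "independent_seq (\<theta> ` row_params) (Suc d) (\<lambda>i. \<theta> (\<lambda>v. snd v i))"
  proof (rule independent_image_of_injective[OF \<theta> subring_row_params])
    show "independent_seq (row_params :: ((nat \<Rightarrow> 'k ^ 'n) \<times> (nat \<Rightarrow> 'k) \<Rightarrow> 'k) set) (Suc d) (\<lambda>i v. snd v i)"
      unfolding row_params_def by (rule independent_seq_param_coords[OF subring_poly_functions])
    fix F assume F: "F \<in> adjoin row_params ((\<lambda>i v. snd v i) ` {..<Suc d})" "\<theta> F = 0"
    show "F = 0"
    proof (rule none)
      fix A x assume "x \<in> X"
      then have "\<theta> F (A, x) = F (A, measurements d A x)" by (simp add: \<theta>_def \<rho>_def)
      then show "F (A, measurements d A x) = 0" using F by simp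
    qed (use F in \<open>simp add: value_coords_def\<close>)
  qed
  then have ind: "independent_seq K (Suc d) (\<lambda>i. \<theta> (\<lambda>v. snd v i))"
    unfolding \<theta>K .
  have "Suc d \<le> card B"
  proof (rule independent_seq_bound[OF K _ B(1) SR subring order.refl fin ind])
    show "K \<subseteq> R" unfolding R_def by (rule adjoin_base)
  next
    fix i assume i: "i < Suc d"
    have "\<theta> (\<lambda>v. snd v i) = (\<Sum>j\<in>UNIV. (\<lambda>v. fst v i $ j) * (\<lambda>v. \<rho> (snd v) $ j))"
      using i by (auto simp: \<theta>_def measurements_def dotp_def fun_eq_iff sum_fun_apply)
    also have "\<dots> \<in> R"
    proof (intro subring_sum subring_mult subring)
      fix j
      have "(\<lambda>A::nat \<Rightarrow> 'k ^ 'n. A i $ j) \<in> poly_functions row_coords"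
        by (intro poly_functions.coord) (auto simp: row_coords_def)
      then have "(\<lambda>v. fst v i $ j) \<in> K" unfolding K_def row_params_def by (force simp: image_iff)
      then show "(\<lambda>v. fst v i $ j) \<in> R" unfolding R_def using adjoin_base by blast
      have "(\<lambda>v. \<rho> (snd v) $ j) \<in> P" by (auto simp: P_def pullback_def)
      then show "(\<lambda>v. \<rho> (snd v) $ j) \<in> R" unfolding R_def using adjoin_gen by blast
    qed
    finally show "\<theta> (\<lambda>v. snd v i) \<in> R" .
  qed
  with B show False by simp
qed

text \<open>
  The degree \<open>N\<close> counts only the values; the entries of the matrix are coefficients.
\<close>
definition is_minimal_relation where
  "is_minimal_relation X N F \<longleftrightarrow>
    degree_le row_params (value_coords (model_dim X)) N F \<and> F \<noteq> 0 \<and>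
    (\<forall>A. \<forall>x\<in>X. F (A, measurements (model_dim X) A x) = 0) \<and>
    (\<forall>M G. M < N \<longrightarrow> degree_le row_params (value_coords (model_dim X)) M G \<longrightarrow>
      (\<forall>A. \<forall>x\<in>X. G (A, measurements (model_dim X) A x) = 0) \<longrightarrow> G = 0)"

lemma minimal_relation_exists:
  fixes X :: "('k::field_char_0 ^ 'n) set"
  assumes irr: "zariski_irreducible (zariski_closure X)" and X: "X \<noteq> {}"
  obtains N F where "is_minimal_relation X N F"
proof -
  let ?Q = "\<lambda>N. \<exists>F. degree_le row_params (value_coords (model_dim X)) N F \<and> F \<noteq> 0 \<and>
    (\<forall>A. \<forall>x\<in>X. F (A, measurements (model_dim X) A x) = 0)"
  have "\<exists>N. ?Q N"
    using incidence_relation_exists[OF assms] by (auto simp: adjoin_def)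
  then have "?Q (LEAST N. ?Q N)" by (rule LeastI_ex)
  moreover have "\<not> ?Q M" if "M < (LEAST N. ?Q N)" for M using not_less_Least[OF that] .
  ultimately show thesis using that unfolding is_minimal_relation_def by blast
qed

lemma relation_agree:
  assumes "F \<in> adjoin row_params (value_coords d)" "\<And>i. i \<le> d \<Longrightarrow> s i = t i"
  shows "F (A, s) = F (A, t)"
  by (rule adjoin_agree[OF _ _ assms(1)]) (auto simp: row_params_def value_coords_def assms(2))

section \<open>More measurements than the dimension\<close>

lemma row_poly_deriv:
  fixes f :: "(nat \<Rightarrow> 'k::real_normed_field ^ 'n) \<Rightarrow> 'k"
  assumes "f \<in> poly_functions row_coords"
  shows "\<exists>f'. \<forall>j A a. ((\<lambda>h. f (A(i := A i + (h * a) *s axis j 1))) has_field_derivative a * f' j A) (at 0)"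
  using assms
proof induction
  case (const c)
  show ?case by (rule exI[of _ "\<lambda>_ _. 0"]) simp
next
  case (coord f)
  then obtain r k where f: "f = (\<lambda>A. A r $ k)" by (auto simp: row_coords_def)
  show ?case
  proof (rule exI[of _ "\<lambda>j _. if r = i \<and> k = j then 1 else 0"], intro allI)
    fix j and A :: "nat \<Rightarrow> 'k ^ 'n" and a :: 'k
    have "(\<lambda>h. f (A(i := A i + (h * a) *s axis j 1))) = (\<lambda>h. A r $ k + h * (if r = i \<and> k = j then a else 0))"
      by (auto simp: f axis_def fun_eq_iff)
    moreover have "((\<lambda>h. A r $ k + h * (if r = i \<and> k = j then a else 0)) has_field_derivative (if r = i \<and> k = j then a else 0)) (at 0)"
      by (auto intro!: derivative_eq_intros)
    moreover have e: "a * (if r = i \<and> k = j then 1 else 0) = (if r = i \<and> k = j then a else 0)" by simp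
    ultimately show "((\<lambda>h. f (A(i := A i + (h * a) *s axis j 1))) has_field_derivative
        a * (if r = i \<and> k = j then 1 else 0)) (at 0)"
      unfolding e by (simp only:)
  qed
next
  case (add f g)
  then obtain f' g' where
    f': "\<And>j A a. ((\<lambda>h. f (A(i := A i + (h * a) *s axis j 1))) has_field_derivative a * f' j A) (at 0)"
    and g': "\<And>j A a. ((\<lambda>h. g (A(i := A i + (h * a) *s axis j 1))) has_field_derivative a * g' j A) (at 0)"
    by blast
  show ?case
  proof (rule exI[of _ "\<lambda>j A. f' j A + g' j A"], intro allI)
    fix j A a
    show "((\<lambda>h. f (A(i := A i + (h * a) *s axis j 1)) + g (A(i := A i + (h * a) *s axis j 1)))
        has_field_derivative a * (f' j A + g' j A)) (at 0)"
      unfolding distrib_left by (intro DERIV_add f' g')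
  qed
next
  case (mult f g)
  then obtain f' g' where
    f': "\<And>j A a. ((\<lambda>h. f (A(i := A i + (h * a) *s axis j 1))) has_field_derivative a * f' j A) (at 0)"
    and g': "\<And>j A a. ((\<lambda>h. g (A(i := A i + (h * a) *s axis j 1))) has_field_derivative a * g' j A) (at 0)"
    by blast
  show ?case
  proof (rule exI[of _ "\<lambda>j A. f' j A * g A + g' j A * f A"], intro allI)
    fix j A a
    show "((\<lambda>h. f (A(i := A i + (h * a) *s axis j 1)) * g (A(i := A i + (h * a) *s axis j 1)))
        has_field_derivative a * (f' j A * g A + g' j A * f A)) (at 0)"
      using DERIV_mult[OF f'[of A a j] g'[of A a j]] by (simp add: algebra_simps)
  qed
qed

text \<open>
  Partial derivatives of a relation by the entry \<open>(i, j)\<close> of the matrix and by the value \<open>i\<close>, taken along a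
  common line. The derivative \<open>FY\<close> by the value must again be a polynomial of smaller degree, because
  minimality is applied to it; of \<open>FA\<close> only the existence matters.
\<close>
lemma relation_deriv:
  fixes F :: "(nat \<Rightarrow> 'k::real_normed_field ^ 'n) \<times> (nat \<Rightarrow> 'k) \<Rightarrow> 'k"
  assumes "degree_le row_params (value_coords d) N F"
  shows "\<exists>FY FA. degree_le row_params (value_coords d) (N - 1) FY \<and> (N = 0 \<longrightarrow> FY = 0) \<and>
    (\<forall>j A Y a b. ((\<lambda>h. F (A(i := A i + (h * a) *s axis j 1), Y(i := Y i + h * b)))
      has_field_derivative a * FA j (A, Y) + b * FY (A, Y)) (at 0))"
proof -
  let ?D = "\<lambda>N F FY FA. degree_le row_params (value_coords d) (N - 1) FY \<and> (N = 0 \<longrightarrow> FY = 0) \<and>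
    (\<forall>j A Y a b. ((\<lambda>h. F (A(i := A i + (h * a) *s axis j 1), Y(i := Y i + h * b)))
      has_field_derivative a * FA j (A, Y) + b * FY (A, Y)) (at (0::'k)))"
  have zero: "degree_le row_params (value_coords d) n 0" for n
    by (intro degree_le_base subring_0 subring_row_params)
  show ?thesis
    using assms
  proof induction
    case (base F)
    then obtain f where f: "f \<in> poly_functions row_coords" "F = (\<lambda>v. f (fst v))"
      by (auto simp: row_params_def)
    obtain f' where "\<And>j A a. ((\<lambda>h. f (A(i := A i + (h * a) *s axis j 1))) has_field_derivative a * f' j A) (at 0)"
      using row_poly_deriv[OF f(1)] by blast
    then show ?case
      by (intro exI[of _ "0 :: _ \<Rightarrow> 'k"] exI[of _ "\<lambda>j v. f' j (fst v)"] conjI zero)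
        (simp_all add: f(2) del: fun_upd_apply)
  next
    case (gen F)
    then obtain r where r: "F = (\<lambda>v. snd v r)" "r \<le> d" by (auto simp: value_coords_def)
    have "((\<lambda>h. F (A(i := A i + (h * a) *s axis j 1), Y(i := Y i + h * b)))
        has_field_derivative (if r = i then b else 0)) (at 0)" for j A Y a b
    proof -
      have "(\<lambda>h. F (A(i := A i + (h * a) *s axis j 1), Y(i := Y i + h * b))) = (\<lambda>h. Y r + h * (if r = i then b else 0))"
        by (auto simp: r)
      then show ?thesis by (auto intro!: derivative_eq_intros)
    qed
    moreover have "degree_le row_params (value_coords d) 0 (\<lambda>_. if r = i then 1 else 0)"
      by (intro degree_le.base subsetD[OF constants_row_params]) (auto simp: constants_def)
    ultimately show ?case
      by (rule_tac exI[of _ "\<lambda>_. if r = i then 1 else 0"], rule_tac exI[of _ "\<lambda>_ _. 0"])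
        (cases "r = i"; simp del: fun_upd_apply)
  next
    case (add n F G)
    then obtain FY FA GY GA where F: "?D n F FY FA" and G: "?D n G GY GA" by blast
    show ?case
    proof (intro exI[of _ "FY + GY"] exI[of _ "\<lambda>j v. FA j v + GA j v"] conjI allI impI)
      show "degree_le row_params (value_coords d) (n - 1) (FY + GY)"
        using F G by (intro degree_le.add) auto
      show "FY + GY = 0" if "n = 0" using that F G by simp
      fix j A Y a b
      have "((\<lambda>h. F (A(i := A i + (h * a) *s axis j 1), Y(i := Y i + h * b)) +
          G (A(i := A i + (h * a) *s axis j 1), Y(i := Y i + h * b))) has_field_derivative
          (a * FA j (A, Y) + b * FY (A, Y)) + (a * GA j (A, Y) + b * GY (A, Y))) (at 0)"
        using F G by (intro DERIV_add) blast+
      then show "((\<lambda>h. (F + G) (A(i := A i + (h * a) *s axis j 1), Y(i := Y i + h * b))) has_field_derivative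
          a * (FA j (A, Y) + GA j (A, Y)) + b * (FY + GY) (A, Y)) (at 0)"
        by (simp add: algebra_simps)
    qed
  next
    case (mult m F n G)
    then obtain FY FA GY GA where F: "?D m F FY FA" and G: "?D n G GY GA" by blast
    show ?case
    proof (intro exI[of _ "FY * G + F * GY"] exI[of _ "\<lambda>j v. FA j v * G v + GA j v * F v"] conjI allI impI)
      have "degree_le row_params (value_coords d) (m + n - 1) (FY * G)"
        using F degree_le.mult[of row_params "value_coords d" "m - 1" FY n G] mult.hyps zero
        by (cases "m = 0") (auto simp: Nat.add_diff_assoc2)
      moreover have "degree_le row_params (value_coords d) (m + n - 1) (F * GY)"
        using G degree_le.mult[of row_params "value_coords d" m F "n - 1" GY] mult.hyps zero
        by (cases "n = 0") auto
      ultimately show "degree_le row_params (value_coords d) (m + n - 1) (FY * G + F * GY)"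
        by (rule degree_le.add)
      show "FY * G + F * GY = 0" if "m + n = 0" using that F G by simp
      fix j A Y a b
      have "((\<lambda>h. F (A(i := A i + (h * a) *s axis j 1), Y(i := Y i + h * b))) has_field_derivative
          a * FA j (A, Y) + b * FY (A, Y)) (at 0)" and
        "((\<lambda>h. G (A(i := A i + (h * a) *s axis j 1), Y(i := Y i + h * b))) has_field_derivative
          a * GA j (A, Y) + b * GY (A, Y)) (at 0)"
        using F G by blast+
      from DERIV_mult[OF this]
      show "((\<lambda>h. (F * G) (A(i := A i + (h * a) *s axis j 1), Y(i := Y i + h * b))) has_field_derivative
          a * (FA j (A, Y) * G (A, Y) + GA j (A, Y) * F (A, Y)) + b * (FY * G + F * GY) (A, Y)) (at 0)"
        by (simp add: algebra_simps)
    qed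
  next
    case (mono m F n)
    then obtain FY FA where F: "?D m F FY FA" by blast
    have "degree_le row_params (value_coords d) (n - 1) FY"
      using F mono.hyps by (auto intro: degree_le.mono)
    moreover have "n = 0 \<longrightarrow> FY = 0" using F mono.hyps by auto
    ultimately show ?case using F by blast
  qed
qed

lemma relation_independent_of_value:
  fixes F :: "(nat \<Rightarrow> 'k::real_normed_field ^ 'n) \<times> (nat \<Rightarrow> 'k) \<Rightarrow> 'k"
  assumes "\<And>A Y. ((\<lambda>h. F (A, Y(i := Y i + h))) has_field_derivative 0) (at 0)"
  shows "F (A, Y(i := s)) = F (A, Y)"
proof -
  have "((\<lambda>h. F (A, Y(i := h))) has_field_derivative 0) (at x)" for x
  proof -
    have "((\<lambda>h. F (A, Y(i := x + h))) has_field_derivative 0) (at 0)"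
      using assms[of A "Y(i := x)"] by simp
    then show ?thesis using DERIV_shift[of "\<lambda>h. F (A, Y(i := h))" 0 0 x] by (simp add: add.commute)
  qed
  then have "(\<lambda>h. F (A, Y(i := h))) s = (\<lambda>h. F (A, Y(i := h))) (Y i)"
    using has_field_derivative_zero_constant[of UNIV "\<lambda>h. F (A, Y(i := h))"] by (metis UNIV_I convex_UNIV)
  then show ?thesis by simp
qed

lemma relation_comp_poly:
  fixes F :: "(nat \<Rightarrow> 'k::field ^ 'n) \<times> (nat \<Rightarrow> 'k) \<Rightarrow> 'k"
  assumes F: "F \<in> adjoin row_params (value_coords d)"
    and r: "\<And>i j. (\<lambda>v. r v i $ j) \<in> poly_functions C" and y: "\<And>i. i \<le> d \<Longrightarrow> (\<lambda>v. y v i) \<in> poly_functions C"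
  shows "(\<lambda>v. F (r v, y v)) \<in> poly_functions C"
proof (rule hom_adjoin[OF hom_on_precompose subring_poly_functions _ _ F])
  fix k :: "(nat \<Rightarrow> 'k ^ 'n) \<times> (nat \<Rightarrow> 'k) \<Rightarrow> 'k"
  assume "k \<in> row_params"
  then obtain f where f: "f \<in> poly_functions row_coords" "k = (\<lambda>v. f (fst v))" by (auto simp: row_params_def)
  have "(\<lambda>v. f (r v)) \<in> poly_functions C"
    by (rule poly_functions_comp[OF f(1)]) (auto simp: row_coords_def r)
  then show "(\<lambda>v. k (r v, y v)) \<in> poly_functions C" using f by simp
next
  fix g :: "(nat \<Rightarrow> 'k ^ 'n) \<times> (nat \<Rightarrow> 'k) \<Rightarrow> 'k"
  assume "g \<in> value_coords d"
  then obtain i where "g = (\<lambda>v. snd v i)" "i \<le> d" by (auto simp: value_coords_def)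
  then show "(\<lambda>v. g (r v, y v)) \<in> poly_functions C" using y by simp
qed

lemma measurements_poly:
  assumes "\<And>i j. (\<lambda>v. r v i $ j) \<in> poly_functions C" "\<And>j. (\<lambda>v. p v $ j) \<in> poly_functions C"
  shows "(\<lambda>v. measurements d (r v) (p v) i) \<in> poly_functions C"
  by (cases "i \<le> d")
    (auto simp: measurements_def dotp_def intro!: poly_functions_sum poly_functions.mult poly_functions.const assms)

text \<open>
  If all derivatives by the values vanished identically on the incidence pairs, minimality would make them zero,
  so \<open>F\<close> would depend on the matrix alone and vanish. Hence some derivative \<open>FY\<close> is nonzero at some \<open>(A0, x0)\<close>;
  it defines both the open set of matrices and, for each of them, the open set of points.
\<close>
lemma generic_matrix_identifies:
  fixes X :: "('k::real_normed_field ^ 'n) set"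
  assumes irr: "zariski_irreducible (zariski_closure X)" and X: "X \<noteq> {}"
    and s: "CARD('s::finite) \<ge> model_dim X + 1"
  shows "for_generic_matrix (\<lambda>A :: 'k ^ 'n ^ 's. generically_identifiable (\<lambda>x. A *v x) X)"
proof -
  define d where "d = model_dim X"
  obtain N F where min: "is_minimal_relation X N F"
    using minimal_relation_exists[OF irr X] .
  then have F: "degree_le row_params (value_coords d) N F" "F \<noteq> 0"
      "\<And>A x. x \<in> X \<Longrightarrow> F (A, measurements d A x) = 0"
      "\<And>M G. M < N \<Longrightarrow> degree_le row_params (value_coords d) M G \<Longrightarrow>
        (\<And>A x. x \<in> X \<Longrightarrow> G (A, measurements d A x) = 0) \<Longrightarrow> G = 0"
    unfolding is_minimal_relation_def d_def by blast+
  have Fadj: "F \<in> adjoin row_params (value_coords d)" using F(1) by (auto simp: adjoin_def)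
  have "\<exists>i\<le>d. \<exists>FY. \<exists>FA::'n \<Rightarrow> _. degree_le row_params (value_coords d) (N - 1) FY \<and> FY \<noteq> 0 \<and> (N = 0 \<longrightarrow> FY = 0) \<and>
      (\<forall>j A Y a b. ((\<lambda>h. F (A(i := A i + (h * a) *s axis j 1), Y(i := Y i + h * b)))
        has_field_derivative a * FA j (A, Y) + b * FY (A, Y)) (at 0))"
  proof (rule ccontr)
    assume none: "\<not> ?thesis"
    have indep: "F (A, Y(i := c)) = F (A, Y)" if "i \<le> d" for i A Y c
    proof (rule relation_independent_of_value)
      fix A Y
      obtain FY FA where D: "degree_le row_params (value_coords d) (N - 1) FY" "N = 0 \<longrightarrow> FY = 0"
        "\<forall>j A Y a b. ((\<lambda>h. F (A(i := A i + (h * a) *s axis j 1), Y(i := Y i + h * b)))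
          has_field_derivative a * FA j (A, Y) + b * FY (A, Y)) (at 0)"
        using relation_deriv[OF F(1)] by blast
      then have "FY = 0" using none that by blast
      then show "((\<lambda>h. F (A, Y(i := Y i + h))) has_field_derivative 0) (at 0)"
        using D(3)[rule_format, of A 0 undefined Y 1] by simp
    qed
    obtain x0 where x0: "x0 \<in> X" using X by auto
    have "F (A, Y) = 0" for A Y
    proof -
      have "F (A, \<lambda>i. if i < k then measurements d A x0 i else Y i) = F (A, Y)" if "k \<le> Suc d" for k
        using that
      proof (induction k)
        case (Suc k)
        have "(\<lambda>i. if i < Suc k then measurements d A x0 i else Y i) =
            (\<lambda>i. if i < k then measurements d A x0 i else Y i)(k := measurements d A x0 k)"
          by (auto simp: fun_eq_iff less_Suc_eq)
        then show ?case using indep[of k] Suc by simp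
      qed simp
      from this[of "Suc d"] have "F (A, Y) = F (A, \<lambda>i. if i < Suc d then measurements d A x0 i else Y i)"
        by simp
      also have "\<dots> = F (A, measurements d A x0)"
        by (rule relation_agree[OF Fadj]) auto
      finally show ?thesis using F(3)[OF x0] by simp
    qed
    then have "F = 0" by (auto simp: fun_eq_iff)
    then show False using F(2) by simp
  qed
  then obtain i FY and FA :: "'n \<Rightarrow> _" where i: "i \<le> d"
    and FY: "degree_le row_params (value_coords d) (N - 1) FY" "FY \<noteq> 0" "N = 0 \<longrightarrow> FY = 0"
    and D: "\<And>j A Y a b. ((\<lambda>h. F (A(i := A i + (h * a) *s axis j 1), Y(i := Y i + h * b)))
        has_field_derivative a * FA j (A, Y) + b * FY (A, Y)) (at 0)"
    by blast
  have FYadj: "FY \<in> adjoin row_params (value_coords d)" using FY by (auto simp: adjoin_def)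
  \<comment> \<open>The relation holds along the line that changes only the entry \<open>(i, j)\<close>: the value \<open>i\<close>
    then moves with speed \<open>x $ j\<close>.\<close>
  have recover: "x $ j * FY (A, measurements d A x) = - FA j (A, measurements d A x)" if x: "x \<in> X" for A x j
  proof -
    let ?Y = "measurements d A x"
    have "(\<lambda>h. F (A(i := A i + (h * 1) *s axis j 1), ?Y(i := ?Y i + h * x $ j))) = (\<lambda>h. 0)"
    proof
      fix h
      have "?Y(i := ?Y i + h * x $ j) = measurements d (A(i := A i + (h * 1) *s axis j 1)) x"
        using i by (auto simp: measurements_def fun_eq_iff dotp_add dotp_scale dotp_axis)
      then show "F (A(i := A i + (h * 1) *s axis j 1), ?Y(i := ?Y i + h * x $ j)) = 0"
        using F(3)[OF x] by simp
    qed
    then have "((\<lambda>h. 0) has_field_derivative 1 * FA j (A, ?Y) + x $ j * FY (A, ?Y)) (at 0)"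
      using D[of A 1 j ?Y "x $ j"] by simp
    then have "FA j (A, ?Y) + x $ j * FY (A, ?Y) = 0"
      using DERIV_unique[OF DERIV_const[of 0]] by fastforce
    then show ?thesis by (simp add: eq_neg_iff_add_eq_0 add.commute)
  qed
  obtain A0 x0 where x0: "x0 \<in> X" "FY (A0, measurements d A0 x0) \<noteq> 0"
    using F(4)[OF _ FY(1)] FY by force
  obtain en :: "nat \<Rightarrow> 's" where en: "bij_betw en {..<CARD('s)} UNIV"
    using ex_bij_betw_nat_finite[of "UNIV :: 's set"] by (auto simp: atLeast0LessThan)
  \<comment> \<open>Rows beyond the ones used are those of \<open>A0\<close>, so that some matrix has exactly the rows \<open>A0\<close>.\<close>
  define rows where "rows A i = (if i \<le> d then A $ en i else A0 i)" for A :: "'k ^ 'n ^ 's" and i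
  define W where "W = {A. FY (rows A, measurements d (rows A) x0) \<noteq> 0}"
  have poly: "(\<lambda>v. FY (r v, measurements d (r v) (p v))) \<in> poly_functions C"
    if "\<And>i j. (\<lambda>v. r v i $ j) \<in> poly_functions C" "\<And>j. (\<lambda>v. p v $ j) \<in> poly_functions C"
    for r :: "'v \<Rightarrow> nat \<Rightarrow> 'k ^ 'n" and p C
    by (intro relation_comp_poly[OF FYadj] measurements_poly that)
  have rows_poly: "(\<lambda>A. rows A i $ j) \<in> poly_functions mat_coords" for i j
    by (cases "i \<le> d") (auto simp: rows_def mat_coords_def intro: poly_functions.intros)
  have W_open: "zariski_open mat_coords W"
    unfolding zariski_open_def zariski_closed_def W_def
    by (intro exI[of _ "{\<lambda>A. FY (rows A, measurements d (rows A) x0)}"])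
      (auto intro: poly rows_poly poly_functions.const)
  have "(\<chi> r. A0 (inv_into {..<CARD('s)} en r)) \<in> W"
  proof -
    have "rows (\<chi> r. A0 (inv_into {..<CARD('s)} en r)) = A0"
      using s en by (auto simp: rows_def fun_eq_iff bij_betw_def inv_into_f_f d_def)
    then show ?thesis using x0 by (simp add: W_def)
  qed
  moreover have "generically_identifiable (\<lambda>x. A *v x) X" if A: "A \<in> W" for A
  proof -
    define U where "U = {x. FY (rows A, measurements d (rows A) x) \<noteq> 0}"
    have "zariski_open vec_coords U"
      unfolding zariski_open_def zariski_closed_def U_def
    proof (intro exI[of _ "{\<lambda>x. FY (rows A, measurements d (rows A) x)}"] conjI)
      have "(\<lambda>x::'k ^ 'n. x $ j) \<in> poly_functions vec_coords" for j
        by (intro poly_functions.coord) (auto simp: vec_coords_def)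
      then show "{\<lambda>x. FY (rows A, measurements d (rows A) x)} \<subseteq> poly_functions vec_coords"
        using poly[of "\<lambda>_. rows A" vec_coords "\<lambda>x. x"] poly_functions.const by auto
    qed auto
    moreover have "zariski_closure X \<inter> U \<noteq> {}"
      using A x0 closure_superset[of X] by (auto simp: U_def W_def)
    moreover have "identifiable_at (\<lambda>x. A *v x) X x" if x: "x \<in> X" "x \<in> U" for x
    proof -
      have "y = x" if y: "y \<in> X" "A *v y = A *v x" for y
      proof -
        have "dotp (A $ r) y = dotp (A $ r) x" for r
          using y(2) by (metis matrix_vector_dotp)
        then have "\<And>i. i \<le> d \<Longrightarrow> measurements d (rows A) y i = measurements d (rows A) x i"
          by (simp add: measurements_def rows_def)
        then have same: "measurements d (rows A) y = measurements d (rows A) x"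
          by (auto simp: fun_eq_iff measurements_def)
        have "y $ j * FY (rows A, measurements d (rows A) x) = x $ j * FY (rows A, measurements d (rows A) x)" for j
          using recover[OF y(1), of j "rows A"] recover[OF x(1), of j "rows A"] unfolding same by simp
        then show ?thesis using x(2) by (simp add: U_def vec_eq_iff)
      qed
      then show ?thesis using x by (auto simp: identifiable_at_def)
    qed
    ultimately show ?thesis unfolding generically_identifiable_def by blast
  qed
  ultimately show ?thesis
    unfolding for_generic_matrix_def using W_open by blast
qed

section \<open>The Jacobian criterion\<close>

definition partial_deriv :: "(nat \<Rightarrow> 'k::real_normed_field) \<Rightarrow> nat \<Rightarrow> ((nat \<Rightarrow> 'k) \<Rightarrow> 'k) \<Rightarrow> 'k" where
  "partial_deriv t j f = deriv (\<lambda>h. f (t(j := t j + h))) 0"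

lemma has_partial_deriv:
  assumes "f \<in> poly_functions (seq_coords l)"
  shows "((\<lambda>h. f (t(j := t j + h))) has_field_derivative partial_deriv t j f) (at 0)"
proof -
  have "\<exists>D. ((\<lambda>h. f (t(j := t j + h))) has_field_derivative D) (at 0)"
    using assms
  proof induction
    case (const c)
    show ?case using DERIV_const by blast
  next
    case (coord f)
    then obtain i where "f = (\<lambda>t. t i)" by (auto simp: seq_coords_def)
    then have "(\<lambda>h. f (t(j := t j + h))) = (\<lambda>h. t i + h * (if i = j then 1 else 0))"
      by (auto simp: fun_eq_iff)
    moreover have "((\<lambda>h. t i + h * (if i = j then 1 else 0)) has_field_derivative (if i = j then 1 else 0)) (at 0)"
      by (auto intro!: derivative_eq_intros)
    ultimately show ?case by metis
  next
    case (add f g)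
    then show ?case using DERIV_add by blast
  next
    case (mult f g)
    then show ?case using DERIV_mult by blast
  qed
  then show ?thesis
    unfolding partial_deriv_def using DERIV_imp_deriv by metis
qed

lemma partial_deriv_const: "partial_deriv t j (\<lambda>_. c) = 0"
  by (simp add: partial_deriv_def)

lemma partial_deriv_coord: "partial_deriv t j (\<lambda>t. t i) = (if i = j then 1 else 0)"
proof -
  have "((\<lambda>h. (t(j := t j + h)) i) has_field_derivative (if i = j then 1 else 0)) (at 0)"
    by (auto intro!: derivative_eq_intros)
  then show ?thesis unfolding partial_deriv_def by (rule DERIV_imp_deriv)
qed

lemma partial_deriv_add:
  assumes "f \<in> poly_functions (seq_coords l)" "g \<in> poly_functions (seq_coords l)"
  shows "partial_deriv t j (\<lambda>t. f t + g t) = partial_deriv t j f + partial_deriv t j g"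
  using DERIV_add[OF has_partial_deriv[OF assms(1), of t j] has_partial_deriv[OF assms(2), of t j]]
  unfolding partial_deriv_def[of t j "\<lambda>t. f t + g t"] by (rule DERIV_imp_deriv)

lemma partial_deriv_mult:
  assumes "f \<in> poly_functions (seq_coords l)" "g \<in> poly_functions (seq_coords l)"
  shows "partial_deriv t j (\<lambda>t. f t * g t) = partial_deriv t j f * g t + partial_deriv t j g * f t"
  using DERIV_mult[OF has_partial_deriv[OF assms(1), of t j] has_partial_deriv[OF assms(2), of t j]]
  unfolding partial_deriv_def[of t j "\<lambda>t. f t * g t"] by (simp add: DERIV_imp_deriv)

lemma poly_function_has_derivative:
  fixes \<tau> :: "'x::real_normed_vector \<Rightarrow> nat \<Rightarrow> 'k::real_normed_field"
  assumes "f \<in> poly_functions (seq_coords l)" "\<And>j. ((\<lambda>\<xi>. \<tau> \<xi> j) has_derivative \<tau>' j) (at x)"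
  shows "((\<lambda>\<xi>. f (\<tau> \<xi>)) has_derivative (\<lambda>\<xi>. \<Sum>j<l. \<tau>' j \<xi> * partial_deriv (\<tau> x) j f)) (at x)"
  using assms(1)
proof induction
  case (const c)
  then show ?case by (simp add: partial_deriv_const)
next
  case (coord f)
  then obtain i where i: "f = (\<lambda>t. t i)" "i < l" by (auto simp: seq_coords_def)
  have "(\<Sum>j<l. \<tau>' j \<xi> * partial_deriv (\<tau> x) j f) = \<tau>' i \<xi>" for \<xi>
  proof -
    have "(\<Sum>j<l. \<tau>' j \<xi> * partial_deriv (\<tau> x) j f) = (\<Sum>j<l. if i = j then \<tau>' j \<xi> else 0)"
      unfolding i partial_deriv_coord by (rule sum.cong) auto
    then show ?thesis using i by simp
  qed
  then show ?case using assms(2)[of i] i by simp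
next
  case (add f g)
  have "(\<lambda>\<xi>. \<Sum>j<l. \<tau>' j \<xi> * partial_deriv (\<tau> x) j (\<lambda>t. f t + g t)) =
      (\<lambda>\<xi>. (\<Sum>j<l. \<tau>' j \<xi> * partial_deriv (\<tau> x) j f) + (\<Sum>j<l. \<tau>' j \<xi> * partial_deriv (\<tau> x) j g))"
    by (simp add: partial_deriv_add[OF add.hyps] distrib_left sum.distrib)
  then show ?case using has_derivative_add[OF add.IH] by simp
next
  case (mult f g)
  have "(\<lambda>\<xi>. \<Sum>j<l. \<tau>' j \<xi> * partial_deriv (\<tau> x) j (\<lambda>t. f t * g t)) =
      (\<lambda>\<xi>. f (\<tau> x) * (\<Sum>j<l. \<tau>' j \<xi> * partial_deriv (\<tau> x) j g) + (\<Sum>j<l. \<tau>' j \<xi> * partial_deriv (\<tau> x) j f) * g (\<tau> x))"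
    by (simp add: partial_deriv_mult[OF mult.hyps] sum_distrib_left sum_distrib_right sum.distrib[symmetric] algebra_simps)
  then show ?case using has_derivative_mult[OF mult.IH] by simp
qed

lemma poly_function_continuous:
  fixes \<tau> :: "'x::topological_space \<Rightarrow> nat \<Rightarrow> 'k::real_normed_field"
  assumes "f \<in> poly_functions (seq_coords l)" "\<And>j. continuous_on S (\<lambda>\<xi>. \<tau> \<xi> j)"
  shows "continuous_on S (\<lambda>\<xi>. f (\<tau> \<xi>))"
  using assms(1) by induction (auto intro!: continuous_intros assms(2) simp: seq_coords_def)

definition dir_deriv :: "nat \<Rightarrow> (nat \<Rightarrow> 'k::real_normed_field) \<Rightarrow> (nat \<Rightarrow> 'k) \<Rightarrow> ((nat \<Rightarrow> 'k) \<Rightarrow> 'k) \<Rightarrow> 'k" where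
  "dir_deriv l t w f = (\<Sum>j<l. w j * partial_deriv t j f)"

lemma dir_deriv_add:
  assumes "f \<in> poly_functions (seq_coords l)" "g \<in> poly_functions (seq_coords l)"
  shows "dir_deriv l t w (f + g) = dir_deriv l t w f + dir_deriv l t w g"
  using partial_deriv_add[OF assms] by (simp add: dir_deriv_def plus_fun_def sum.distrib distrib_left)

lemma dir_deriv_mult:
  assumes "f \<in> poly_functions (seq_coords l)" "g \<in> poly_functions (seq_coords l)"
  shows "dir_deriv l t w (f * g) = dir_deriv l t w f * g t + dir_deriv l t w g * f t"
  using partial_deriv_mult[OF assms]
  by (simp add: dir_deriv_def times_fun_def sum.distrib distrib_left sum_distrib_right mult.assoc)

lemma dir_deriv_const: "f \<in> constants \<Longrightarrow> dir_deriv l t w f = 0"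
  by (auto simp: constants_def dir_deriv_def partial_deriv_const)

lemma dir_deriv_zero: "dir_deriv l t w 0 = 0" "dir_deriv l t w (\<lambda>_. 0) = 0"
  using dir_deriv_const[OF subring_0[OF subring_constants], of l t w] by (simp_all add: zero_fun_def)

lemma dir_deriv_coord: "i < l \<Longrightarrow> dir_deriv l t w (\<lambda>t. t i) = w i"
proof -
  assume "i < l"
  have "dir_deriv l t w (\<lambda>t. t i) = (\<Sum>j<l. if i = j then w j else 0)"
    unfolding dir_deriv_def partial_deriv_coord by (rule sum.cong) auto
  then show ?thesis using \<open>i < l\<close> by simp
qed

lemma dir_deriv_adjoin:
  assumes "\<And>g. g \<in> G \<Longrightarrow> g \<in> poly_functions (seq_coords l) \<and> dir_deriv l t w g = 0"
    and "a \<in> adjoin constants G"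
  shows "dir_deriv l t w a = 0"
proof -
  let ?R = "poly_functions (seq_coords l)"
  let ?T = "{f \<in> ?R. dir_deriv l t w f = 0}"
  have "subring ?T"
    unfolding subring_def
  proof (intro conjI ballI)
    have "(1 :: (nat \<Rightarrow> 'a) \<Rightarrow> 'a) \<in> constants" by (auto simp: constants_def one_fun_def)
    then show "1 \<in> ?T" by (auto simp: dir_deriv_const subring_1[OF subring_poly_functions])
  next
    fix x y assume xy: "x \<in> ?T" "y \<in> ?T"
    have m1: "(- 1 :: (nat \<Rightarrow> 'a) \<Rightarrow> 'a) \<in> constants" by (rule subring_uminus[OF subring_constants subring_1[OF subring_constants]])
    then have m: "(- 1 :: (nat \<Rightarrow> 'a) \<Rightarrow> 'a) \<in> ?R" unfolding poly_functions_eq_adjoin using adjoin_base by blast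
    have y: "dir_deriv l t w ((- 1) * y) = 0" "(- 1) * y \<in> ?R"
      using xy dir_deriv_mult[OF m, of y t w] dir_deriv_const[OF m1, of l t w] subring_mult[OF subring_poly_functions m, of y]
      by simp_all
    have "dir_deriv l t w (x + (- 1) * y) = 0"
      using xy dir_deriv_add[OF _ y(2), of x t w] y(1) by auto
    moreover have "x + (- 1) * y = x - y" by (simp add: algebra_simps)
    ultimately show "x - y \<in> ?T"
      using xy by (metis (mono_tags, lifting) mem_Collect_eq subring_diff[OF subring_poly_functions])
    show "x * y \<in> ?T"
      using xy by (simp add: dir_deriv_mult subring_mult[OF subring_poly_functions])
  qed
  moreover have "constants \<subseteq> ?T"
    using adjoin_base[of constants "seq_coords l"] by (auto simp: dir_deriv_const poly_functions_eq_adjoin)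
  ultimately have "adjoin constants G \<subseteq> ?T" using assms(1) by (intro adjoin_least) auto
  then show ?thesis using assms(2) by auto
qed

text \<open>
  The chain rule when the coefficients are constant in the direction \<open>w\<close>.
\<close>
lemma dir_deriv_poly:
  assumes S: "S \<subseteq> poly_functions (seq_coords l)" "\<And>a. a \<in> S \<Longrightarrow> dir_deriv l t w a = 0"
    and c: "c \<in> poly_functions (seq_coords l)" and "p \<in> polys_over S"
  shows "dir_deriv l t w (poly p c) = poly (formal_deriv p) c t * dir_deriv l t w c"
  using assms(4)
proof (induction p)
  case 0
  show ?case by (simp add: formal_deriv_0 dir_deriv_zero)
next
  case (pCons a p)
  let ?R = "poly_functions (seq_coords l)"
  have a: "a \<in> S" "p \<in> polys_over S" using pCons.prems by (auto simp: polys_over_pCons)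
  have p: "poly p c \<in> ?R"
    using a polys_over_mono[OF S(1)] by (intro poly_in_subring subring_poly_functions c) auto
  have "dir_deriv l t w (poly (pCons a p) c) = dir_deriv l t w a + dir_deriv l t w (c * poly p c)"
    using a S(1) p c by (simp add: dir_deriv_add subring_mult[OF subring_poly_functions] subset_iff)
  also have "\<dots> = dir_deriv l t w c * poly p c t + dir_deriv l t w (poly p c) * c t"
    using S(2) a by (simp add: dir_deriv_mult[OF c p])
  finally have "dir_deriv l t w (poly (pCons a p) c) =
      dir_deriv l t w c * poly p c t + (poly (formal_deriv p) c t * dir_deriv l t w c) * c t"
    using pCons.IH[OF a(2)] by (simp only:)
  moreover have "poly (formal_deriv (pCons a p)) c t = poly p c t + c t * poly (formal_deriv p) c t"
    by (simp add: formal_deriv_pCons)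
  ultimately show ?case by (simp only: algebra_simps)
qed

text \<open>
  Complete \<open>g\<close> by coordinates to a transcendence basis \<open>G\<close> of all polynomials. At a point where the
  derivatives of the minimal equations of all coordinates over \<open>G\<close> do not vanish, differentiating these
  equations shows that a direction annihilating every member of \<open>G\<close> is zero. As \<open>G\<close> has at most \<open>l\<close> members,
  omitting one of them leaves a nonzero common solution, which is a dual direction.
\<close>
lemma jacobian_criterion:
  fixes g :: "nat \<Rightarrow> (nat \<Rightarrow> 'k::real_normed_field) \<Rightarrow> 'k"
  assumes g: "\<And>i. i < d \<Longrightarrow> g i \<in> poly_functions (seq_coords l)" and ind: "independent_seq constants d g"
  shows "\<exists>t w. \<forall>i<d. \<forall>k<d. dir_deriv l t (w i) (g k) = (if i = k then 1 else 0)"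
proof -
  let ?C = "seq_coords l :: ((nat \<Rightarrow> 'k) \<Rightarrow> 'k) set" and ?R = "poly_functions (seq_coords l :: ((nat \<Rightarrow> 'k) \<Rightarrow> 'k) set)"
  interpret subdomain ?R by (rule subdomain_seq)
  note c = subring_constants
  have C: "finite ?C" "card ?C \<le> l"
    unfolding seq_coords_eq using card_image_le[of "{..<l}"] by auto
  have coordR: "(\<lambda>t. t j) \<in> ?R" if "j < l" for j
    using that by (intro poly_functions.coord) (auto simp: seq_coords_def)
  obtain m G where G: "d \<le> m" "\<forall>i<d. G i = g i" "\<forall>i. d \<le> i \<and> i < m \<longrightarrow> G i \<in> ?C"
      "independent_seq constants m G" "\<forall>x\<in>?C. algebraic_over (adjoin constants (G ` {..<m})) x"
    using extend_to_transcendence_basis[OF c C(1) ind] by blast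
  have GR: "G i \<in> ?R" if "i < m" for i
    using G(2,3) g that poly_functions.coord[of "G i" ?C] by (cases "i < d") auto
  let ?S = "adjoin constants (G ` {..<m})"
  have KR: "constants \<subseteq> ?R" unfolding poly_functions_eq_adjoin by (rule adjoin_base)
  have "G ` {..<m} \<subseteq> ?R" using GR by auto
  then have S: "subring ?S" "?S \<subseteq> ?R"
    by (rule_tac subring_adjoin[OF c], rule_tac adjoin_least[OF subring KR])
  have "m \<le> card ?C"
    using independent_seq_bound[OF c KR C(1) _ subring order.refl _ G(4) GR]
      finite_over_refl[OF subring order.refl] by (simp add: poly_functions_eq_adjoin)
  then have ml: "m \<le> l" using C by simp
  have "\<forall>j. \<exists>P. j < l \<longrightarrow> minimal_poly ?S (\<lambda>t. t j) P"
  proof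
    fix j
    have "algebraic_over ?S (\<lambda>t. t j)" if "j < l"
      using G(5) that by (auto simp: seq_coords_eq)
    then show "\<exists>P. j < l \<longrightarrow> minimal_poly ?S (\<lambda>t. t j) P"
      using minimal_poly_exists[of ?S "\<lambda>t. t j"] by blast
  qed
  from choice[OF this] obtain P where P: "\<And>j. j < l \<Longrightarrow> minimal_poly ?S (\<lambda>t. t j) (P j)" by blast
  define \<delta> where "\<delta> j = poly (formal_deriv (P j)) (\<lambda>t. t j)" for j
  have \<delta>: "\<delta> j \<noteq> 0" "\<delta> j \<in> ?R" if "j < l" for j
  proof -
    show "\<delta> j \<noteq> 0" unfolding \<delta>_def by (rule minimal_poly_formal_deriv[OF S P[OF that]])
    have "formal_deriv (P j) \<in> polys_over ?R"
      using P[OF that] polys_over_formal_deriv[OF S(1)] polys_over_mono[OF S(2)] by (auto simp: minimal_poly_def)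
    then show "\<delta> j \<in> ?R" unfolding \<delta>_def by (intro poly_in_subring subring coordR that)
  qed
  have "(\<Prod>j<l. \<delta> j) \<noteq> 0" using \<delta> by (intro prod_neq_0) auto
  then obtain t where "(\<Prod>j<l. \<delta> j) t \<noteq> 0" by (auto simp: fun_eq_iff)
  moreover have "(\<Prod>j\<in>J. \<delta> j) t = (\<Prod>j\<in>J. \<delta> j t)" for J
    by (induction J rule: infinite_finite_induct) auto
  ultimately have t: "\<delta> j t \<noteq> 0" if "j < l" for j using that by auto
  have inj: "w j = 0" if w: "\<And>i. i < m \<Longrightarrow> dir_deriv l t w (G i) = 0" and j: "j < l" for w j
  proof -
    have D0: "dir_deriv l t w a = 0" if "a \<in> ?S" for a
      by (rule dir_deriv_adjoin[OF _ that]) (use GR w in auto)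
    have Pj: "P j \<in> polys_over ?S" "poly (P j) (\<lambda>t. t j) = 0"
      using P[OF j] by (auto simp: minimal_poly_def)
    have "dir_deriv l t w (poly (P j) (\<lambda>t. t j)) = \<delta> j t * dir_deriv l t w (\<lambda>t. t j)"
      unfolding \<delta>_def by (rule dir_deriv_poly[OF S(2) D0 coordR[OF j] Pj(1)])
    then have "\<delta> j t * w j = 0"
      unfolding Pj(2) dir_deriv_zero dir_deriv_coord[OF j] by (rule sym)
    then show ?thesis using t[OF j] by simp
  qed
  interpret k: subdomain "UNIV :: 'k set"
    by standard (auto simp: subring_UNIV simp del: of_nat_Suc)
  have "\<exists>w. \<forall>k<d. dir_deriv l t w (g k) = (if i = k then 1 else 0)" if i: "i < d" for i
  proof -
    have "card ({..<m} - {i}) < card {..<l}"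
      using i G(1) ml by (simp add: card_Diff_singleton)
    then obtain w where w: "\<exists>j\<in>{..<l}. w j \<noteq> 0"
        "\<forall>k\<in>{..<m} - {i}. (\<Sum>j<l. w j * partial_deriv t j (G k)) = 0"
      using k.linear_system_nontrivial_solution[OF subring_UNIV, of "{..<m} - {i}" "{..<l}" "\<lambda>j k. partial_deriv t j (G k)"]
      by auto
    define D where "D = dir_deriv l t w (G i)"
    have "D \<noteq> 0"
    proof
      assume "D = 0"
      then have "\<And>k. k < m \<Longrightarrow> dir_deriv l t w (G k) = 0"
        using w(2) by (metis D_def Diff_iff dir_deriv_def lessThan_iff singletonD)
      then show False using inj w(1) by auto
    qed
    have "dir_deriv l t (\<lambda>j. w j / D) f = dir_deriv l t w f / D" for f
      by (simp add: dir_deriv_def sum_divide_distrib)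
    moreover have "dir_deriv l t w (G k) = (if i = k then D else 0)" if "k < m" for k
      using w(2) that by (auto simp: D_def dir_deriv_def)
    then have "dir_deriv l t w (g k) = (if i = k then D else 0)" if "k < d" for k
      using that G(1) G(2)[rule_format, OF that, symmetric] by auto
    ultimately show ?thesis
      using \<open>D \<noteq> 0\<close> by (intro exI[of _ "\<lambda>j. w j / D"]) auto
  qed
  then have "\<forall>i. \<exists>w. i < d \<longrightarrow> (\<forall>k<d. dir_deriv l t w (g k) = (if i = k then 1 else 0))" by blast
  from choice[OF this] show ?thesis by blast
qed

lemma bounded_linear_axis: "bounded_linear (axis r :: 'k::real_normed_vector \<Rightarrow> 'k ^ 'n)"
proof (rule bounded_linear_intro[where K = 1])
  show "axis r (x + y) = axis r x + axis r y" "axis r (c *\<^sub>R x) = c *\<^sub>R (axis r x :: 'k ^ 'n)" for x y c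
    by (auto simp: axis_def vec_eq_iff)
  have "norm (axis r x :: 'k ^ 'n) \<le> (\<Sum>i\<in>UNIV. norm ((axis r x :: 'k ^ 'n) $ i))" for x
    unfolding norm_vec_def by (rule L2_set_le_sum) auto
  also have "\<dots> x = norm x" for x
    by (simp add: axis_def if_distrib[of norm] cong: if_cong)
  finally show "norm (axis r x :: 'k ^ 'n) \<le> norm x * 1" for x by simp
qed

text \<open>
  Move from \<open>t0\<close> along the \<open>d\<close> dual directions, and fill up with free variables to a map of \<open>'k ^ 'n\<close>
  to itself. Its derivative at the origin is the identity, so it is open there.
\<close>
lemma independent_polys_image_contains_ball:
  fixes g :: "nat \<Rightarrow> (nat \<Rightarrow> 'k::{real_normed_field,euclidean_space}) \<Rightarrow> 'k"
  assumes g: "\<And>i. i < d \<Longrightarrow> g i \<in> poly_functions (seq_coords l)" and ind: "independent_seq constants d g"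
    and d: "d \<le> CARD('n::finite)"
  shows "\<exists>c. \<exists>\<epsilon>>0. \<forall>c'. (\<forall>i<d. norm (c' i - c i) < \<epsilon>) \<longrightarrow> (\<exists>t. \<forall>i<d. g i t = c' i)"
proof -
  obtain t0 w where tw: "\<And>i k. i < d \<Longrightarrow> k < d \<Longrightarrow> dir_deriv l t0 (w i) (g k) = (if i = k then 1 else 0)"
    using jacobian_criterion[OF g ind] by blast
  obtain ix :: "'n \<Rightarrow> nat" where ix: "bij_betw ix UNIV {..<CARD('n)}"
    using ex_bij_betw_finite_nat[of "UNIV :: 'n set"] by (auto simp: atLeast0LessThan)
  have ixinj: "ix r = ix s \<longleftrightarrow> r = s" for r s using ix by (auto simp: bij_betw_def inj_eq)
  define I where "I = {r. ix r < d}"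
  define \<tau> where "\<tau> \<xi> j = t0 j + (\<Sum>r\<in>I. \<xi> $ r * w (ix r) j)" for \<xi> :: "'k ^ 'n" and j
  define \<Psi> where "\<Psi> \<xi> = (\<chi> r. if ix r < d then g (ix r) (\<tau> \<xi>) else \<xi> $ r)" for \<xi> :: "'k ^ 'n"
  have \<tau>0: "\<tau> 0 = t0" by (auto simp: \<tau>_def)
  have nth: "((\<lambda>\<xi>::'k ^ 'n. \<xi> $ r) has_derivative (\<lambda>\<xi>. \<xi> $ r)) F" for r F
    by (rule bounded_linear_imp_has_derivative[OF bounded_linear_vec_nth])
  have d\<tau>: "((\<lambda>\<xi>. \<tau> \<xi> j) has_derivative (\<lambda>\<xi>. \<Sum>r\<in>I. \<xi> $ r * w (ix r) j)) (at 0)" for j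
    unfolding \<tau>_def by (auto intro!: derivative_eq_intros nth)
  have comp: "((\<lambda>\<xi>. \<Psi> \<xi> $ r) has_derivative (\<lambda>\<xi>. \<xi> $ r)) (at 0)" for r
  proof (cases "ix r < d")
    case True
    have "((\<lambda>\<xi>. g (ix r) (\<tau> \<xi>)) has_derivative
        (\<lambda>\<xi>. \<Sum>j<l. (\<Sum>s\<in>I. \<xi> $ s * w (ix s) j) * partial_deriv (\<tau> 0) j (g (ix r)))) (at 0)"
      by (rule poly_function_has_derivative[OF g[OF True] d\<tau>])
    moreover have "(\<Sum>j<l. (\<Sum>s\<in>I. \<xi> $ s * w (ix s) j) * partial_deriv (\<tau> 0) j (g (ix r))) = \<xi> $ r" for \<xi> :: "'k ^ 'n"
    proof -
      have "(\<Sum>j<l. (\<Sum>s\<in>I. \<xi> $ s * w (ix s) j) * partial_deriv (\<tau> 0) j (g (ix r))) =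
          (\<Sum>j<l. \<Sum>s\<in>I. \<xi> $ s * (w (ix s) j * partial_deriv t0 j (g (ix r))))"
        by (simp add: \<tau>0 sum_distrib_right mult.assoc)
      also have "\<dots> = (\<Sum>s\<in>I. \<xi> $ s * dir_deriv l t0 (w (ix s)) (g (ix r)))"
        by (subst sum.swap) (simp add: dir_deriv_def sum_distrib_left)
      also have "\<dots> = (\<Sum>s\<in>I. if s = r then \<xi> $ s else 0)"
        by (rule sum.cong) (auto simp: I_def tw True ixinj)
      also have "\<dots> = \<xi> $ r" using True by (simp add: I_def)
      finally show ?thesis .
    qed
    ultimately show ?thesis using True by (simp add: \<Psi>_def)
  next
    case False
    then show ?thesis using nth by (simp add: \<Psi>_def)
  qed
  have ax: "x = (\<Sum>r\<in>UNIV. axis r (x $ r))" for x :: "'k ^ 'n"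
    by (simp add: vec_eq_iff axis_def)
  have "((\<lambda>\<xi>. \<Sum>r\<in>UNIV. axis r (\<Psi> \<xi> $ r)) has_derivative (\<lambda>\<xi>. \<Sum>r\<in>UNIV. axis r (\<xi> $ r))) (at 0)"
    by (intro has_derivative_sum bounded_linear.has_derivative[OF bounded_linear_axis] comp)
  then have der: "(\<Psi> has_derivative (\<lambda>\<xi>. \<xi>)) (at 0)"
    by (simp add: ax[symmetric])
  have "continuous_on UNIV (\<lambda>\<xi>. \<tau> \<xi> j)" for j
    unfolding \<tau>_def by (intro continuous_intros)
  then have "continuous_on UNIV (\<lambda>\<xi>. if ix r < d then g (ix r) (\<tau> \<xi>) else \<xi> $ r)" for r
    by (cases "ix r < d") (auto intro!: poly_function_continuous[OF g] continuous_intros)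
  then have "continuous_on UNIV \<Psi>"
    unfolding \<Psi>_def by (intro continuous_on_vec_lambda)
  then have "\<Psi> 0 \<in> interior (\<Psi> ` UNIV)"
    by (intro sussmann_open_mapping[OF open_UNIV _ _ der bounded_linear_ident]) auto
  then obtain e where e: "e > 0" "ball (\<Psi> 0) e \<subseteq> range \<Psi>"
    by (auto simp: mem_interior)
  define \<epsilon> where "\<epsilon> = e / CARD('n)"
  have \<epsilon>: "\<epsilon> > 0" using e by (simp add: \<epsilon>_def)
  show ?thesis
  proof (rule exI[of _ "\<lambda>i. g i t0"], rule exI[of _ \<epsilon>], intro conjI \<epsilon> allI impI)
    fix c' assume c': "\<forall>i<d. norm (c' i - g i t0) < \<epsilon>"
    define v where "v = (\<chi> r. if ix r < d then c' (ix r) else 0) - \<Psi> 0"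
    have "norm v \<le> (\<Sum>r\<in>UNIV. norm (v $ r))"
      unfolding norm_vec_def by (rule L2_set_le_sum) auto
    also have "\<dots> < (\<Sum>r\<in>(UNIV :: 'n set). \<epsilon>)"
      by (rule sum_strict_mono) (use c' \<epsilon> in \<open>auto simp: v_def \<Psi>_def \<tau>0\<close>)
    also have "\<dots> = e" by (simp add: \<epsilon>_def)
    finally have "\<Psi> 0 + v \<in> ball (\<Psi> 0) e" by (simp add: dist_norm)
    then have "\<Psi> 0 + v \<in> range \<Psi>" using e(2) by blast
    then obtain \<xi> where \<xi>: "\<Psi> \<xi> = \<Psi> 0 + v" by force
    have "g i (\<tau> \<xi>) = c' i" if "i < d" for i
    proof -
      have "i \<in> range ix" using that d bij_betw_imp_surj_on[OF ix] by auto
      then obtain r where r: "ix r = i" by blast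
      show "g i (\<tau> \<xi>) = c' i" using r \<open>i < d\<close> arg_cong[OF \<xi>, of "\<lambda>x. x $ r"] by (simp add: v_def \<Psi>_def)
    qed
    then show "\<exists>t. \<forall>i<d. g i t = c' i" by blast
  qed
qed

section \<open>Models with linear closure\<close>

lemma affine_coordinates_exist:
  fixes X :: "('k::field ^ 'n) set"
  assumes "linear_closure X"
  shows "\<exists>a e b u. zariski_closure X = {a + (\<Sum>i<e. t i *s b i) | t. True} \<and> e \<le> CARD('n) \<and>
    (\<forall>i<e. \<forall>k<e. dotp (u i) (b k) = (if k = i then 1 else 0))"
proof -
  obtain a where L: "vec.subspace ((\<lambda>x. x - a) ` zariski_closure X)"
    using assms by (auto simp: linear_closure_def)
  define L where "L = (\<lambda>x. x - a) ` zariski_closure X"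
  obtain B where B: "B \<subseteq> L" "vec.independent B" "L \<subseteq> vec.span B" "card B = vec.dim L"
    by (rule vec.basis_exists)
  have finB: "finite B" using B(2) by (rule vec.finiteI_independent)
  define e where "e = card B"
  have "e \<le> CARD('n)"
    using vec.independent_card_le_dim[OF subset_UNIV B(2)] unfolding e_def vec_dim_card .
  obtain b where b: "bij_betw b {..<e} B"
    using ex_bij_betw_nat_finite[OF finB] by (auto simp: e_def atLeast0LessThan)
  have LB: "L = vec.span B"
    using B L vec.span_minimal[of B L] by (auto simp: L_def)
  have span: "vec.span B = {(\<Sum>i<e. t i *s b i) | t. True}"
  proof -
    have reindex: "(\<Sum>v\<in>B. u v *s v) = (\<Sum>i<e. u (b i) *s b i)" for u
      by (rule sum.reindex_bij_betw[OF b, symmetric])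
    have "\<exists>u. (\<Sum>i<e. t i *s b i) = (\<Sum>v\<in>B. u v *s v)" for t
    proof (intro exI)
      show "(\<Sum>i<e. t i *s b i) = (\<Sum>v\<in>B. t (inv_into {..<e} b v) *s v)"
        unfolding reindex using b by (intro sum.cong) (auto simp: bij_betw_def inv_into_f_f)
    qed
    then show ?thesis
      unfolding vec.span_finite[OF finB] using reindex by (auto simp: image_def)
  qed
  have V: "zariski_closure X = {a + (\<Sum>i<e. t i *s b i) | t. True}"
  proof -
    have "zariski_closure X = (\<lambda>x. a + x) ` L" by (force simp: L_def)
    then show ?thesis unfolding LB span by auto
  qed
  define E where "E = vec.extend_basis B"
  have E: "vec.independent E" "\<And>x. x \<in> vec.span E" "B \<subseteq> E"
    using vec.independent_extend_basis[OF B(2)] vec.span_extend_basis[OF B(2)] vec.extend_basis_superset[OF B(2)]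
    by (auto simp: E_def)
  define u where "u i = (\<chi> j. vec.representation E (axis j 1) (b i))" for i
  have u: "dotp (u i) x = vec.representation E x (b i)" for i x
  proof -
    have "vec.representation E x (b i) = vec.representation E (\<Sum>j\<in>UNIV. x $ j *s axis j 1) (b i)"
      by (simp only: basis_expansion)
    also have "\<dots> = (\<Sum>j\<in>UNIV. vec.representation E (x $ j *s axis j 1) (b i))"
      by (subst vec.representation_sum[OF E(1) E(2)]) (rule refl)
    also have "\<dots> = (\<Sum>j\<in>UNIV. x $ j * vec.representation E (axis j 1) (b i))"
      by (subst vec.representation_scale[OF E(1) E(2)]) (rule refl)
    finally show ?thesis by (simp add: dotp_def u_def mult.commute)
  qed
  have "dotp (u i) (b k) = (if k = i then 1 else 0)" if "i < e" "k < e" for i k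
  proof -
    have "b k \<in> E" "b k = b i \<longleftrightarrow> k = i"
      using that b E(3) by (auto simp: bij_betw_def inj_on_eq_iff)
    then show ?thesis unfolding u using vec.representation_basis[OF E(1), of "b k"] by auto
  qed
  then show ?thesis using V \<open>e \<le> CARD('n)\<close> by blast
qed
lemma vec_coord_poly: "(\<lambda>x. x $ j) \<in> poly_functions vec_coords"
  by (intro poly_functions.coord) (auto simp: vec_coords_def)

lemma dotp_poly: "(\<lambda>x. dotp u (x - a)) \<in> poly_functions vec_coords"
proof -
  have "(\<lambda>x. \<Sum>j\<in>UNIV. u $ j * (x $ j + - a $ j)) \<in> poly_functions vec_coords"
    by (intro poly_functions_sum poly_functions.mult poly_functions.add poly_functions.const vec_coord_poly)
  then show ?thesis by (simp add: dotp_def)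
qed

lemma dotp_scale_right: "dotp a (c *s x) = c * dotp a x"
  by (simp add: dotp_def sum_distrib_left mult_ac)

lemma dotp_sum_right: "dotp a (\<Sum>i\<in>I. f i) = (\<Sum>i\<in>I. dotp a (f i))"
  unfolding dotp_def by (simp add: sum_component sum_distrib_left) (rule sum.swap)

lemma dotp_dual_basis:
  fixes e :: nat
  assumes "\<And>k. k < e \<Longrightarrow> dotp u (b k) = (if k = i then 1 else 0)" "i < e"
  shows "dotp u (\<Sum>k<e. t k *s b k) = t i"
proof -
  have "dotp u (\<Sum>k<e. t k *s b k) = (\<Sum>k<e. t k * dotp u (b k))"
    by (simp only: dotp_sum_right dotp_scale_right)
  also have "\<dots> = (\<Sum>k<e. if k = i then t k else 0)"
    by (rule sum.cong) (auto simp: assms(1))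
  finally show ?thesis using assms(2) by simp
qed

text \<open>
  Affine coordinates are independent, because they take arbitrary values, and they generate the coordinate ring.
\<close>
lemma affine_coordinates_dim:
  fixes X :: "('k::field_char_0 ^ 'n) set"
  assumes irr: "zariski_irreducible (zariski_closure X)" and X: "X \<noteq> {}"
    and V: "zariski_closure X = {a + (\<Sum>i<e. t i *s b i) | t. True}"
    and lam: "\<And>i. i < e \<Longrightarrow> lam i \<in> poly_functions vec_coords"
      "\<And>i t. i < e \<Longrightarrow> lam i (a + (\<Sum>k<e. t k *s b k)) = t i"
  shows "alg_independent_on X e lam" and "model_dim X = e"
proof -
  have "alg_independent_on (zariski_closure X) e lam"
    unfolding alg_independent_on_def
  proof (intro ballI impI allI)
    fix p t assume p: "p \<in> poly_functions (seq_coords e)" "\<forall>x\<in>zariski_closure X. p (\<lambda>i. lam i x) = 0"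
    define x where "x = a + (\<Sum>i<e. t i *s b i)"
    have "x \<in> zariski_closure X" using V by (auto simp: x_def intro!: bexI[of _ f])
    then have "p (\<lambda>i. lam i x) = 0" using p(2) by auto
    moreover have "p (\<lambda>i. lam i x) = p t"
      by (rule poly_functions_seq_agree[OF p(1)]) (simp add: x_def lam(2))
    ultimately show "p t = 0" by simp
  qed
  then show ind: "alg_independent_on X e lam"
    by (simp add: alg_independent_on_closure[OF lam(1)])
  obtain x0 where x0: "x0 \<in> X" using X by auto
  define \<rho> where "\<rho> x = (if x \<in> X then x else x0)" for x
  have \<rho>: "range \<rho> = X" using x0 by (auto simp: \<rho>_def image_def)
  let ?R = "poly_functions (pullback \<rho>)"
  interpret subdomain ?R by (rule subdomain_pullback[OF irr \<rho>])
  note c = subring_constants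
  have "e \<le> model_dim X"
    using ind lam(1) unfolding alg_independent_on_iff[OF \<rho>]
    by (rule_tac transcendence_basis_of_coordinates(2)[OF irr \<rho>]) (auto simp: poly_functions_pullback)
  moreover have "model_dim X \<le> e"
  proof -
    obtain g where g: "independent_seq constants (model_dim X) g" "\<forall>i<model_dim X. g i \<in> pullback \<rho>"
      using transcendence_basis_of_coordinates(1)[OF irr \<rho>] by auto
    define B where "B = (\<lambda>i z. lam i (\<rho> z)) ` {..<e}"
    have B: "finite B" "card B \<le> e" using card_image_le[of "{..<e}"] by (auto simp: B_def)
    have BR: "adjoin constants B \<subseteq> ?R"
      unfolding poly_functions_eq_adjoin
    proof (rule adjoin_least[OF subring_adjoin[OF c] adjoin_base])
      show "B \<subseteq> adjoin constants (pullback \<rho>)"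
        using lam(1) by (auto simp: B_def poly_functions_eq_adjoin[symmetric] poly_functions_pullback)
    qed
    have "g i \<in> adjoin constants B" if i: "i < model_dim X" for i
    proof -
      obtain j where j: "g i = (\<lambda>z. \<rho> z $ j)" using g(2) i by (auto simp: pullback_def)
      have "\<rho> z $ j = a $ j + (\<Sum>k<e. lam k (\<rho> z) * b k $ j)" for z
      proof -
        have "\<rho> z \<in> zariski_closure X" using \<rho> closure_superset[of X] by auto
        then obtain t where t: "\<rho> z = a + (\<Sum>k<e. t k *s b k)" using V by auto
        have "\<rho> z $ j = a $ j + (\<Sum>k<e. t k * b k $ j)" by (simp add: t sum_component)
        also have "(\<Sum>k<e. t k * b k $ j) = (\<Sum>k<e. lam k (\<rho> z) * b k $ j)"
          by (rule sum.cong) (simp_all add: t lam(2))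
        finally show ?thesis .
      qed
      then have "g i = (\<lambda>_. a $ j) + (\<Sum>k<e. (\<lambda>z. lam k (\<rho> z)) * (\<lambda>_. b k $ j))"
        unfolding j by (auto simp: fun_eq_iff sum_fun_apply)
      also have "\<dots> \<in> adjoin constants B"
      proof (intro subring_add subring_sum subring_mult subring_adjoin c)
        show "(\<lambda>_. a $ j) \<in> adjoin constants B" "\<And>k. (\<lambda>_. b k $ j) \<in> adjoin constants B"
          using adjoin_base[of constants B] by (auto simp: constants_def)
        show "(\<lambda>z. lam k (\<rho> z)) \<in> adjoin constants B" if "k \<in> {..<e}" for k
          using that adjoin_gen[of B constants] by (auto simp: B_def)
      qed
      finally show ?thesis .
    qed
    moreover have "constants \<subseteq> ?R" unfolding poly_functions_eq_adjoin by (rule adjoin_base)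
    ultimately have "model_dim X \<le> card B"
      using g(1) by (intro independent_seq_bound[OF c _ B(1) order.refl subring_adjoin[OF c] BR
        finite_over_refl[OF subring_adjoin[OF c] BR]]) auto
    then show ?thesis using B(2) by simp
  qed
  ultimately show "model_dim X = e" by simp
qed

text \<open>
  The columns \<open>A *v b k\<close>, completed by standard basis vectors to a square matrix \<open>M A\<close>, have a determinant that is
  polynomial in \<open>A\<close>; it is \<open>1\<close> when \<open>A\<close> maps \<open>b k\<close> to the standard basis.
\<close>
lemma generic_matrix_injective_on_linear:
  fixes X :: "('k::field_char_0 ^ 'n) set"
  assumes X: "X \<noteq> {}" and V: "zariski_closure X = {a + (\<Sum>i<e. t i *s b i) | t. True}"
    and dual: "\<And>i k. i < e \<Longrightarrow> k < e \<Longrightarrow> dotp (w i) (b k) = (if k = i then 1 else 0)"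
    and s: "e \<le> CARD('s::finite)"
  shows "for_generic_matrix (\<lambda>A :: 'k ^ 'n ^ 's. generically_identifiable (\<lambda>x. A *v x) X)"
proof -
  obtain ix :: "'s \<Rightarrow> nat" where ix: "bij_betw ix UNIV {..<CARD('s)}"
    using ex_bij_betw_finite_nat[of "UNIV :: 's set"] by (auto simp: atLeast0LessThan)
  define M :: "'k ^ 'n ^ 's \<Rightarrow> 'k ^ 's ^ 's" where
    "M A = (\<chi> r k. if ix k < e then dotp (A $ r) (b (ix k)) else if r = k then 1 else 0)" for A
  define W where "W = {A. det (M A) \<noteq> 0}"
  have entry: "(\<lambda>A. M A $ r $ k) \<in> poly_functions mat_coords" for r k
  proof (cases "ix k < e")
    case True
    have "(\<lambda>A. A $ r $ j) \<in> poly_functions mat_coords" for j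
      by (intro poly_functions.coord) (auto simp: mat_coords_def)
    then have "(\<lambda>A. \<Sum>j\<in>UNIV. A $ r $ j * b (ix k) $ j) \<in> poly_functions mat_coords"
      by (intro poly_functions_sum poly_functions.mult poly_functions.const)
    then show ?thesis using True by (simp add: M_def dotp_def)
  qed (auto simp: M_def intro: poly_functions.const)
  have "(\<lambda>A. det (M A)) \<in> poly_functions mat_coords"
    unfolding det_def by (intro poly_functions_sum poly_functions.mult poly_functions_prod entry poly_functions.const)
  then have open_W: "zariski_open mat_coords W"
    unfolding zariski_open_def zariski_closed_def W_def by (intro exI[of _ "{\<lambda>A. det (M A)}"]) auto
  have "(\<chi> r. if ix r < e then w (ix r) else 0) \<in> W"
  proof -
    have "ix r = ix k \<longleftrightarrow> r = k" for r k using ix by (auto simp: bij_betw_def inj_eq)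
    then have "M (\<chi> r. if ix r < e then w (ix r) else 0) = mat 1"
      by (auto simp: M_def mat_def vec_eq_iff dual) (auto simp: dotp_def)
    then show ?thesis by (simp add: W_def)
  qed
  moreover have "generically_identifiable (\<lambda>x. A *v x) X" if A: "A \<in> W" for A
  proof -
    obtain N where N: "N ** M A = mat 1"
      using A invertible_det_nz[of "M A"] by (auto simp: W_def invertible_def)
    have "y = x" if x: "x \<in> X" and y: "y \<in> X" "A *v y = A *v x" for x y
    proof -
      have "x \<in> zariski_closure X" "y \<in> zariski_closure X" using x y closure_superset[of X] by auto
      then obtain t u where t: "x = a + (\<Sum>i<e. t i *s b i)" and u: "y = a + (\<Sum>i<e. u i *s b i)"
        using V by auto
      define v where "v = (\<chi> k. if ix k < e then u (ix k) - t (ix k) else 0)"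
      have bij: "bij_betw ix {k. ix k < e} {..<e}"
      proof (rule bij_betw_subset[OF ix subset_UNIV])
        show "ix ` {k. ix k < e} = {..<e}"
        proof
          show "{..<e} \<subseteq> ix ` {k. ix k < e}"
          proof
            fix i assume i: "i \<in> {..<e}"
            then have "i \<in> range ix" using s bij_betw_imp_surj_on[OF ix] by auto
            then show "i \<in> ix ` {k. ix k < e}" using i by auto
          qed
        qed auto
      qed
      have "M A *v v = A *v (y - x)"
      proof (subst vec_eq_iff, rule allI)
        fix r
        have "(M A *v v) $ r = (\<Sum>k\<in>UNIV. if ix k < e then dotp (A $ r) (b (ix k)) * (u (ix k) - t (ix k)) else 0)"
          unfolding matrix_vector_mult_def M_def v_def by (auto intro: sum.cong)
        also have "\<dots> = (\<Sum>k\<in>{k. ix k < e}. dotp (A $ r) (b (ix k)) * (u (ix k) - t (ix k)))"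
          by (simp add: sum.If_cases)
        also have "\<dots> = (\<Sum>i<e. dotp (A $ r) (b i) * (u i - t i))"
          by (rule sum.reindex_bij_betw[OF bij])
        also have "\<dots> = (\<Sum>i<e. dotp (A $ r) ((u i - t i) *s b i))"
          by (simp only: dotp_scale_right mult.commute)
        also have "\<dots> = dotp (A $ r) (\<Sum>i<e. (u i - t i) *s b i)"
          by (rule dotp_sum_right[symmetric])
        also have "(\<Sum>i<e. (u i - t i) *s b i) = y - x"
          by (simp add: t u sum_subtractf vector_sub_rdistrib)
        finally show "(M A *v v) $ r = (A *v (y - x)) $ r"
          by (simp add: matrix_vector_dotp)
      qed
      also have "\<dots> = 0" using y(2) by (simp add: matrix_vector_mult_diff_distrib)
      finally have "N *v (M A *v v) = 0" by simp
      then have "v = 0" by (simp add: matrix_vector_mul_assoc N)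
      have "u i = t i" if "i < e" for i
      proof -
        have "i \<in> ix ` {k. ix k < e}" using bij that by (auto simp: bij_betw_def)
        then obtain k where "ix k = i" by auto
        moreover have "v $ k = 0" using \<open>v = 0\<close> by simp
        ultimately show ?thesis using that by (simp add: v_def)
      qed
      then show ?thesis by (simp add: t u)
    qed
    moreover have "zariski_open vec_coords UNIV"
      unfolding zariski_open_def zariski_closed_def
      by (intro exI[of _ "{\<lambda>_. 1}"]) (auto intro: poly_functions.const)
    ultimately show ?thesis
      unfolding generically_identifiable_def identifiable_at_def
      using X closure_superset[of X] by (intro exI[of _ UNIV]) auto
  qed
  ultimately show ?thesis
    unfolding for_generic_matrix_def using open_W by blast
qed

lemma small_non_root:
  fixes p :: "'k::real_normed_field poly"
  assumes "p \<noteq> 0" "\<delta> > 0"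
  shows "\<exists>s. norm s < \<delta> \<and> poly p s \<noteq> 0"
proof (rule ccontr)
  assume "\<not> ?thesis"
  then have roots: "poly p s = 0" if "norm s < \<delta>" for s using that by blast
  define r where "r n = (of_real (\<delta> / real (n + 2)) :: 'k)" for n :: nat
  have "norm (r n) < \<delta>" for n
    unfolding r_def norm_of_real using assms(2) by (auto simp: field_simps intro: add_pos_nonneg)
  then have "range r \<subseteq> {s. poly p s = 0}" using roots by auto
  then have "finite (range r)" using poly_roots_finite[OF assms(1)] finite_subset by blast
  moreover have "inj r"
    using assms(2) by (auto simp: inj_def r_def field_simps)
  ultimately show False using range_inj_infinite by blast
qed

lemma closed_implicit_model: "implicit_model X \<Longrightarrow> zariski_closure X = X"
  using closure_superset[of X]
  by (auto simp: implicit_model_def zariski_closure_def zariski_closed_def)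

lemma model_contains_ball_of_linear_closure:
  fixes X :: "('k::{real_normed_field,euclidean_space} ^ 'n) set"
  assumes model: "model X" and X: "X \<noteq> {}" and e: "e \<le> CARD('n)"
    and V: "zariski_closure X = {a + (\<Sum>i<e. t i *s b i) | t. True}"
    and dual: "\<And>i k. i < e \<Longrightarrow> k < e \<Longrightarrow> dotp (w i) (b k) = (if k = i then 1 else 0)"
  shows "\<exists>c. \<exists>\<epsilon>>0. \<forall>c'. (\<forall>i<e. norm (c' i - c i) < \<epsilon>) \<longrightarrow> a + (\<Sum>i<e. c' i *s b i) \<in> X"
proof -
  have irr: "zariski_irreducible (zariski_closure X)" using model by (simp add: model_def)
  have val: "dotp (w i) ((a + (\<Sum>k<e. t k *s b k)) - a) = t i" if "i < e" for i t
    using dotp_dual_basis[of e "w i" b i t] dual that by simp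
  consider "implicit_model X" | "explicit_model X" using model by (auto simp: model_def)
  then show ?thesis
  proof cases
    case 1
    then have "a + (\<Sum>i<e. c' i *s b i) \<in> X" for c' using closed_implicit_model V by blast
    then show ?thesis by (intro exI[of _ "\<lambda>_. 0"] exI[of _ 1]) auto
  next
    case 2
    then obtain l and \<phi> :: "(nat \<Rightarrow> 'k) \<Rightarrow> 'k ^ 'n" where
      \<phi>: "\<And>i. (\<lambda>t. \<phi> t $ i) \<in> poly_functions (seq_coords l)" "X = range \<phi>"
      by (auto simp: explicit_model_def)
    define g where "g i t = dotp (w i) (\<phi> t - a)" for i t
    have gp: "g i \<in> poly_functions (seq_coords l)" for i
      unfolding g_def using poly_functions_comp[OF dotp_poly[of "w i" a], of \<phi> "seq_coords l"] \<phi>(1)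
      by (auto simp: vec_coords_def)
    have "alg_independent_on X e (\<lambda>i x. dotp (w i) (x - a))"
      by (rule affine_coordinates_dim(1)[OF irr X V dotp_poly val])
    then have "independent_seq constants e (\<lambda>i t. dotp (w i) (\<phi> t - a))"
      by (rule iffD1[OF alg_independent_on_iff[OF \<phi>(2)[symmetric]]])
    moreover have "g = (\<lambda>i t. dotp (w i) (\<phi> t - a))" by (intro ext) (simp add: g_def)
    ultimately have ind: "independent_seq constants e g" by simp
    obtain c \<epsilon> where c: "\<epsilon> > 0" "\<And>c'. (\<forall>i<e. norm (c' i - c i) < \<epsilon>) \<Longrightarrow> \<exists>t. \<forall>i<e. g i t = c' i"
      using independent_polys_image_contains_ball[of e g l, OF gp ind e] by blast
    have "a + (\<Sum>i<e. c' i *s b i) \<in> X" if c': "\<forall>i<e. norm (c' i - c i) < \<epsilon>" for c'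
    proof -
      obtain t where t: "\<forall>i<e. g i t = c' i" using c(2)[OF c'] by auto
      have "\<phi> t \<in> zariski_closure X" using \<phi>(2) closure_superset[of X] by auto
      then obtain u where u: "\<phi> t = a + (\<Sum>i<e. u i *s b i)" using V by auto
      have "u i = c' i" if "i < e" for i
        using t val[OF that, of u] that by (simp add: g_def u)
      then have "(\<Sum>i<e. u i *s b i) = (\<Sum>i<e. c' i *s b i)" by (intro sum.cong) auto
      then show ?thesis using u \<phi>(2) by (metis rangeI)
    qed
    then show ?thesis using c(1) by blast
  qed
qed

text \<open>
  A kernel vector in the direction of the closure, scaled down to stay inside a ball contained in the model, leads from any
  point of the ball to another one with the same measurements. The ball meets every
  Zariski open set that meets the closure: a polynomial vanishing on the ball vanishes on all lines through its centre.
\<close>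
lemma linear_model_not_identifiable:
  fixes X :: "('k::{real_normed_field,euclidean_space} ^ 'n) set" and A :: "'k ^ 'n ^ 's::finite"
  assumes model: "model X" and X: "X \<noteq> {}" and e: "e \<le> CARD('n)"
    and V: "zariski_closure X = {a + (\<Sum>i<e. t i *s b i) | t. True}"
    and dual: "\<And>i k. i < e \<Longrightarrow> k < e \<Longrightarrow> dotp (w i) (b k) = (if k = i then 1 else 0)"
    and s: "CARD('s) < e"
  shows "\<not> generically_identifiable (\<lambda>x. A *v x) X"
proof
  assume "generically_identifiable (\<lambda>x. A *v x) X"
  then obtain U where U: "zariski_open vec_coords U" "zariski_closure X \<inter> U \<noteq> {}"
      "\<And>x. x \<in> X \<Longrightarrow> x \<in> U \<Longrightarrow> identifiable_at (\<lambda>x. A *v x) X x"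
    by (auto simp: generically_identifiable_def)
  define pt where "pt c = a + (\<Sum>i<e. c i *s b i)" for c
  obtain c \<epsilon> where c: "\<epsilon> > 0" "\<And>c'. (\<forall>i<e. norm (c' i - c i) < \<epsilon>) \<Longrightarrow> pt c' \<in> X"
    using model_contains_ball_of_linear_closure[OF model X e V dual] unfolding pt_def by blast
  interpret k: subdomain "UNIV :: 'k set"
    by standard (auto simp: subring_UNIV simp del: of_nat_Suc)
  obtain \<kappa> where \<kappa>: "\<exists>i\<in>{..<e}. \<kappa> i \<noteq> 0" "\<forall>r\<in>UNIV. (\<Sum>i<e. \<kappa> i * (A *v b i) $ r) = 0"
    using k.linear_system_nontrivial_solution[OF subring_UNIV, of "UNIV :: 's set" "{..<e}" "\<lambda>i r. (A *v b i) $ r"] s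
    by auto
  have A\<kappa>: "A *v (\<Sum>i<e. \<kappa> i *s b i) = 0"
  proof (subst vec_eq_iff, rule allI)
    fix r
    have "(A *v (\<Sum>i<e. \<kappa> i *s b i)) $ r = (\<Sum>i<e. \<kappa> i * (A *v b i) $ r)"
      by (simp only: matrix_vector_dotp dotp_sum_right dotp_scale_right)
    then show "(A *v (\<Sum>i<e. \<kappa> i *s b i)) $ r = 0 $ r" using \<kappa>(2) by simp
  qed
  have \<kappa>nz: "(\<Sum>i<e. \<kappa> i *s b i) \<noteq> 0"
  proof
    assume 0: "(\<Sum>i<e. \<kappa> i *s b i) = 0"
    obtain i where i: "i < e" "\<kappa> i \<noteq> 0" using \<kappa>(1) by auto
    have "dotp (w i) (\<Sum>i<e. \<kappa> i *s b i) = \<kappa> i"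
      by (rule dotp_dual_basis) (use dual i in auto)
    then show False using i 0 by (simp add: dotp_def)
  qed
  obtain F where F: "F \<subseteq> poly_functions vec_coords" "- U = {v. \<forall>f\<in>F. f v = 0}"
    using U(1) by (auto simp: zariski_open_def zariski_closed_def)
  obtain cs where cs: "pt cs \<in> U" using U(2) V by (auto simp: pt_def)
  then have "pt cs \<notin> {v. \<forall>f\<in>F. f v = 0}" using F(2) by blast
  then obtain f where f: "f \<in> F" "f (pt cs) \<noteq> 0" by auto
  define seg where "seg s i = c i + s * (cs i - c i)" for s i
  have "\<exists>p. \<forall>s. f (pt (seg s)) = poly p s"
  proof (rule poly_functions_on_curve[where f = f and \<gamma> = "\<lambda>s. pt (seg s)" and C = vec_coords])
    show "f \<in> poly_functions vec_coords" using f F by auto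
    fix x :: "'k ^ 'n \<Rightarrow> 'k" assume "x \<in> vec_coords"
    then obtain j where x: "x = (\<lambda>v. v $ j)" by (auto simp: vec_coords_def)
    have "x (pt (seg s)) = poly [:a $ j + (\<Sum>i<e. c i * b i $ j), \<Sum>i<e. (cs i - c i) * b i $ j:] s" for s
      by (simp add: x pt_def seg_def sum_component distrib_right sum.distrib sum_distrib_left mult.assoc)
    then show "\<exists>p. \<forall>s. x (pt (seg s)) = poly p s" by blast
  qed
  then obtain p where p: "\<And>s. f (pt (seg s)) = poly p s" by blast
  have "seg 1 = cs" by (auto simp: seg_def)
  then have "p \<noteq> 0" using p[of 1] f by auto
  \<comment> \<open>A common bound for both displacements, so that one \<open>\<delta>\<close> serves for \<open>s\<close> and for \<open>h\<close>.\<close>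
  define N where "N = (\<Sum>i<e. norm (cs i - c i)) + (\<Sum>i<e. norm (\<kappa> i)) + 1"
  have N: "norm (cs i - c i) < N" "norm (\<kappa> i) < N" if "i < e" for i
    using member_le_sum[of i "{..<e}" "\<lambda>i. norm (cs i - c i)"] member_le_sum[of i "{..<e}" "\<lambda>i. norm (\<kappa> i)"]
      sum_nonneg[of "{..<e}" "\<lambda>i. norm (cs i - c i)"] sum_nonneg[of "{..<e}" "\<lambda>i. norm (\<kappa> i)"] that
    by (auto simp: N_def)
  have N0: "N > 0" by (auto simp: N_def intro!: add_nonneg_pos add_nonneg_nonneg sum_nonneg)
  define \<delta> where "\<delta> = \<epsilon> / 2 / N"
  have \<delta>: "\<delta> > 0" "\<delta> * N = \<epsilon> / 2" using c(1) N0 by (auto simp: \<delta>_def)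
  obtain s where s: "norm s < \<delta>" "poly p s \<noteq> 0" using small_non_root[OF \<open>p \<noteq> 0\<close> \<delta>(1)] by auto
  define x where "x = pt (seg s)"
  define h where "h = (of_real \<delta> :: 'k)"
  define y where "y = pt (\<lambda>i. seg s i + h * \<kappa> i)"
  have near: "norm (seg s i - c i) < \<epsilon> / 2" if "i < e" for i
  proof -
    have "norm (seg s i - c i) = norm s * norm (cs i - c i)" by (simp add: seg_def norm_mult)
    also have "\<dots> \<le> \<delta> * norm (cs i - c i)" using s(1) by (intro mult_right_mono) auto
    also have "\<dots> < \<delta> * N" using N(1)[OF that] \<delta>(1) by simp
    finally show ?thesis using \<delta> by simp
  qed
  have "x \<in> X" unfolding x_def
    using near c(1) by (intro c(2)) force
  have "y \<in> X" unfolding y_def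
  proof (intro c(2) allI impI)
    fix i assume i: "i < e"
    have "norm (h * \<kappa> i) \<le> \<delta> * norm (\<kappa> i)" using \<delta>(1) by (simp add: h_def norm_mult)
    also have "\<dots> < \<delta> * N" using N(2)[OF i] \<delta>(1) by simp
    finally have "norm (h * \<kappa> i) < \<epsilon> / 2" using \<delta> by simp
    then show "norm (seg s i + h * \<kappa> i - c i) < \<epsilon>"
      using near[OF i] norm_triangle_ineq[of "seg s i - c i" "h * \<kappa> i"] by (simp add: algebra_simps)
  qed
  have "x \<notin> - U" unfolding F(2) using s(2) p[of s] f(1) by (auto simp: x_def intro!: bexI[of _ f])
  then have "identifiable_at (\<lambda>x. A *v x) X x" using U(3) \<open>x \<in> X\<close> by auto
  moreover have yx: "y = x + h *s (\<Sum>i<e. \<kappa> i *s b i)"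
    by (simp add: x_def y_def pt_def vec.scale_left_distrib sum.distrib vec.scale_sum_right vec.scale_scale)
  then have "A *v y = A *v x"
    by (simp add: matrix_vector_right_distrib matrix_vector_mult_scaleR vector_scalar_commute A\<kappa>)
  ultimately have "y = x" using \<open>y \<in> X\<close> unfolding identifiable_at_def by blast
  then have "h *s (\<Sum>i<e. \<kappa> i *s b i) = 0" using yx by simp
  moreover have "h \<noteq> 0" using \<delta>(1) by (simp add: h_def)
  ultimately show False using \<kappa>nz by simp
qed

lemma linear_case:
  fixes X :: "('k::{real_normed_field,euclidean_space} ^ 'n) set"
  assumes model: "model X" and d: "model_dim X > 0" and lin: "linear_closure X"
  shows "for_generic_matrix (\<lambda>A :: 'k ^ 'n ^ 's::finite.
    generically_identifiable (\<lambda>x. A *v x) X \<longleftrightarrow> CARD('s) \<ge> model_dim X)"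
proof -
  have irr: "zariski_irreducible (zariski_closure X)" using model by (simp add: model_def)
  have X: "X \<noteq> {}" by (rule model_dim_pos_imp_nonempty[OF d])
  obtain a e b w where V: "zariski_closure X = {a + (\<Sum>i<e. t i *s b i) | t. True}" and e: "e \<le> CARD('n)"
    and dual: "\<And>i k. i < e \<Longrightarrow> k < e \<Longrightarrow> dotp (w i) (b k) = (if k = i then 1 else 0)"
    using affine_coordinates_exist[OF lin] by blast
  have val: "dotp (w i) ((a + (\<Sum>k<e. t k *s b k)) - a) = t i" if "i < e" for i t
    using dotp_dual_basis[of e "w i" b i t] dual that by simp
  have dim: "model_dim X = e"
    by (rule affine_coordinates_dim(2)[OF irr X V dotp_poly val])
  show ?thesis
  proof (cases "e \<le> CARD('s)")
    case True
    have "for_generic_matrix (\<lambda>A :: 'k ^ 'n ^ 's. generically_identifiable (\<lambda>x. A *v x) X)"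
      by (rule generic_matrix_injective_on_linear[OF X V dual True])
    then show ?thesis using True by (simp add: dim)
  next
    case False
    then have "\<not> generically_identifiable (\<lambda>x. A *v x) X" for A :: "'k ^ 'n ^ 's"
      by (intro linear_model_not_identifiable[OF model X e V dual]) auto
    moreover have "zariski_open (mat_coords :: ('k ^ 'n ^ 's \<Rightarrow> 'k) set) UNIV"
      unfolding zariski_open_def zariski_closed_def
      by (intro exI[of _ "{\<lambda>_. 1}"]) (auto intro: poly_functions.const)
    ultimately show ?thesis
      using False unfolding for_generic_matrix_def dim by (intro exI[of _ UNIV]) auto
  qed
qed

section \<open>Bounded equations for quotients of polynomials\<close>

text \<open>
  The equation says that \<open>p / q\<close> is integral over the polynomials, with coefficients that force linear growth. A root of
  \<open>q\<close> is a root of \<open>p\<close> and can be cancelled from both, without changing the \<open>C i\<close>; once \<open>q\<close> is constant, comparing the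
  coefficients of degree \<open>N * degree p\<close> excludes degrees above one.
\<close>
lemma rational_solution_is_affine:
  fixes p q :: "complex poly"
  assumes "q \<noteq> 0" "\<kappa> \<noteq> 0" "\<And>i. i < N \<Longrightarrow> degree (C i) \<le> N - i"
    and "smult \<kappa> (p ^ N) + (\<Sum>i<N. C i * p ^ i * q ^ (N - i)) = 0"
  shows "\<exists>\<alpha> \<beta>. p = q * [:\<alpha>, \<beta>:]"
  using assms(1,4)
proof (induction "degree q" arbitrary: p q)
  case 0
  then obtain c where c: "q = [:c:]" "c \<noteq> 0" by (metis degree_eq_zeroE pCons_0_0)
  have "degree p \<le> 1"
  proof (rule ccontr)
    assume m: "\<not> degree p \<le> 1"
    define m where "m = degree p"
    have p0: "p \<noteq> 0" using m by auto
    have "degree (C i * p ^ i * q ^ (N - i)) < N * m" if "i < N" for i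
    proof -
      have "degree (C i * p ^ i * q ^ (N - i)) \<le> degree (C i) + i * m + 0"
        unfolding m_def c(1)
        by (intro order.trans[OF degree_mult_le] add_mono degree_power_le order.trans[OF degree_power_le]) (auto simp: mult.commute)
      also have "\<dots> \<le> (N - i) + i * m" using assms(3)[OF that] by simp
      also have "\<dots> < (N - i) * m + i * m"
      proof -
        have "(N - i) * 1 < (N - i) * m"
          using m that by (intro mult_strict_left_mono) (auto simp: m_def)
        then show ?thesis unfolding m_def by linarith
      qed
      also have "\<dots> = N * m" using that by (simp add: add_mult_distrib[symmetric])
      finally show ?thesis .
    qed
    then have "coeff (\<Sum>i<N. C i * p ^ i * q ^ (N - i)) (N * m) = 0"
      by (simp add: coeff_sum coeff_eq_0)
    moreover have "coeff (p ^ N) (N * m) = lead_coeff p ^ N"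
      unfolding m_def by (metis degree_power_eq lead_coeff_power mult.commute p0)
    ultimately have "\<kappa> * lead_coeff p ^ N = 0"
      using arg_cong[OF "0.prems"(2), of "\<lambda>f. coeff f (N * m)"] by simp
    then show False using assms(2) p0 by simp
  qed
  then have "p = [:coeff p 0, coeff p 1:]"
    by (intro poly_eqI) (auto simp: coeff_pCons coeff_eq_0 split: nat.split)
  then have "p = q * [:coeff p 0 / c, coeff p 1 / c:]"
    using c by simp
  then show ?case by blast
next
  case (Suc n)
  have "\<not> constant (poly q)" using Suc(2) by (simp add: constant_degree)
  then obtain b where b: "poly q b = 0" using fundamental_theorem_of_algebra by blast
  have "\<kappa> * poly p b ^ N = 0"
  proof -
    have "poly (\<Sum>i<N. C i * p ^ i * q ^ (N - i)) b = 0"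
      unfolding poly_sum by (rule sum.neutral) (auto simp: b power_0_left)
    then show ?thesis using arg_cong[OF Suc.prems(2), of "\<lambda>f. poly f b"] by simp
  qed
  then have "poly p b = 0" using assms(2) by simp
  with b obtain p' q' where pq: "p = [:-b, 1:] * p'" "q = [:-b, 1:] * q'"
    by (auto simp: poly_eq_0_iff_dvd elim!: dvdE)
  have q': "q' \<noteq> 0" using Suc.prems(1) pq by auto
  have "degree q = Suc (degree q')"
    unfolding pq(2) using q' by (subst degree_mult_eq) auto
  then have deg: "n = degree q'" using Suc(2) by simp
  let ?x = "[:-b, 1:] :: complex poly"
  have "?x ^ N * (smult \<kappa> (p' ^ N) + (\<Sum>i<N. C i * p' ^ i * q' ^ (N - i))) =
      smult \<kappa> (p ^ N) + (\<Sum>i<N. C i * p ^ i * q ^ (N - i))"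
  proof -
    have "?x ^ N * (C i * p' ^ i * q' ^ (N - i)) = C i * p ^ i * q ^ (N - i)" if "i < N" for i
    proof -
      have "?x ^ N = ?x ^ i * ?x ^ (N - i)" using that by (simp add: power_add[symmetric])
      then show ?thesis unfolding pq power_mult_distrib by (simp only: mult_ac)
    qed
    then have "?x ^ N * (\<Sum>i<N. C i * p' ^ i * q' ^ (N - i)) = (\<Sum>i<N. C i * p ^ i * q ^ (N - i))"
      unfolding sum_distrib_left by (intro sum.cong) auto
    moreover have "?x ^ N * smult \<kappa> (p' ^ N) = smult \<kappa> (p ^ N)"
      unfolding pq power_mult_distrib by simp
    ultimately show ?thesis by (simp only: distrib_left)
  qed
  also have "\<dots> = 0" by (rule Suc.prems(2))
  finally have "smult \<kappa> (p' ^ N) + (\<Sum>i<N. C i * p' ^ i * q' ^ (N - i)) = 0"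
    by (simp only: mult_eq_0_iff power_eq_0_iff) auto
  from Suc.hyps(1)[OF deg q' this] obtain \<alpha> \<beta> where "p' = q' * [:\<alpha>, \<beta>:]" by blast
  then have "p = q * [:\<alpha>, \<beta>:]" unfolding pq by (simp only: mult.assoc)
  then show ?case by blast
qed

lemma degree_le_on_line:
  fixes f :: "(nat \<Rightarrow> 'k::field) \<Rightarrow> 'k"
  assumes "degree_le constants (seq_coords d) n f"
  shows "\<exists>p. degree p \<le> n \<and> (\<forall>s. f (\<lambda>j. t j + s * v j) = poly p s)"
  using assms
proof induction
  case (base f)
  then obtain c where "f = (\<lambda>_. c)" by (auto simp: constants_def)
  then show ?case by (intro exI[of _ "[:c:]"]) auto
next
  case (gen f)
  then obtain i where "f = (\<lambda>t. t i)" by (auto simp: seq_coords_def)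
  then show ?case by (intro exI[of _ "[:t i, v i:]"]) auto
next
  case (add n f g)
  then obtain p q where "degree p \<le> n" "\<forall>s. f (\<lambda>j. t j + s * v j) = poly p s"
    "degree q \<le> n" "\<forall>s. g (\<lambda>j. t j + s * v j) = poly q s" by blast
  then show ?case by (intro exI[of _ "p + q"]) (auto intro: degree_add_le)
next
  case (mult m f n g)
  then obtain p q where "degree p \<le> m" "\<forall>s. f (\<lambda>j. t j + s * v j) = poly p s"
    "degree q \<le> n" "\<forall>s. g (\<lambda>j. t j + s * v j) = poly q s" by blast
  then show ?case by (intro exI[of _ "p * q"]) (auto intro: order.trans[OF degree_mult_le] add_mono)
next
  case (mono m f n)
  then show ?case by (meson order.trans)
qed

lemma poly_functions_degree_le: "f \<in> poly_functions C \<Longrightarrow> \<exists>n. degree_le constants C n f"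
  by (simp add: poly_functions_eq_adjoin adjoin_def)

text \<open>
  On every line through a point \<open>t0\<close> with \<open>q t0 \<noteq> 0\<close> the quotient is affine by \<open>rational_solution_is_affine\<close>. Its slope
  is the directional derivative of \<open>p / q\<close> at \<open>t0\<close>, hence linear in the direction, and so the quotient is
  affine altogether.
\<close>
lemma rational_function_is_affine:
  fixes p q :: "(nat \<Rightarrow> complex) \<Rightarrow> complex"
  assumes p: "p \<in> poly_functions (seq_coords d)" and q: "q \<in> poly_functions (seq_coords d)" "q \<noteq> 0"
    and \<kappa>: "\<kappa> \<noteq> 0" and C: "\<And>i. i < N \<Longrightarrow> degree_le constants (seq_coords d) (N - i) (C i)"
    and eq: "\<And>t. \<kappa> * p t ^ N + (\<Sum>i<N. C i t * p t ^ i * q t ^ (N - i)) = 0"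
  shows "\<exists>\<alpha> \<beta>. \<forall>t. p t = q t * (\<alpha> + (\<Sum>j<d. \<beta> j * t j))"
proof -
  obtain t0 where t0: "q t0 \<noteq> 0" using q(2) by (auto simp: fun_eq_iff)
  define \<alpha> where "\<alpha> = p t0 / q t0"
  define \<beta> where "\<beta> j = (partial_deriv t0 j p - \<alpha> * partial_deriv t0 j q) / q t0" for j
  have line: "p (\<lambda>j. t0 j + v j) = q (\<lambda>j. t0 j + v j) * (\<alpha> + (\<Sum>j<d. v j * \<beta> j))" for v
  proof -
    let ?l = "\<lambda>s j. t0 j + s * v j"
    obtain P where P: "\<And>s. p (?l s) = poly P s"
      using poly_functions_degree_le[OF p] degree_le_on_line by blast
    obtain Q where Q: "\<And>s. q (?l s) = poly Q s"
      using poly_functions_degree_le[OF q(1)] degree_le_on_line by blast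
    have "\<forall>i. \<exists>c. i < N \<longrightarrow> degree c \<le> N - i \<and> (\<forall>s. C i (?l s) = poly c s)"
      using degree_le_on_line[OF C] by blast
    from choice[OF this] obtain c where c: "\<And>i. i < N \<Longrightarrow> degree (c i) \<le> N - i"
      "\<And>i s. i < N \<Longrightarrow> C i (?l s) = poly (c i) s" by blast
    have Q0: "poly Q 0 = q t0" "poly P 0 = p t0" using P[of 0] Q[of 0] by simp_all
    then have "Q \<noteq> 0" using t0 by auto
    moreover have "smult \<kappa> (P ^ N) + (\<Sum>i<N. c i * P ^ i * Q ^ (N - i)) = 0"
    proof (rule poly_eq_poly_eq_iff[THEN iffD1], rule ext)
      fix s
      have "(\<Sum>i<N. C i (?l s) * p (?l s) ^ i * q (?l s) ^ (N - i)) = poly (\<Sum>i<N. c i * P ^ i * Q ^ (N - i)) s"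
        unfolding poly_sum using c(2) by (intro sum.cong) (auto simp: P Q)
      then show "poly (smult \<kappa> (P ^ N) + (\<Sum>i<N. c i * P ^ i * Q ^ (N - i))) s = poly 0 s"
        using eq[of "?l s"] by (simp add: P)
    qed
    ultimately obtain a b where ab: "P = Q * [:a, b:]"
      using rational_solution_is_affine[OF _ \<kappa> c(1)] by blast
    have pl: "p (?l s) = q (?l s) * (a + s * b)" for s unfolding P Q ab by (simp add: algebra_simps)
    then have a: "a = \<alpha>" using pl[of 0] t0 by (simp add: \<alpha>_def)
    have dl: "((\<lambda>s. ?l s j) has_derivative (\<lambda>s. s * v j)) (at 0)" for j
      by (auto intro!: derivative_eq_intros)
    have D: "((\<lambda>s. f (?l s)) has_field_derivative (\<Sum>j<d. v j * partial_deriv t0 j f)) (at 0)"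
      if "f \<in> poly_functions (seq_coords d)" for f
    proof -
      have "(\<lambda>s. \<Sum>j<d. s * v j * partial_deriv (?l 0) j f) = (*) (\<Sum>j<d. v j * partial_deriv t0 j f)"
        by (auto simp: fun_eq_iff sum_distrib_left mult_ac)
      then show ?thesis
        using poly_function_has_derivative[OF that, of ?l "\<lambda>j s. s * v j" 0] dl
        unfolding has_field_derivative_def by simp
    qed
    have "((\<lambda>s. q (?l s) * (a + s * b)) has_field_derivative
        (\<Sum>j<d. v j * partial_deriv t0 j q) * (a + 0 * b) + b * q (?l 0)) (at 0)"
      by (rule DERIV_mult[OF D[OF q(1)]]) (auto intro!: derivative_eq_intros)
    then have "((\<lambda>s. p (?l s)) has_field_derivative (\<Sum>j<d. v j * partial_deriv t0 j q) * a + b * q t0) (at 0)"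
      by (simp add: pl)
    then have "(\<Sum>j<d. v j * partial_deriv t0 j p) = (\<Sum>j<d. v j * partial_deriv t0 j q) * a + b * q t0"
      using DERIV_unique[OF D[OF p]] by blast
    then have "b = ((\<Sum>j<d. v j * partial_deriv t0 j p) - \<alpha> * (\<Sum>j<d. v j * partial_deriv t0 j q)) / q t0"
      using t0 by (simp add: a field_simps)
    also have "\<dots> = (\<Sum>j<d. v j * \<beta> j)"
      by (simp add: \<beta>_def sum_divide_distrib sum_subtractf[symmetric] sum_distrib_left right_diff_distrib mult_ac)
    finally show ?thesis using pl[of 1] by (simp add: a)
  qed
  have "p t = q t * ((\<alpha> - (\<Sum>j<d. \<beta> j * t0 j)) + (\<Sum>j<d. \<beta> j * t j))" for t
  proof -
    have "(\<lambda>j. t0 j + (t j - t0 j)) = t" by auto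
    then have "p t = q t * (\<alpha> + (\<Sum>j<d. (t j - t0 j) * \<beta> j))"
      using line[of "\<lambda>j. t j - t0 j"] by simp
    moreover have "\<alpha> + (\<Sum>j<d. (t j - t0 j) * \<beta> j) = (\<alpha> - (\<Sum>j<d. \<beta> j * t0 j)) + (\<Sum>j<d. \<beta> j * t j)"
      by (simp add: algebra_simps sum_subtractf)
    ultimately show ?thesis by (simp only:)
  qed
  then show ?thesis by blast
qed

section \<open>Nonlinear models over the complex numbers\<close>

text \<open>
  The assumption \<open>pts\<close> is what remains of the geometry of the model: every homomorphism of the ring to the complex
  numbers is evaluation at a point. So the two homomorphisms over a generic value of \<open>G\<close>,
  extended to the whole ring, are two points.
\<close>
lemma two_points_over_generic_value:
  fixes C :: "('z \<Rightarrow> complex) set"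
  assumes "subdomain (poly_functions C)" "finite C"
    and pts: "\<And>\<psi>. hom_on (poly_functions C) \<psi> \<Longrightarrow> (\<forall>c. \<psi> (\<lambda>_. c) = c) \<Longrightarrow>
      (\<exists>p. \<forall>f\<in>poly_functions C. \<psi> f = f p)"
    and G: "G \<subseteq> poly_functions C" and z: "z \<in> poly_functions C"
    and P: "minimal_poly (adjoin constants G) z P" "degree P \<ge> 2"
    and u: "u \<in> poly_functions C" "u \<noteq> 0"
  shows "\<exists>p q. (\<forall>g\<in>G. g p = g q) \<and> z p \<noteq> z q \<and> u p \<noteq> 0"
proof -
  let ?R = "poly_functions C"
  interpret subdomain ?R by fact
  note c = subring_constants
  let ?S = "adjoin constants G" and ?T = "adjoin constants (insert z G)"
  have R: "adjoin constants (insert z G \<union> C) = ?R"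
  proof
    show "adjoin constants (insert z G \<union> C) \<subseteq> ?R"
      using G z adjoin_base[of constants C] adjoin_gen[of C constants]
      by (intro adjoin_least subring) (auto simp: poly_functions_eq_adjoin)
    show "?R \<subseteq> adjoin constants (insert z G \<union> C)"
      unfolding poly_functions_eq_adjoin by (intro adjoin_mono c) auto
  qed
  have TR: "?T \<subseteq> ?R" unfolding R[symmetric] by (intro adjoin_mono c) auto
  have ST: "?S \<subseteq> ?T" by (intro adjoin_mono c) auto
  obtain h where h: "h \<in> ?T" "h \<noteq> 0" "\<And>\<psi>::_ \<Rightarrow> complex. hom_on ?T \<psi> \<Longrightarrow> \<psi> h \<noteq> 0 \<Longrightarrow>
      \<exists>\<psi>'. hom_on ?R \<psi>' \<and> (\<forall>x\<in>?T. \<psi>' x = \<psi> x) \<and> \<psi>' u \<noteq> 0"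
    using generic_hom_extension[OF c \<open>finite C\<close>, of "insert z G" u] u unfolding R by blast
  obtain k where k: "k \<in> ?S" "k \<noteq> 0" "\<And>\<psi>::_ \<Rightarrow> complex. hom_on ?S \<psi> \<Longrightarrow> \<psi> k \<noteq> 0 \<Longrightarrow>
      \<exists>\<psi>1 \<psi>2. hom_on ?T \<psi>1 \<and> hom_on ?T \<psi>2 \<and> (\<forall>x\<in>?S. \<psi>1 x = \<psi> x \<and> \<psi>2 x = \<psi> x) \<and>
        \<psi>1 z \<noteq> \<psi>2 z \<and> \<psi>1 h \<noteq> 0 \<and> \<psi>2 h \<noteq> 0"
    using two_homs_over_generic_point[OF c TR P h(1,2)] by blast
  obtain v where "k v \<noteq> 0" using k(2) by (auto simp: fun_eq_iff)
  then obtain \<psi>1 \<psi>2 where \<psi>: "hom_on ?T \<psi>1" "hom_on ?T \<psi>2" "\<And>x. x \<in> ?S \<Longrightarrow> \<psi>1 x = x v" "\<And>x. x \<in> ?S \<Longrightarrow> \<psi>2 x = x v"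
      "\<psi>1 z \<noteq> \<psi>2 z" "\<psi>1 h \<noteq> 0" "\<psi>2 h \<noteq> 0"
    using k(3)[OF hom_on_eval, of v] by blast
  have lift: "\<exists>p. (\<forall>x\<in>?T. x p = \<psi> x) \<and> u p \<noteq> 0"
    if \<psi>: "hom_on ?T \<psi>" "\<And>x. x \<in> ?S \<Longrightarrow> \<psi> x = x v" "\<psi> h \<noteq> 0" for \<psi>
  proof -
    obtain \<psi>' where \<psi>': "hom_on ?R \<psi>'" "\<forall>x\<in>?T. \<psi>' x = \<psi> x" "\<psi>' u \<noteq> 0" using h(3)[OF \<psi>(1,3)] by blast
    have "(\<lambda>_. a) \<in> ?S" for a :: complex
      using adjoin_base[of constants G] by (auto simp: constants_def)
    then have "\<psi>' (\<lambda>_. a) = a" for a using \<psi>'(2) \<psi>(2) ST by (metis subsetD)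
    then obtain p where p: "\<forall>f\<in>?R. \<psi>' f = f p" using pts[OF \<psi>'(1)] by blast
    have "x p = \<psi> x" if "x \<in> ?T" for x using that p \<psi>'(2) TR by (metis subsetD)
    then show ?thesis using p \<psi>'(3) u(1) by auto
  qed
  obtain p q where pq: "\<forall>x\<in>?T. x p = \<psi>1 x" "u p \<noteq> 0" "\<forall>x\<in>?T. x q = \<psi>2 x"
    using lift[OF \<psi>(1,3,6)] lift[OF \<psi>(2,4,7)] by blast
  have "g p = g q" if "g \<in> G" for g
  proof -
    have "g \<in> ?S" "g \<in> ?T" using that adjoin_gen[of G constants] ST by auto
    then show ?thesis using pq \<psi>(3,4) by metis
  qed
  moreover have "z \<in> ?T" using adjoin_gen[of "insert z G" constants] by auto
  then have "z p \<noteq> z q" using pq \<psi>(5) by metis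
  ultimately show ?thesis using pq(2) by blast
qed

lemma degree_le_0_imp_base:
  assumes K: "subring K" and "degree_le K G n a" "n = 0"
  shows "a \<in> K"
  using assms(2,3) by induction (auto intro: subring_add[OF K] subring_mult[OF K])

text \<open>
  The coefficient of \<open>s ^ i\<close> in \<open>F (A, s * Y)\<close> is the homogeneous part of degree \<open>i\<close> in the values. It is again a
  polynomial in \<open>A\<close> and \<open>Y\<close>.
\<close>
lemma relation_homogeneous_parts:
  fixes F :: "(nat \<Rightarrow> 'k::field ^ 'n) \<times> (nat \<Rightarrow> 'k) \<Rightarrow> 'k"
  assumes "degree_le row_params (value_coords d) N F"
  shows "\<exists>P. (\<forall>i\<le>N. degree_le row_params (value_coords d) i (coeff P i)) \<and> (\<forall>i>N. coeff P i = 0) \<and>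
    (\<forall>A Y s. F (A, \<lambda>i. s * Y i) = poly (map_poly (\<lambda>f. f (A, Y)) P) s)"
proof -
  note S = subring_UNIV
  have zero: "degree_le row_params (value_coords d) n 0" for n
    by (intro degree_le_base subring_0 subring_row_params)
  have UN: "p \<in> polys_over UNIV" for p by (simp add: polys_over_def)
  show ?thesis
    using assms
  proof induction
    case (base F)
    then show ?case
      by (intro exI[of _ "[:F:]"]) (auto simp: coeff_pCons map_poly_pCons row_params_def degree_le.base split: nat.split)
  next
    case (gen F)
    then obtain r where r: "F = (\<lambda>v. snd v r)" by (auto simp: value_coords_def)
    have "degree_le row_params (value_coords d) i (coeff [:0, F:] i)" if "i \<le> 1" for i
      using that gen zero degree_le.gen[of F] by (auto simp: coeff_pCons le_Suc_eq split: nat.split)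
    moreover have "F (A, \<lambda>i. s * Y i) = poly (map_poly (\<lambda>f. f (A, Y)) [:0, F:]) s" for A Y s
      by (simp add: r map_poly_pCons)
    ultimately show ?case by (intro exI[of _ "[:0, F:]"]) (auto simp: coeff_pCons split: nat.split)
  next
    case (add n F G)
    then obtain P Q where
      P: "\<forall>i\<le>n. degree_le row_params (value_coords d) i (coeff P i)" "\<forall>i>n. coeff P i = 0"
        "\<forall>A Y s. F (A, \<lambda>i. s * Y i) = poly (map_poly (\<lambda>f. f (A, Y)) P) s" and
      Q: "\<forall>i\<le>n. degree_le row_params (value_coords d) i (coeff Q i)" "\<forall>i>n. coeff Q i = 0"
        "\<forall>A Y s. G (A, \<lambda>i. s * Y i) = poly (map_poly (\<lambda>f. f (A, Y)) Q) s" by blast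
    have "degree_le row_params (value_coords d) i (coeff (P + Q) i)" if "i \<le> n" for i
      unfolding coeff_add using P(1) Q(1) that by (intro degree_le.add) blast+
    moreover have "coeff (P + Q) i = 0" if "i > n" for i
      unfolding coeff_add using P(2) Q(2) that by simp
    ultimately show ?case
      using P(3) Q(3) by (intro exI[of _ "P + Q"]) (simp add: map_hom_add[OF hom_on_eval S UN UN] del: coeff_add)
  next
    case (mult m F n G)
    then obtain P Q where
      P: "\<forall>i\<le>m. degree_le row_params (value_coords d) i (coeff P i)" "\<forall>i>m. coeff P i = 0"
        "\<forall>A Y s. F (A, \<lambda>i. s * Y i) = poly (map_poly (\<lambda>f. f (A, Y)) P) s" and
      Q: "\<forall>i\<le>n. degree_le row_params (value_coords d) i (coeff Q i)" "\<forall>i>n. coeff Q i = 0"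
        "\<forall>A Y s. G (A, \<lambda>i. s * Y i) = poly (map_poly (\<lambda>f. f (A, Y)) Q) s" by blast
    have "degree_le row_params (value_coords d) i (coeff (P * Q) i)" for i
      unfolding coeff_mult
    proof (intro degree_le_sum subring_row_params)
      fix j assume "j \<in> {..i}"
      then have "j + (i - j) = i" by simp
      moreover have "degree_le row_params (value_coords d) j (coeff P j)" using P zero by (cases "j \<le> m") auto
      moreover have "degree_le row_params (value_coords d) (i - j) (coeff Q (i - j))" using Q zero by (cases "i - j \<le> n") auto
      ultimately show "degree_le row_params (value_coords d) i (coeff P j * coeff Q (i - j))"
        using degree_le.mult by metis
    qed
    moreover have "coeff (P * Q) i = 0" if "i > m + n" for i
      unfolding coeff_mult
    proof (intro sum.neutral ballI)
      fix j
      show "coeff P j * coeff Q (i - j) = 0"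
        using P(2) Q(2) that by (cases "j > m") auto
    qed
    ultimately show ?case
      using P(3) Q(3) by (intro exI[of _ "P * Q"]) (auto simp: map_hom_mult[OF hom_on_eval S UN UN])
  next
    case (mono m F n)
    then obtain P where
      P: "\<forall>i\<le>m. degree_le row_params (value_coords d) i (coeff P i)" "\<forall>i>m. coeff P i = 0"
        "\<forall>A Y s. F (A, \<lambda>i. s * Y i) = poly (map_poly (\<lambda>f. f (A, Y)) P) s" by blast
    then have "degree_le row_params (value_coords d) i (coeff P i)" for i
      using zero by (cases "i \<le> m") auto
    then show ?case using P mono.hyps by (intro exI[of _ P]) auto
  qed
qed

text \<open>
  The expansion of \<open>F (A, y + s * v)\<close> in powers of \<open>s\<close>, for a fixed matrix, as polynomials in \<open>y\<close>. The coefficient of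
  \<open>s ^ N\<close> has degree \<open>0\<close>, so it is the value of the leading form at \<open>v\<close>.
\<close>
lemma relation_along_direction:
  fixes F :: "(nat \<Rightarrow> 'k::field ^ 'n) \<times> (nat \<Rightarrow> 'k) \<Rightarrow> 'k"
  assumes "degree_le row_params (value_coords d) N F"
  shows "\<exists>P. (\<forall>i. degree_le constants (seq_coords (Suc d)) (N - i) (coeff P i)) \<and> (\<forall>i>N. coeff P i = 0) \<and>
    (\<forall>y s. F (A, \<lambda>i. y i + s * v i) = poly (map_poly (\<lambda>f. f y) P) s)"
proof -
  note S = subring_UNIV
  let ?D = "degree_le constants (seq_coords (Suc d))"
  have cst: "?D n (\<lambda>_. c)" for n c
    by (intro degree_le_base) (auto simp: constants_def)
  have zero: "?D n 0" for n
    by (intro degree_le_base subring_0 subring_constants)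
  have UN: "p \<in> polys_over UNIV" for p by (simp add: polys_over_def)
  show ?thesis
    using assms
  proof induction
    case (base F)
    then obtain f where "F = (\<lambda>v. f (fst v))" by (auto simp: row_params_def)
    then show ?case
      using cst zero by (intro exI[of _ "[:\<lambda>_. f A:]"]) (auto simp: coeff_pCons map_poly_pCons split: nat.split)
  next
    case (gen F)
    then obtain r where r: "F = (\<lambda>v. snd v r)" "r < Suc d" by (auto simp: value_coords_def)
    have "?D 1 (\<lambda>t. t r)" using r by (intro degree_le.gen) (auto simp: seq_coords_def)
    then have "?D (1 - i) (coeff [:\<lambda>t. t r, \<lambda>_. v r:] i)" for i
      using cst zero by (auto simp: coeff_pCons split: nat.split)
    moreover have "F (A, \<lambda>i. y i + s * v i) = poly (map_poly (\<lambda>f. f y) [:\<lambda>t. t r, \<lambda>_. v r:]) s" for y s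
      by (simp add: r map_poly_pCons)
    ultimately show ?case by (intro exI[of _ "[:\<lambda>t. t r, \<lambda>_. v r:]"]) (auto simp: coeff_pCons split: nat.split)
  next
    case (add n F G)
    then obtain P Q where
      P: "\<forall>i. ?D (n - i) (coeff P i)" "\<forall>i>n. coeff P i = 0"
        "\<forall>y s. F (A, \<lambda>i. y i + s * v i) = poly (map_poly (\<lambda>f. f y) P) s" and
      Q: "\<forall>i. ?D (n - i) (coeff Q i)" "\<forall>i>n. coeff Q i = 0"
        "\<forall>y s. G (A, \<lambda>i. y i + s * v i) = poly (map_poly (\<lambda>f. f y) Q) s" by blast
    have "?D (n - i) (coeff (P + Q) i)" for i
      unfolding coeff_add using P(1) Q(1) by (intro degree_le.add) blast+
    moreover have "coeff (P + Q) i = 0" if "i > n" for i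
      unfolding coeff_add using P(2) Q(2) that by simp
    ultimately show ?case
      using P(3) Q(3) by (intro exI[of _ "P + Q"]) (simp add: map_hom_add[OF hom_on_eval S UN UN] del: coeff_add)
  next
    case (mult m F n G)
    then obtain P Q where
      P: "\<forall>i. ?D (m - i) (coeff P i)" "\<forall>i>m. coeff P i = 0"
        "\<forall>y s. F (A, \<lambda>i. y i + s * v i) = poly (map_poly (\<lambda>f. f y) P) s" and
      Q: "\<forall>i. ?D (n - i) (coeff Q i)" "\<forall>i>n. coeff Q i = 0"
        "\<forall>y s. G (A, \<lambda>i. y i + s * v i) = poly (map_poly (\<lambda>f. f y) Q) s" by blast
    have "?D (m + n - i) (coeff (P * Q) i)" for i
      unfolding coeff_mult
    proof (intro degree_le_sum subring_constants)
      fix j assume j: "j \<in> {..i}"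
      show "?D (m + n - i) (coeff P j * coeff Q (i - j))"
      proof (cases "j \<le> m \<and> i - j \<le> n")
        case True
        then have "m + n - i = (m - j) + (n - (i - j))" using j by auto
        then show ?thesis using P(1) Q(1) degree_le.mult by metis
      next
        case False
        then have "coeff P j * coeff Q (i - j) = 0" using P(2) Q(2) by auto
        then show ?thesis using zero by simp
      qed
    qed
    moreover have "coeff (P * Q) i = 0" if "i > m + n" for i
      unfolding coeff_mult
    proof (intro sum.neutral ballI)
      fix j
      show "coeff P j * coeff Q (i - j) = 0"
        using P(2) Q(2) that by (cases "j > m") auto
    qed
    ultimately show ?case
      using P(3) Q(3) by (intro exI[of _ "P * Q"]) (auto simp: map_hom_mult[OF hom_on_eval S UN UN])
  next
    case (mono m F n)
    then obtain P where
      P: "\<forall>i. ?D (m - i) (coeff P i)" "\<forall>i>m. coeff P i = 0"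
        "\<forall>y s. F (A, \<lambda>i. y i + s * v i) = poly (map_poly (\<lambda>f. f y) P) s" by blast
    have "?D (n - i) (coeff P i)" for i
      using P(1) mono.hyps degree_le.mono[of constants "seq_coords (Suc d)" "m - i" "coeff P i" "n - i"] by auto
    then show ?case using P mono.hyps by (intro exI[of _ P]) auto
  qed
qed

text \<open>
  The homogeneous part \<open>H\<close> of degree \<open>N\<close> is nonzero since \<open>N\<close> is the least possible degree. The degree is positive because a
  relation between the entries of the matrix alone would hold for all matrices.
\<close>
lemma minimal_relation_leading_form:
  fixes X :: "('k::field_char_0 ^ 'n) set"
  assumes min: "is_minimal_relation X N F" and X: "X \<noteq> {}"
  obtains H where "H \<in> adjoin row_params (value_coords (model_dim X))" "H \<noteq> 0" "N > 0"
    "\<And>A v P. (\<And>s. F (A, \<lambda>i. s * v i) = poly P s) \<Longrightarrow> coeff P N = H (A, v)"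
    "\<And>A v. (\<And>i. i \<le> model_dim X \<Longrightarrow> v i = 0) \<Longrightarrow> H (A, v) = 0"
proof -
  define d where "d = model_dim X"
  have F: "degree_le row_params (value_coords d) N F" "F \<noteq> 0"
      "\<And>A x. x \<in> X \<Longrightarrow> F (A, measurements d A x) = 0"
      "\<And>M G. M < N \<Longrightarrow> degree_le row_params (value_coords d) M G \<Longrightarrow>
        (\<And>A x. x \<in> X \<Longrightarrow> G (A, measurements d A x) = 0) \<Longrightarrow> G = 0"
    using min unfolding is_minimal_relation_def d_def by blast+
  obtain P where P: "\<forall>i\<le>N. degree_le row_params (value_coords d) i (coeff P i)" "\<forall>i>N. coeff P i = 0"
      "\<And>A Y s. F (A, \<lambda>i. s * Y i) = poly (map_poly (\<lambda>f. f (A, Y)) P) s"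
    using relation_homogeneous_parts[OF F(1)] by blast
  have unique: "coeff Q i = coeff P i (A, v)" if "\<And>s. F (A, \<lambda>i. s * v i) = poly Q s" for Q A v i
  proof -
    have "poly Q = poly (map_poly (\<lambda>f. f (A, v)) P)" using that P(3) by auto
    then have "Q = map_poly (\<lambda>f. f (A, v)) P" by (simp only: poly_eq_poly_eq_iff)
    then show ?thesis by (simp add: coeff_map_poly)
  qed
  have N: "N > 0"
  proof (rule ccontr)
    assume "\<not> N > 0"
    then have const: "F (A, \<lambda>i. s * Y i) = F (A, \<lambda>i. s' * Y i)" for A Y s s'
    proof -
      have "map_poly (\<lambda>f. f (A, Y)) P = [:coeff P 0 (A, Y):]"
        using P(2) \<open>\<not> N > 0\<close> by (intro poly_eqI) (auto simp: coeff_map_poly coeff_pCons split: nat.split)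
      then show ?thesis unfolding P(3) by simp
    qed
    obtain x where x: "x \<in> X" using X by auto
    have "F (A, Y) = 0" for A Y
    proof -
      have "F (A, Y) = F (A, \<lambda>i. 0)" using const[of A 1 Y 0] by simp
      also have "\<dots> = F (A, measurements d A x)" using const[of A 0 "measurements d A x" 1] by simp
      finally show ?thesis using F(3)[OF x] by simp
    qed
    then show False using F(2) by (auto simp: fun_eq_iff)
  qed
  have "coeff P N \<noteq> 0"
  proof
    assume 0: "coeff P N = 0"
    have "F = (\<Sum>i<N. coeff P i)"
    proof
      fix v :: "(nat \<Rightarrow> 'k ^ 'n) \<times> (nat \<Rightarrow> 'k)"
      obtain A Y where v: "v = (A, Y)" by (cases v)
      let ?p = "map_poly (\<lambda>f. f (A, Y)) P"
      have c0: "coeff ?p i = 0" if "i \<ge> N" for i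
        using P(2) 0 that by (cases "i = N") (auto simp: coeff_map_poly)
      have "F v = poly ?p 1" using P(3)[of A 1 Y] by (simp add: v)
      also have "\<dots> = (\<Sum>i\<le>degree ?p. coeff ?p i)" by (simp add: poly_altdef)
      also have "\<dots> = (\<Sum>i<N. coeff ?p i)"
        by (rule sum.mono_neutral_cong) (auto simp: c0 coeff_eq_0 not_less not_le)
      finally show "F v = (\<Sum>i<N. coeff P i) v"
        by (simp add: sum_fun_apply coeff_map_poly v)
    qed
    moreover have "degree_le row_params (value_coords d) (N - 1) (\<Sum>i<N. coeff P i)"
    proof (intro degree_le_sum subring_row_params)
      fix i assume "i \<in> {..<N}"
      then show "degree_le row_params (value_coords d) (N - 1) (coeff P i)"
        using P(1) degree_le.mono[of row_params "value_coords d" i "coeff P i" "N - 1"] by simp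
    qed
    ultimately have "degree_le row_params (value_coords d) (N - 1) F" by simp
    from F(4)[OF _ this F(3)] have "F = 0" using N by simp
    then show False using F(2) by simp
  qed
  moreover have adj: "coeff P N \<in> adjoin row_params (value_coords d)" using P(1) by (auto simp: adjoin_def)
  moreover have "coeff P N (A, v) = 0" if "\<And>i. i \<le> d \<Longrightarrow> v i = 0" for A v
  proof -
    have "F (A, \<lambda>i. s * 0) = poly [:F (A, \<lambda>i. 0):] s" for s by simp
    from unique[of A "\<lambda>_. 0", OF this, of N] N have "coeff P N (A, \<lambda>_. 0) = 0"
      by (simp add: coeff_pCons split: nat.splits)
    then show ?thesis using relation_agree[where A = A and s = v and t = "\<lambda>_. 0", OF adj] that by simp
  qed
  ultimately show thesis
    by (intro that[of "coeff P N"]) (use unique N in \<open>simp_all add: d_def\<close>)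
qed

lemma hom_is_evaluation:
  assumes \<psi>: "hom_on (poly_functions C) \<psi>" "\<And>c. \<psi> (\<lambda>_. c) = c"
    and f: "f \<in> poly_functions D"
    and D: "\<And>c. c \<in> D \<Longrightarrow> (\<lambda>z. c (h z)) \<in> poly_functions C" "\<And>c. c \<in> D \<Longrightarrow> \<psi> (\<lambda>z. c (h z)) = c w"
  shows "\<psi> (\<lambda>z. f (h z)) = f w"
  using f
proof induction
  case (add f g)
  then show ?case
    using hom_on_add[OF \<psi>(1) poly_functions_comp[where h = h, OF add.hyps(1) D(1)]
      poly_functions_comp[where h = h, OF add.hyps(2) D(1)]]
    by (simp add: plus_fun_def)
next
  case (mult f g)
  then show ?case
    using hom_on_mult[OF \<psi>(1) poly_functions_comp[where h = h, OF mult.hyps(1) D(1)]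
      poly_functions_comp[where h = h, OF mult.hyps(2) D(1)]]
    by (simp add: times_fun_def)
qed (auto simp: \<psi>(2) D(2))

text \<open>
  A minimal polynomial of degree one makes \<open>z\<close> a quotient of polynomials in \<open>g\<close>. Because the \<open>g i\<close> are independent, the
  equation \<open>Q\<close> for \<open>z\<close> becomes an identity between polynomials in \<open>d\<close> free variables, to which
  \<open>rational_function_is_affine\<close> applies.
\<close>
lemma affine_of_degree_one:
  fixes C :: "('z \<Rightarrow> complex) set"
  assumes sub: "subdomain (poly_functions C)"
    and g: "\<And>i. i < d \<Longrightarrow> g i \<in> poly_functions C" "independent_seq constants d g"
    and z: "z \<in> poly_functions C"
    and Q: "\<And>i. degree_le constants (g ` {..<d}) (N - i) (coeff Q i)" "\<And>i. i > N \<Longrightarrow> coeff Q i = 0"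
      "coeff Q N = (\<lambda>_. \<kappa>)" "\<kappa> \<noteq> 0" "poly Q z = 0"
    and P: "minimal_poly (adjoin constants (g ` {..<d})) z P" "degree P < 2"
  shows "\<exists>\<alpha> \<beta>. \<forall>p. z p = \<alpha> + (\<Sum>j<d. \<beta> j * g j p)"
proof -
  interpret subdomain "poly_functions C" by fact
  note c = subring_constants
  define \<theta> where "\<theta> f p = f (\<lambda>i. g i p)" for f :: "(nat \<Rightarrow> complex) \<Rightarrow> complex" and p
  have \<theta>: "hom_on UNIV \<theta>" unfolding \<theta>_def by (rule hom_on_precompose)
  have \<theta>c: "\<theta> ` constants = constants"
    by (auto simp: \<theta>_def constants_def image_def fun_eq_iff)
  have \<theta>t: "\<theta> (\<lambda>t. t i) = g i" for i by (auto simp: \<theta>_def)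
  have \<theta>g: "\<theta> ` seq_coords d = g ` {..<d}" by (simp add: seq_coords_eq image_image \<theta>t)
  have inj: "f = 0" if "f \<in> poly_functions (seq_coords d)" "\<theta> f = 0" for f
  proof (rule injective_of_independent_image[OF \<theta> c])
    show "independent_seq (\<theta> ` constants) d (\<lambda>i. \<theta> (\<lambda>t. t i))"
      using g(2) by (simp only: \<theta>c \<theta>t)
    show "f \<in> adjoin constants ((\<lambda>i t. t i) ` {..<d})"
      using that by (simp add: poly_functions_eq_adjoin seq_coords_eq)
  qed (use that in \<open>auto simp: \<theta>_def constants_def fun_eq_iff\<close>)
  let ?S = "adjoin constants (g ` {..<d})"
  have S: "?S = \<theta> ` poly_functions (seq_coords d)"
    unfolding poly_functions_eq_adjoin adjoin_image[OF \<theta>, symmetric] \<theta>c \<theta>g ..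
  have PS: "P \<in> polys_over ?S" "P \<noteq> 0" "poly P z = 0" using P by (auto simp: minimal_poly_def)
  have "degree P = 1" using minimal_poly_degree_pos[OF P(1)] P(2) by simp
  then have "P = [:coeff P 0, coeff P 1:]"
    by (intro poly_eqI) (auto simp: coeff_pCons coeff_eq_0 split: nat.split)
  then have "poly [:coeff P 0, coeff P 1:] z = 0" using PS(3) by simp
  then have lin: "coeff P 0 + z * coeff P 1 = 0" by simp
  have P1: "coeff P 1 \<noteq> 0" using \<open>degree P = 1\<close> PS(2) by (metis leading_coeff_0_iff)
  obtain q where q: "q \<in> poly_functions (seq_coords d)" "\<theta> q = coeff P 1"
    using coeff_polys_over[OF PS(1), of 1] unfolding S by auto
  obtain p0 where p0: "p0 \<in> poly_functions (seq_coords d)" "\<theta> p0 = coeff P 0"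
    using coeff_polys_over[OF PS(1), of 0] unfolding S by auto
  define p where "p = - p0"
  have p: "p \<in> poly_functions (seq_coords d)"
    unfolding p_def by (intro subring_uminus subring_poly_functions p0)
  have \<theta>p: "\<theta> p v = \<theta> q v * z v" for v
  proof -
    have "\<theta> p v = - coeff P 0 v" unfolding p0(2)[symmetric] by (simp add: \<theta>_def p_def)
    moreover have "coeff P 0 v + z v * coeff P 1 v = 0" using fun_cong[OF lin, of v] by simp
    then have "- coeff P 0 v = coeff P 1 v * z v" unfolding neg_eq_iff_add_eq_0 by (simp only: mult.commute)
    ultimately show ?thesis by (simp only: q(2))
  qed
  have q0: "q \<noteq> 0" using q(2) P1 hom_on_0[OF \<theta> subring_UNIV] by metis
  have "\<forall>i. \<exists>a. degree_le constants (seq_coords d) (N - i) a \<and> \<theta> a = coeff Q i"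
    using degree_le_image[OF \<theta>, of constants "seq_coords d"] Q(1) unfolding \<theta>c \<theta>g by blast
  from choice[OF this] obtain a where a: "\<And>i. degree_le constants (seq_coords d) (N - i) (a i)"
      "\<And>i. \<theta> (a i) = coeff Q i" by blast
  have aR: "a i \<in> poly_functions (seq_coords d)" for i
    using a(1) by (auto simp: poly_functions_eq_adjoin adjoin_def)
  define E where "E t = \<kappa> * p t ^ N + (\<Sum>i<N. a i t * p t ^ i * q t ^ (N - i))" for t
  have "E = 0"
  proof (rule inj)
    have pow: "(\<lambda>t. f t ^ n) \<in> poly_functions (seq_coords d)" if "f \<in> poly_functions (seq_coords d)" for f n
      by (induction n) (auto intro: poly_functions.const poly_functions.mult that)
    show "E \<in> poly_functions (seq_coords d)"
      unfolding E_def
      by (intro poly_functions.add poly_functions.mult poly_functions_sum poly_functions.const pow p q aR)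
    show "\<theta> E = 0"
    proof
      fix v
      have "\<theta> E v = \<kappa> * (\<theta> q v * z v) ^ N + (\<Sum>i<N. coeff Q i v * (\<theta> q v * z v) ^ i * \<theta> q v ^ (N - i))"
        unfolding \<theta>p[symmetric] a(2)[symmetric] by (simp add: \<theta>_def E_def)
      also have "\<dots> = \<theta> q v ^ N * (\<kappa> * z v ^ N) + (\<Sum>i<N. \<theta> q v ^ N * (coeff Q i v * z v ^ i))"
      proof -
        have summand: "coeff Q i v * (\<theta> q v * z v) ^ i * \<theta> q v ^ (N - i) = \<theta> q v ^ N * (coeff Q i v * z v ^ i)" if "i < N" for i
        proof -
          have "\<theta> q v ^ N = \<theta> q v ^ i * \<theta> q v ^ (N - i)" using that by (simp add: power_add[symmetric])
          then show ?thesis by (simp add: power_mult_distrib)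
        qed
        have "(\<Sum>i<N. coeff Q i v * (\<theta> q v * z v) ^ i * \<theta> q v ^ (N - i)) =
            (\<Sum>i<N. \<theta> q v ^ N * (coeff Q i v * z v ^ i))"
          by (intro sum.cong refl summand) simp
        moreover have "\<kappa> * (\<theta> q v * z v) ^ N = \<theta> q v ^ N * (\<kappa> * z v ^ N)"
          by (simp add: power_mult_distrib)
        ultimately show ?thesis by (simp only:)
      qed
      also have "\<dots> = \<theta> q v ^ N * (\<Sum>i<Suc N. coeff Q i v * z v ^ i)"
        by (simp add: Q(3) sum_distrib_left distrib_left)
      also have "(\<Sum>i<Suc N. coeff Q i v * z v ^ i) = poly (map_poly (\<lambda>f. f v) Q) (z v)"
      proof -
        have "coeff Q i v = 0" if "degree (map_poly (\<lambda>f. f v) Q) < i" for i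
          using coeff_eq_0[OF that] by (simp add: coeff_map_poly)
        then show ?thesis
          unfolding poly_altdef by (intro sum.mono_neutral_cong) (auto simp: coeff_map_poly Q(2))
      qed
      also have "\<dots> = (poly Q z) v"
        by (rule hom_on_poly[OF hom_on_eval subring_UNIV, symmetric]) (auto simp: polys_over_def)
      finally show "\<theta> E v = 0 v" by (simp add: Q(5))
    qed
  qed
  then obtain \<alpha> \<beta> where ab: "\<And>t. p t = q t * (\<alpha> + (\<Sum>j<d. \<beta> j * t j))"
    using rational_function_is_affine[OF p q(1) q0 Q(4) a(1)] by (auto simp: E_def fun_eq_iff)
  define w where "w v = z v - (\<alpha> + (\<Sum>j<d. \<beta> j * g j v))" for v
  have "w \<in> poly_functions C"
  proof -
    have "(\<lambda>v. z v + (- 1) * (\<alpha> + (\<Sum>j<d. \<beta> j * g j v))) \<in> poly_functions C"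
      by (intro poly_functions.add poly_functions.mult poly_functions_sum poly_functions.const z) (use g in auto)
    moreover have "w = (\<lambda>v. z v + (- 1) * (\<alpha> + (\<Sum>j<d. \<beta> j * g j v)))"
      by (simp add: w_def fun_eq_iff)
    ultimately show ?thesis by (simp only:)
  qed
  moreover have "coeff P 1 * w = 0"
  proof
    fix v
    have "coeff P 1 v * z v = coeff P 1 v * (\<alpha> + (\<Sum>j<d. \<beta> j * g j v))"
      using \<theta>p[of v] ab[of "\<lambda>i. g i v"] unfolding q(2)[symmetric] by (auto simp: \<theta>_def)
    then show "(coeff P 1 * w) v = 0 v" by (simp add: w_def right_diff_distrib)
  qed
  moreover have "coeff P 1 \<in> poly_functions C"
  proof -
    have "?S \<subseteq> poly_functions C"
      using g(1) adjoin_base[of constants C] by (intro adjoin_least subring) (auto simp: poly_functions_eq_adjoin)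
    then show ?thesis using coeff_polys_over[OF PS(1)] by blast
  qed
  ultimately have "w = 0" using domain P1 by blast
  then have "z v = \<alpha> + (\<Sum>j<d. \<beta> j * g j v)" for v by (auto simp: w_def fun_eq_iff)
  then show ?thesis by blast
qed

text \<open>
  The points \<open>x\<close> that satisfy the affine formulas form a linear space containing the closure. It is not larger:
  a polynomial vanishing on \<open>X\<close>, read through the formulas as a polynomial in the \<open>d\<close> independent forms, is zero.
\<close>
lemma linear_closure_of_affine_coordinates:
  fixes X :: "('k::field_char_0 ^ 'n) set"
  assumes \<Phi>: "range \<Phi> = X" and ind: "independent_seq constants d (\<lambda>i z. dotp (b i) (\<Phi> z))"
    and aff: "\<And>z j. \<Phi> z $ j = \<alpha> j + (\<Sum>i<d. \<beta> j i * dotp (b i) (\<Phi> z))"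
  shows "linear_closure X"
proof -
  define L where "L x = (\<chi> j. \<Sum>i<d. \<beta> j i * dotp (b i) x)" for x
  define a where "a = (\<chi> j. \<alpha> j)"
  have dotp_poly': "(\<lambda>x. dotp u x) \<in> poly_functions vec_coords" for u
    using dotp_poly[of u 0] by simp
  have X: "x = a + L x" if "x \<in> X" for x
    using that \<Phi> aff by (auto simp: vec_eq_iff L_def a_def)
  have V1: "x = a + L x" if "x \<in> zariski_closure X" for x
  proof -
    have "(\<lambda>x. x $ j + (- 1) * (\<alpha> j + (\<Sum>i<d. \<beta> j i * dotp (b i) x))) \<in> poly_functions vec_coords" for j
      by (intro poly_functions.add poly_functions.mult poly_functions_sum poly_functions.const vec_coord_poly dotp_poly')
    moreover have "y $ j + (- 1) * (\<alpha> j + (\<Sum>i<d. \<beta> j i * dotp (b i) y)) = 0" if "y \<in> X" for y j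
    proof -
      obtain z where "y = \<Phi> z" using \<open>y \<in> X\<close> \<Phi> by auto
      then show ?thesis by (simp add: aff[of z j, symmetric])
    qed
    ultimately have "x $ j + (- 1) * (\<alpha> j + (\<Sum>i<d. \<beta> j i * dotp (b i) x)) = 0" for j
      using vanishes_on_closure[OF _ _ that] by blast
    then have "x $ j = \<alpha> j + (\<Sum>i<d. \<beta> j i * dotp (b i) x)" for j
      by (simp only: mult_minus_left mult_1_left add_uminus_conv_diff right_minus_eq)
    then show ?thesis by (simp add: vec_eq_iff L_def a_def)
  qed
  have V2: "x \<in> zariski_closure X" if x: "x = a + L x" for x
    unfolding zariski_closure_def
  proof (intro InterI, clarify)
    fix Z assume "zariski_closed vec_coords Z" "X \<subseteq> Z"
    then obtain F where F: "F \<subseteq> poly_functions vec_coords" "Z = {v. \<forall>f\<in>F. f v = 0}"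
      by (auto simp: zariski_closed_def)
    have "f x = 0" if f: "f \<in> F" for f
    proof -
      define h where "h t = f (\<chi> j. \<alpha> j + (\<Sum>i<d. \<beta> j i * t i))" for t
      have h: "h \<in> poly_functions (seq_coords d)"
        unfolding h_def
      proof (rule poly_functions_comp[where f = f and C = vec_coords and h = "\<lambda>t. \<chi> j. \<alpha> j + (\<Sum>i<d. \<beta> j i * t i)"])
        show "f \<in> poly_functions vec_coords" using F f by auto
        have "(\<lambda>t. t i) \<in> poly_functions (seq_coords d)" if "i \<in> {..<d}" for i
          using that by (intro poly_functions.coord) (auto simp: seq_coords_def)
        then show "(\<lambda>t. c (\<chi> j. \<alpha> j + (\<Sum>i<d. \<beta> j i * t i))) \<in> poly_functions (seq_coords d)" if "c \<in> vec_coords" for c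
          using that by (auto simp: vec_coords_def intro!: poly_functions.add poly_functions_sum poly_functions.mult poly_functions.const)
      qed
      have "alg_independent_on X d (\<lambda>i. dotp (b i))"
        using ind by (simp add: alg_independent_on_iff[OF \<Phi>])
      moreover have "h (\<lambda>i. dotp (b i) y) = 0" if "y \<in> X" for y
      proof -
        have "h (\<lambda>i. dotp (b i) y) = f (a + L y)"
          by (auto simp: h_def a_def L_def vec_eq_iff intro!: arg_cong[of _ _ f])
        then show ?thesis using X[OF that] that \<open>X \<subseteq> Z\<close> F(2) f by auto
      qed
      ultimately have "h (\<lambda>i. dotp (b i) x) = 0" using h by (auto simp: alg_independent_on_def)
      moreover have "h (\<lambda>i. dotp (b i) x) = f (a + L x)"
        by (auto simp: h_def a_def L_def vec_eq_iff intro!: arg_cong[of _ _ f])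
      ultimately show ?thesis using x by simp
    qed
    then show "x \<in> Z" using F(2) by auto
  qed
  obtain x0 where x0: "x0 \<in> X" using \<Phi> by auto
  have Ldiff: "L (x - y) = L x - L y" for x y
    by (simp add: L_def vec_eq_iff dotp_def right_diff_distrib sum_subtractf)
  have "(\<lambda>x. x - x0) ` zariski_closure X = {w. w = L w}"
  proof (intro set_eqI iffI)
    fix w assume "w \<in> (\<lambda>x. x - x0) ` zariski_closure X"
    then obtain x where x: "x \<in> zariski_closure X" "w = x - x0" by auto
    have "x - x0 = (a + L x) - (a + L x0)"
      by (rule arg_cong2[of _ _ _ _ "(-)", OF V1[OF x(1)] X[OF x0]])
    also have "\<dots> = L (x - x0)" by (simp add: Ldiff)
    finally show "w \<in> {w. w = L w}" by (simp only: x(2) mem_Collect_eq)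
  next
    fix w assume "w \<in> {w. w = L w}"
    then have w: "w = L w" by blast
    have "L (x0 + w) = L x0 + L w"
      using Ldiff[of "x0 + w" x0] by (simp add: algebra_simps)
    moreover have "x0 + w = (a + L x0) + L w"
      by (rule arg_cong2[of _ _ _ _ "(+)", OF X[OF x0] w])
    ultimately have "x0 + w = a + L (x0 + w)" by (simp only: add.assoc)
    from V2[OF this] show "w \<in> (\<lambda>x. x - x0) ` zariski_closure X"
      by (intro image_eqI[of _ _ "x0 + w"]) auto
  qed
  moreover have "vec.subspace {w. w = L w}"
    unfolding vec.subspace_def
  proof (intro conjI ballI allI)
    have L0: "L 0 = 0" using Ldiff[of 0 0] by simp
    then show "0 \<in> {w. w = L w}" by simp
    fix x y assume "x \<in> {w. w = L w}" "y \<in> {w. w = L w}"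
    then have xy: "x = L x" "y = L y" by blast+
    have "x + y = L x + L y" by (rule arg_cong2[of _ _ _ _ "(+)", OF xy])
    moreover have "L (x + y) = L x + L y" using Ldiff[of x "- y"] Ldiff[of 0 y] L0 by simp
    ultimately show "x + y \<in> {w. w = L w}" by (simp only: mem_Collect_eq)
  next
    fix c x assume "x \<in> {w. w = L w}"
    then have "c *s x = c *s L x" by (intro arg_cong[of _ _ "(*s) c"]) blast
    moreover have "L (c *s x) = c *s L x"
      by (simp add: L_def vec_eq_iff dotp_scale_right sum_distrib_left mult.left_commute)
    ultimately show "c *s x \<in> {w. w = L w}" by (simp only: mem_Collect_eq)
  qed
  ultimately have "vec.subspace ((\<lambda>x. x - x0) ` zariski_closure X)" by (simp only:)
  then show ?thesis unfolding linear_closure_def by blast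
qed

text \<open>
  The rows of the matrix \<open>\<lambda>i. B i + v i *s l\<close> mix a form \<open>l\<close> into rows \<open>B\<close>, one of which is zero. Its measurements are
  \<open>y + (l . x) * v\<close>, with \<open>y\<close> the \<open>d\<close> measurements of \<open>B\<close>. The relation \<open>F\<close> is thus an equation for \<open>l . x\<close> over
  the polynomials in \<open>y\<close>, with leading coefficient \<open>H (\<lambda>i. B i + v i *s l, v)\<close>. Where this is nonzero, \<open>l . x\<close> is affine
  in \<open>y\<close>, and the coordinates are differences of such forms.
\<close>
lemma identifiable_imp_linear_closure:
  fixes X :: "(complex ^ 'n) set" and \<Phi> :: "'z \<Rightarrow> complex ^ 'n" and A :: "complex ^ 'n ^ 's::finite"
  assumes irr: "zariski_irreducible (zariski_closure X)" and \<Phi>: "range \<Phi> = X"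
    and sub: "subdomain (poly_functions C)" and finC: "finite C"
    and comp: "\<And>j. (\<lambda>z. \<Phi> z $ j) \<in> poly_functions C"
    and pts: "\<And>\<psi>. hom_on (poly_functions C) \<psi> \<Longrightarrow> (\<forall>c. \<psi> (\<lambda>_. c) = c) \<Longrightarrow>
      (\<exists>p. \<forall>f\<in>poly_functions C. \<psi> f = f p)"
    and F: "degree_le row_params (value_coords (model_dim X)) N F"
      "\<And>A x. x \<in> X \<Longrightarrow> F (A, measurements (model_dim X) A x) = 0"
    and H: "H \<in> adjoin row_params (value_coords (model_dim X))"
      "\<And>A v P. (\<And>s. F (A, \<lambda>i. s * v i) = poly P s) \<Longrightarrow> coeff P N = H (A, v)"
    and v: "\<And>i. i > model_dim X \<Longrightarrow> v i = 0" and i0: "i0 \<le> model_dim X" "B i0 = 0"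
    and e: "range e \<subseteq> {..model_dim X} - {i0}" "\<And>r. B (e r) = A $ r"
    and l0: "H (\<lambda>i. B i + v i *s l0, v) \<noteq> 0"
    and gi: "generically_identifiable (\<lambda>x. A *v x) X"
  shows "linear_closure X"
proof -
  define d where "d = model_dim X"
  note c = subring_constants
  let ?R = "poly_functions C"
  interpret subdomain ?R by fact
  have KR: "constants \<subseteq> ?R" unfolding poly_functions_eq_adjoin by (rule adjoin_base)
  obtain U where U: "zariski_open vec_coords U" "zariski_closure X \<inter> U \<noteq> {}"
      "\<And>x. x \<in> X \<Longrightarrow> x \<in> U \<Longrightarrow> identifiable_at (\<lambda>x. A *v x) X x"
    using gi by (auto simp: generically_identifiable_def)
  obtain FU where FU: "FU \<subseteq> poly_functions vec_coords" "- U = {v. \<forall>f\<in>FU. f v = 0}"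
    using U(1) by (auto simp: zariski_open_def zariski_closed_def)
  obtain xs where xs: "xs \<in> zariski_closure X" "xs \<notin> - U" using U(2) by auto
  then obtain f where f: "f \<in> FU" "f xs \<noteq> 0" unfolding FU(2) by auto
  have fp: "f \<in> poly_functions vec_coords" using f FU by auto
  have fU: "x \<in> U" if "f x \<noteq> 0" for x
  proof -
    have "x \<notin> - U" unfolding FU(2) using f(1) that by auto
    then show ?thesis by simp
  qed
  \<comment> \<open>The equation \<open>f\<close> stands for the complement of \<open>U\<close>: nonvanishing of \<open>u\<close> puts the point in \<open>U\<close>.\<close>
  define u where "u z = f (\<Phi> z)" for z
  have pull: "(\<lambda>z. g (\<Phi> z)) \<in> ?R" if "g \<in> poly_functions vec_coords" for g
    by (rule poly_functions_comp[OF that]) (auto simp: vec_coords_def comp)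
  have uR: "u \<in> ?R" unfolding u_def by (rule pull[OF fp])
  have "\<exists>x\<in>X. f x \<noteq> 0" using vanishes_on_closure[OF fp _ xs(1)] f(2) by blast
  then have u0: "u \<noteq> 0" using \<Phi> by (auto simp: u_def fun_eq_iff)
  define lin where "lin l z = dotp l (\<Phi> z)" for l z
  have linR: "lin l \<in> ?R" for l
    unfolding lin_def using pull[OF dotp_poly[of l 0]] by simp
  define I where "I = {..d} - {i0}"
  have I: "finite I" "card I = d" using i0 by (auto simp: I_def d_def)
  define G where "G = (\<lambda>i. lin (B i)) ` I"
  have G: "finite G" "card G \<le> d" "G \<subseteq> ?R"
    using I card_image_le[OF I(1), of "\<lambda>i. lin (B i)"] linR by (auto simp: G_def)
  \<comment> \<open>For a good form \<open>l\<close> the equation obtained from the relation is monic up to a constant.\<close>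
  define good where "good l \<longleftrightarrow> H (\<lambda>i. B i + v i *s l, v) \<noteq> 0" for l
  have good0: "good l0" using l0 by (simp add: good_def)
  have monic: "\<exists>Q. (\<forall>i. degree_le constants G (N - i) (coeff Q i)) \<and> (\<forall>i>N. coeff Q i = 0) \<and>
      coeff Q N = (\<lambda>_. H (\<lambda>i. B i + v i *s l, v)) \<and> poly Q (lin l) = 0" for l
  proof -
    let ?A = "\<lambda>i. B i + v i *s l"
    obtain P where P: "\<And>i. degree_le constants (seq_coords (Suc d)) (N - i) (coeff P i)" "\<And>i. i > N \<Longrightarrow> coeff P i = 0"
        "\<And>y s. F (?A, \<lambda>i. y i + s * v i) = poly (map_poly (\<lambda>f. f y) P) s"
      using relation_along_direction[OF F(1), of ?A v] unfolding d_def by blast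
    have "coeff P N \<in> constants"
      by (rule degree_le_0_imp_base[OF c P(1)[of N]]) simp
    then obtain a where a: "coeff P N = (\<lambda>_. a)" by (auto simp: constants_def)
    have "F (?A, \<lambda>i. s * v i) = poly (map_poly (\<lambda>f. f (\<lambda>_. 0)) P) s" for s
      using P(3)[of "\<lambda>_. 0" s] by simp
    from H(2)[OF this] have a': "a = H (?A, v)" by (simp add: coeff_map_poly a)
    define \<theta> where "\<theta> h z = h (measurements d B (\<Phi> z))" for h :: "(nat \<Rightarrow> complex) \<Rightarrow> complex" and z
    have \<theta>: "hom_on UNIV \<theta>" unfolding \<theta>_def by (rule hom_on_precompose)
    let ?Q = "map_poly \<theta> P"
    have cQ: "coeff ?Q i = \<theta> (coeff P i)" for i by (rule coeff_map_hom[OF \<theta> subring_UNIV])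
    have "degree_le constants G (N - i) (coeff ?Q i)" for i
      unfolding cQ
    proof (rule hom_degree_le[OF \<theta> _ _ P(1)])
      show "\<theta> k \<in> constants" if "k \<in> constants" for k using that by (auto simp: \<theta>_def[abs_def] constants_def)
      fix g :: "(nat \<Rightarrow> complex) \<Rightarrow> complex" assume "g \<in> seq_coords (Suc d)"
      then obtain r where r: "g = (\<lambda>t. t r)" "r \<le> d" by (auto simp: seq_coords_def)
      show "degree_le constants G 1 (\<theta> g)"
      proof (cases "r = i0")
        case True
        then have "\<theta> g = (\<lambda>_. 0)" using r i0(2) by (auto simp: \<theta>_def measurements_def dotp_def)
        then show ?thesis by (auto intro!: degree_le_base simp: constants_def)
      next
        case False
        then have "\<theta> g = lin (B r)" using r by (auto simp: \<theta>_def measurements_def lin_def)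
        then show ?thesis using False r by (intro degree_le.gen) (auto simp: G_def I_def)
      qed
    qed
    moreover have "coeff ?Q i = 0" if "i > N" for i
      unfolding cQ P(2)[OF that] by (rule hom_on_0[OF \<theta> subring_UNIV])
    moreover have "coeff ?Q N = (\<lambda>_. H (?A, v))"
      unfolding cQ a by (simp add: \<theta>_def[abs_def] a')
    moreover have "poly ?Q (lin l) = 0"
    proof
      fix z
      let ?y = "measurements d B (\<Phi> z)"
      have "poly ?Q (lin l) z = poly (map_poly (\<lambda>f. f z) ?Q) (lin l z)"
        by (rule hom_on_poly[OF hom_on_eval subring_UNIV]) (auto simp: polys_over_def)
      also have "map_poly (\<lambda>f. f z) ?Q = map_poly (\<lambda>f. f ?y) P"
        by (rule poly_eqI) (simp add: coeff_map_poly cQ, simp add: \<theta>_def)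
      also have "poly \<dots> (lin l z) = F (?A, \<lambda>i. ?y i + lin l z * v i)"
        by (rule P(3)[symmetric])
      also have "(\<lambda>i. ?y i + lin l z * v i) = measurements d ?A (\<Phi> z)"
        using v by (auto simp: measurements_def dotp_add dotp_scale lin_def d_def)
      also have "F (?A, measurements d ?A (\<Phi> z)) = 0"
        unfolding d_def using \<Phi> by (intro F(2)) auto
      finally show "poly ?Q (lin l) z = 0 z" by simp
    qed
    ultimately show ?thesis by (intro exI[of _ ?Q]) blast
  qed
  let ?S = "adjoin constants G"
  have alg: "algebraic_over ?S (lin l)" if "good l" for l
  proof -
    obtain Q where Q: "\<forall>i. degree_le constants G (N - i) (coeff Q i)" "poly Q (lin l) = 0"
        "coeff Q N = (\<lambda>_. H (\<lambda>i. B i + v i *s l, v))" using monic[of l] by blast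
    have "coeff Q N \<noteq> 0" using that unfolding Q(3) by (auto simp: good_def fun_eq_iff)
    then have "Q \<noteq> 0" by auto
    moreover have "Q \<in> polys_over ?S" using Q(1) by (auto simp: polys_over_def adjoin_def)
    ultimately show ?thesis using Q(2) by (auto simp: algebraic_over_def)
  qed
  have "\<exists>\<epsilon>. \<epsilon> \<noteq> 0 \<and> good (l0 + \<epsilon> *s axis j 1)" for j
  proof -
    let ?C = "{\<lambda>s::complex. s}"
    have id: "(\<lambda>s. s) \<in> poly_functions ?C" by (intro poly_functions.coord) simp
    have "(\<lambda>s. (B i + v i *s (l0 + s *s axis j 1)) $ k) \<in> poly_functions ?C" for i k
    proof -
      have "(\<lambda>s. B i $ k + v i * (l0 $ k + s * axis j 1 $ k)) \<in> poly_functions ?C"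
        by (intro poly_functions.add poly_functions.mult poly_functions.const id)
      then show ?thesis by (simp only: vector_add_component vector_smult_component)
    qed
    then have "(\<lambda>s. H (\<lambda>i. B i + v i *s (l0 + s *s axis j 1), v)) \<in> poly_functions ?C"
      by (intro relation_comp_poly[OF H(1)] poly_functions.const)
    then have "\<exists>p. \<forall>s. H (\<lambda>i. B i + v i *s (l0 + s *s axis j 1), v) = poly p s"
      by (rule poly_functions_on_curve[where \<gamma> = "\<lambda>s. s"]) (auto intro!: exI[of _ "[:0, 1:]"])
    then obtain p where p: "\<And>s. H (\<lambda>i. B i + v i *s (l0 + s *s axis j 1), v) = poly p s" by blast
    have "p \<noteq> 0" using p[of 0] l0 by auto
    then have "p * [:0, 1:] \<noteq> 0" by auto
    then obtain s where "poly (p * [:0, 1:]) s \<noteq> 0" using poly_all_0_iff_0 by blast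
    then show ?thesis using p[of s] by (intro exI[of _ s]) (auto simp: good_def)
  qed
  then obtain \<epsilon> where \<epsilon>: "\<And>j. \<epsilon> j \<noteq> 0" "\<And>j. good (l0 + \<epsilon> j *s axis j 1)" by metis
  have coord: "\<Phi> z $ j = (lin (l0 + \<epsilon> j *s axis j 1) z - lin l0 z) / \<epsilon> j" for z j
    using \<epsilon>(1)[of j] by (simp add: lin_def dotp_add dotp_scale dotp_axis)
  define E where "E = insert (lin l0) (range (\<lambda>j. lin (l0 + \<epsilon> j *s axis j 1)))"
  have E: "finite E" "E \<subseteq> ?R" "\<And>x. x \<in> E \<Longrightarrow> algebraic_over ?S x"
    using alg good0 \<epsilon>(2) linR by (auto simp: E_def)
  let ?M = "adjoin constants (G \<union> E)"
  have MR: "?M \<subseteq> ?R" using G(3) E(2) KR by (intro adjoin_least subring) auto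
  have pullM: "pullback \<Phi> \<subseteq> ?M"
  proof
    fix x assume "x \<in> pullback \<Phi>"
    then obtain j where x: "x = (\<lambda>z. \<Phi> z $ j)" by (auto simp: pullback_def)
    have "x = (\<lambda>_. 1 / \<epsilon> j) * (lin (l0 + \<epsilon> j *s axis j 1) - lin l0)"
      unfolding x by (auto simp: coord fun_eq_iff)
    also have "\<dots> \<in> ?M"
    proof (intro subring_mult subring_diff subring_adjoin c)
      show "(\<lambda>_. 1 / \<epsilon> j) \<in> ?M" using adjoin_base[of constants] by (auto simp: constants_def)
      show "lin (l0 + \<epsilon> j *s axis j 1) \<in> ?M" "lin l0 \<in> ?M"
        using adjoin_gen[of "G \<union> E" constants] by (auto simp: E_def)
    qed
    finally show "x \<in> ?M" .
  qed
  \<comment> \<open>The functions in \<open>G\<close> are independent: all coordinates are algebraic over them, and they are at most \<open>d\<close> in number.\<close>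
  obtain m g where g: "\<forall>i<m. g i \<in> G" "independent_seq constants m g"
      "\<forall>x\<in>G. algebraic_over (adjoin constants (g ` {..<m})) x"
    using extend_to_transcendence_basis[OF c G(1), of 0 "\<lambda>_. 0"] by (auto simp: independent_seq_def)
  have gG: "g ` {..<m} \<subseteq> G" using g(1) by auto
  then have un: "g ` {..<m} \<union> G = G" by auto
  let ?T = "adjoin constants (g ` {..<m})"
  have T: "subring ?T" by (rule subring_adjoin[OF c])
  have TS: "?T \<subseteq> ?S" by (rule adjoin_mono[OF c order.refl gG])
  have SM: "?S \<subseteq> ?M" by (intro adjoin_mono c) auto
  have TR: "?T \<subseteq> ?R" using TS SM MR by blast
  have "finite_over ?T (adjoin constants (g ` {..<m} \<union> G))"
  proof (rule finite_over_adjoin_finite[OF c T order.refl _ finite_over_refl[OF T TR] G(1)])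
    show "adjoin constants (g ` {..<m} \<union> G) \<subseteq> ?R" using SM MR unfolding un by blast
    show "\<And>x. x \<in> G \<Longrightarrow> algebraic_over ?T x" using g(3) by blast
  qed
  then have finS: "finite_over ?T ?S" unfolding un .
  have finM: "finite_over ?T ?M"
    by (rule finite_over_adjoin_finite[OF c T TS MR finS E(1,3)])
  obtain b where b: "independent_seq constants d b" "\<forall>i<d. b i \<in> pullback \<Phi>"
    using transcendence_basis_of_coordinates(1)[OF irr \<Phi>] unfolding d_def by blast
  have "d \<le> card (g ` {..<m})"
  proof (rule independent_seq_bound[OF c KR _ _ subring_adjoin[OF c] MR finM b(1)])
    show "?T \<subseteq> ?M" using TS SM by blast
    show "\<And>i. i < d \<Longrightarrow> b i \<in> ?M" using b(2) pullM by auto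
  qed simp
  moreover have "card (g ` {..<m}) = m"
    using card_image[OF independent_seq_inj_on[OF c g(2)]] by simp
  moreover have "card (g ` {..<m}) \<le> card G" by (rule card_mono[OF G(1) gG])
  ultimately have md: "m = d" and "card (g ` {..<m}) = card G" using G(2) by auto
  then have gG': "g ` {..<d} = G" using card_subset_eq[OF G(1) gG] by simp
  have aff: "\<exists>\<alpha> \<beta>. \<forall>p. lin l p = \<alpha> + (\<Sum>j<d. \<beta> j * g j p)" if l: "good l" for l
  proof -
    obtain Q where Q: "\<forall>i. degree_le constants G (N - i) (coeff Q i)" "\<forall>i>N. coeff Q i = 0"
        "coeff Q N = (\<lambda>_. H (\<lambda>i. B i + v i *s l, v))" "poly Q (lin l) = 0" using monic[of l] by blast
    obtain P where P: "minimal_poly ?S (lin l) P" using alg[OF l] by (rule minimal_poly_exists)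
    have "degree P < 2"
    proof (rule ccontr)
      assume "\<not> degree P < 2"
      then obtain p q where pq: "\<forall>g\<in>G. g p = g q" "lin l p \<noteq> lin l q" "u p \<noteq> 0"
        using two_points_over_generic_value[OF sub finC pts G(3) linR P _ uR u0] by auto
      have "A *v \<Phi> q = A *v \<Phi> p"
      proof (subst vec_eq_iff, rule allI)
        fix r
        have "e r \<in> I" using e(1) by (auto simp: I_def d_def)
        then have "lin (B (e r)) \<in> G" by (auto simp: G_def)
        then have "lin (A $ r) p = lin (A $ r) q" using pq(1) e(2)[of r] by simp
        then show "(A *v \<Phi> q) $ r = (A *v \<Phi> p) $ r" by (simp add: matrix_vector_dotp lin_def)
      qed
      moreover have "\<Phi> p \<in> X" "\<Phi> q \<in> X" using \<Phi> by auto
      moreover have "\<Phi> p \<in> U" using pq(3) by (intro fU) (simp add: u_def)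
      ultimately have "\<Phi> q = \<Phi> p" using U(3)[of "\<Phi> p"] unfolding identifiable_at_def by blast
      then show False using pq(2) by (simp add: lin_def)
    qed
    then show ?thesis
      using Q l P g md G(3) unfolding gG'[symmetric]
      by (intro affine_of_degree_one[OF sub _ _ linR, of d g N Q "H (\<lambda>i. B i + v i *s l, v)" l P]) (auto simp: good_def)
  qed
  have "\<exists>\<alpha> \<beta>. \<forall>z. \<Phi> z $ j = \<alpha> + (\<Sum>i<d. \<beta> i * g i z)" for j
  proof -
    obtain \<alpha> \<beta> where 1: "\<And>p. lin l0 p = \<alpha> + (\<Sum>j<d. \<beta> j * g j p)" using aff[OF good0] by blast
    obtain \<alpha>' \<beta>' where 2: "\<And>p. lin (l0 + \<epsilon> j *s axis j 1) p = \<alpha>' + (\<Sum>j<d. \<beta>' j * g j p)"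
      using aff[OF \<epsilon>(2)[of j]] by blast
    have "\<Phi> z $ j = (\<alpha>' - \<alpha>) / \<epsilon> j + (\<Sum>i<d. ((\<beta>' i - \<beta> i) / \<epsilon> j) * g i z)" for z
    proof -
      have "(\<Sum>i<d. ((\<beta>' i - \<beta> i) / \<epsilon> j) * g i z) = ((\<Sum>i<d. \<beta>' i * g i z) - (\<Sum>i<d. \<beta> i * g i z)) / \<epsilon> j"
        by (simp add: sum_subtractf[symmetric] sum_divide_distrib left_diff_distrib diff_divide_distrib)
      then show ?thesis unfolding coord 1 2 by (simp add: add_divide_distrib diff_divide_distrib)
    qed
    then show ?thesis
      by (rule_tac exI[of _ "(\<alpha>' - \<alpha>) / \<epsilon> j"], rule_tac exI[of _ "\<lambda>i. (\<beta>' i - \<beta> i) / \<epsilon> j"]) blast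
  qed
  then obtain \<alpha> \<beta> where ab: "\<And>j z. \<Phi> z $ j = \<alpha> j + (\<Sum>i<d. \<beta> j i * g i z)" by metis
  have "\<forall>i. \<exists>k. i < d \<longrightarrow> g i = lin (B k)" using g(1) md by (auto simp: G_def)
  from choice[OF this] obtain \<pi> where \<pi>: "\<And>i. i < d \<Longrightarrow> g i = lin (B (\<pi> i))" by blast
  show ?thesis
  proof (rule linear_closure_of_affine_coordinates[OF \<Phi>])
    have "independent_seq constants d (\<lambda>i. lin (B (\<pi> i)))"
      using g(2) independent_seq_cong[of d g "\<lambda>i. lin (B (\<pi> i))" constants] \<pi> md by simp
    then show "independent_seq constants d (\<lambda>i z. dotp (B (\<pi> i)) (\<Phi> z))"
      by (simp add: lin_def[abs_def])
    show "\<Phi> z $ j = \<alpha> j + (\<Sum>i<d. \<beta> j i * dotp (B (\<pi> i)) (\<Phi> z))" for z j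
      unfolding ab[of z j] using \<pi> by (simp add: lin_def)
  qed
qed

lemma explicit_model_homs_are_points:
  fixes \<psi> :: "((nat \<Rightarrow> 'k::field) \<Rightarrow> 'k) \<Rightarrow> 'k"
  assumes "hom_on (poly_functions (seq_coords l)) \<psi>" "\<forall>c. \<psi> (\<lambda>_. c) = c"
  shows "\<exists>p. \<forall>f\<in>poly_functions (seq_coords l). \<psi> f = f p"
proof (intro exI ballI)
  fix f :: "(nat \<Rightarrow> 'k) \<Rightarrow> 'k"
  assume f: "f \<in> poly_functions (seq_coords l)"
  show "\<psi> f = f (\<lambda>i. \<psi> (\<lambda>t. t i))"
    using hom_is_evaluation[OF assms(1) _ f, of "\<lambda>t. t" "\<lambda>i. \<psi> (\<lambda>t. t i)"] assms(2)
    by (auto simp: seq_coords_def intro: poly_functions.coord)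
qed

lemma implicit_model_homs_are_points:
  fixes X :: "('k::field ^ 'n) set"
  assumes "implicit_model X" and \<rho>: "range \<rho> = X" "\<And>x. x \<in> X \<Longrightarrow> \<rho> x = x"
    and \<psi>: "hom_on (poly_functions (pullback \<rho>)) \<psi>" "\<forall>c. \<psi> (\<lambda>_. c) = c"
  shows "\<exists>p. \<forall>f\<in>poly_functions (pullback \<rho>). \<psi> f = f p"
proof -
  obtain F where F: "F \<subseteq> poly_functions vec_coords" "X = {x. \<forall>f\<in>F. f x = 0}"
    using assms(1) by (auto simp: implicit_model_def)
  define p where "p = (\<chi> j. \<psi> (\<lambda>z. \<rho> z $ j))"
  have eval: "\<psi> (\<lambda>z. f (\<rho> z)) = f p" if "f \<in> poly_functions vec_coords" for f
  proof (rule hom_is_evaluation[OF \<psi>(1) _ that])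
    show "\<psi> (\<lambda>_. c) = c" for c using \<psi>(2) by blast
    show "(\<lambda>z. c (\<rho> z)) \<in> poly_functions (pullback \<rho>)" if "c \<in> vec_coords" for c
      using that by (intro poly_functions.coord) (auto simp: vec_coords_def pullback_def)
    show "\<psi> (\<lambda>z. c (\<rho> z)) = c p" if "c \<in> vec_coords" for c
      using that by (auto simp: vec_coords_def p_def)
  qed
  have "f p = 0" if "f \<in> F" for f
  proof -
    have "f (\<rho> z) = 0" for z using that \<rho>(1) F(2) by blast
    then have "(\<lambda>z. f (\<rho> z)) = (\<lambda>_. 0)" by simp
    moreover have "\<psi> (\<lambda>z. f (\<rho> z)) = f p" using that F(1) by (intro eval) auto
    ultimately show ?thesis using \<psi>(2) by metis
  qed
  then have "p \<in> X" using F(2) by auto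
  then show ?thesis
    using eval \<rho>(2)[of p] by (intro exI[of _ p]) (auto simp: poly_functions_pullback)
qed

text \<open>
  The leading form \<open>H\<close> is nonzero at some \<open>(A0, v)\<close>. Choosing \<open>l0\<close> as a multiple of row \<open>i0\<close> of \<open>A0\<close>, where \<open>v i0 \<noteq> 0\<close>, and
  \<open>B0 i = A0 i - v i *s l0\<close> clears row \<open>i0\<close> and leaves \<open>d\<close> rows, among which the rows of the given
  matrix are placed; the others keep their value in \<open>B0\<close>.
\<close>
lemma nonlinear_case:
  fixes X :: "(complex ^ 'n) set"
  assumes model: "model X" and dpos: "model_dim X > 0" and nonlin: "\<not> linear_closure X"
    and s: "CARD('s::finite) \<le> model_dim X"
  shows "for_generic_matrix (\<lambda>A :: complex ^ 'n ^ 's. \<not> generically_identifiable (\<lambda>x. A *v x) X)"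
proof -
  define d where "d = model_dim X"
  have irr: "zariski_irreducible (zariski_closure X)" using model by (simp add: model_def)
  have X: "X \<noteq> {}" by (rule model_dim_pos_imp_nonempty[OF dpos])
  obtain N F where min: "is_minimal_relation X N F"
    using minimal_relation_exists[OF irr X] .
  then have F: "degree_le row_params (value_coords (model_dim X)) N F"
      "\<And>A x. x \<in> X \<Longrightarrow> F (A, measurements (model_dim X) A x) = 0"
    unfolding is_minimal_relation_def by blast+
  obtain H where H: "H \<in> adjoin row_params (value_coords (model_dim X))" "H \<noteq> 0" "N > 0"
    "\<And>A v P. (\<And>s. F (A, \<lambda>i. s * v i) = poly P s) \<Longrightarrow> coeff P N = H (A, v)"
    "\<And>A v. (\<And>i. i \<le> model_dim X \<Longrightarrow> v i = 0) \<Longrightarrow> H (A, v) = 0"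
    using minimal_relation_leading_form[OF min X] by blast
  obtain A0 v0 where Av0: "H (A0, v0) \<noteq> 0" using H(2) by (auto simp: fun_eq_iff)
  define v where "v i = (if i \<le> d then v0 i else 0)" for i
  have Av: "H (A0, v) \<noteq> 0"
    using relation_agree[OF H(1), where A = A0 and s = v0 and t = v] Av0 by (simp add: v_def d_def)
  then obtain i0 where i0: "i0 \<le> d" "v i0 \<noteq> 0" using H(5)[of v A0] unfolding d_def by blast
  define l0 where "l0 = (1 / v i0) *s A0 i0"
  define B0 where "B0 i = A0 i - v i *s l0" for i
  have B0: "B0 i0 = 0" using i0(2) by (simp add: B0_def l0_def vec_eq_iff)
  have "card (UNIV :: 's set) \<le> card ({..d} - {i0})" using s i0(1) by (simp add: d_def)
  then obtain e :: "'s \<Rightarrow> nat" where e: "range e \<subseteq> {..d} - {i0}" "inj e"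
    using card_le_inj[of "UNIV :: 's set" "{..d} - {i0}"] by auto
  define rows where "rows A i = (if i \<in> range e then A $ inv e i else B0 i)" for A :: "complex ^ 'n ^ 's" and i
  have rows_e: "rows A (e r) = A $ r" for A r using e(2) by (simp add: rows_def)
  have rows_i0: "rows A i0 = 0" for A using e(1) B0 by (auto simp: rows_def)
  define W where "W = {A. H (\<lambda>i. rows A i + v i *s l0, v) \<noteq> 0}"
  have rows_poly: "(\<lambda>A. rows A i $ j) \<in> poly_functions mat_coords" for i j
    by (cases "i \<in> range e") (auto simp: rows_def mat_coords_def intro: poly_functions.intros)
  have "(\<lambda>A. (rows A i + v i *s l0) $ j) \<in> poly_functions mat_coords" for i j
    using poly_functions.add[OF rows_poly[of i j] poly_functions.const[of "v i * l0 $ j"]] by simp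
  then have "(\<lambda>A. H (\<lambda>i. rows A i + v i *s l0, v)) \<in> poly_functions mat_coords"
    by (intro relation_comp_poly[OF H(1)] poly_functions.const)
  then have W_open: "zariski_open mat_coords W"
    unfolding zariski_open_def zariski_closed_def W_def
    by (intro exI[of _ "{\<lambda>A. H (\<lambda>i. rows A i + v i *s l0, v)}"]) auto
  have "rows (\<chi> r. B0 (e r)) = B0"
    using e(2) by (auto simp: rows_def fun_eq_iff f_inv_into_f)
  then have "(\<chi> r. B0 (e r)) \<in> W"
    using Av by (simp add: W_def) (simp add: B0_def)
  moreover have "\<not> generically_identifiable (\<lambda>x. A *v x) X" if A: "A \<in> W" for A
  proof
    assume gi: "generically_identifiable (\<lambda>x. A *v x) X"
    have v0': "v i = 0" if "i > model_dim X" for i using that by (simp add: v_def d_def)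
    have HA: "H (\<lambda>i. rows A i + v i *s l0, v) \<noteq> 0" using A by (simp add: W_def)
    note args = F H(1,4) v0' i0(1)[unfolded d_def] rows_i0 e(1)[unfolded d_def] rows_e HA gi
    consider "implicit_model X" | "explicit_model X" using model by (auto simp: model_def)
    then have "linear_closure X"
    proof cases
      case 1
      obtain x0 where x0: "x0 \<in> X" using X by auto
      define \<rho> where "\<rho> x = (if x \<in> X then x else x0)" for x
      have \<rho>: "range \<rho> = X" "\<And>x. x \<in> X \<Longrightarrow> \<rho> x = x" using x0 by (auto simp: \<rho>_def image_def)
      have comp: "(\<lambda>z. \<rho> z $ j) \<in> poly_functions (pullback \<rho>)" for j
        by (intro poly_functions.coord) (auto simp: pullback_def)
      show ?thesis
        by (rule identifiable_imp_linear_closure[OF irr \<rho>(1) subdomain_pullback[OF irr \<rho>(1)] finite_pullback comp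
          implicit_model_homs_are_points[OF 1 \<rho>] args])
    next
      case 2
      then obtain l and \<phi> :: "(nat \<Rightarrow> complex) \<Rightarrow> complex ^ 'n" where
        \<phi>: "\<And>i. (\<lambda>t. \<phi> t $ i) \<in> poly_functions (seq_coords l)" "range \<phi> = X"
        by (auto simp: explicit_model_def)
      have fin: "finite (seq_coords l :: ((nat \<Rightarrow> complex) \<Rightarrow> complex) set)" by (simp add: seq_coords_eq)
      show ?thesis
        by (rule identifiable_imp_linear_closure[OF irr \<phi>(2) subdomain_seq fin \<phi>(1)
          explicit_model_homs_are_points args])
    qed
    with nonlin show False by simp
  qed
  ultimately show ?thesis
    unfolding for_generic_matrix_def using W_open by blast
qed

section \<open>Generic identifiability\<close>

lemma for_generic_matrix_mono:
  "for_generic_matrix P \<Longrightarrow> (\<And>A. P A \<Longrightarrow> Q A) \<Longrightarrow> for_generic_matrix Q"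
  unfolding for_generic_matrix_def by blast

lemma for_generic_matrix_trivial:
  assumes "\<And>A. P A"
  shows "for_generic_matrix P"
proof -
  have "zariski_open mat_coords UNIV"
    unfolding zariski_open_def zariski_closed_def
    by (intro exI[of _ "{\<lambda>_. 1}"]) (auto intro: poly_functions.const)
  then show ?thesis
    using assms unfolding for_generic_matrix_def by blast
qed

lemma generic_identifiability:
  fixes X :: "('k::{real_normed_field,euclidean_space} ^ 'n) set"
  assumes model: "model X" and d: "model_dim X > 0"
  shows "for_generic_matrix (\<lambda>A :: 'k ^ 'n ^ 's::finite.
    (linear_closure X \<longrightarrow> (generically_identifiable (\<lambda>x. A *v x) X \<longleftrightarrow> CARD('s) \<ge> model_dim X)) \<and>
    (CARD('s) \<ge> model_dim X + 1 \<longrightarrow> generically_identifiable (\<lambda>x. A *v x) X))"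
proof (cases "linear_closure X")
  case True
  show ?thesis
    by (rule for_generic_matrix_mono[OF linear_case[OF model d True]]) auto
next
  case False
  have irr: "zariski_irreducible (zariski_closure X)" using model by (simp add: model_def)
  show ?thesis
  proof (cases "CARD('s) \<ge> model_dim X + 1")
    case True
    show ?thesis
      by (rule for_generic_matrix_mono[OF generic_matrix_identifies[OF irr model_dim_pos_imp_nonempty[OF d] True]])
        (use False in auto)
  qed (use False in \<open>auto intro: for_generic_matrix_trivial\<close>)
qed

theorem mainTheorem8:
  shows
    "(\<forall>X :: (real ^ 'n) set. model X \<and> model_dim X > 0 \<longrightarrow>
        for_generic_matrix (\<lambda>A :: real ^ 'n ^ 's.
          (linear_closure X \<longrightarrow>
             (generically_identifiable (\<lambda>x. A *v x) X \<longleftrightarrow> CARD('s) \<ge> model_dim X)) \<and>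
          (\<not> vec.subspace X \<and> CARD('s) \<ge> model_dim X + 1 \<longrightarrow>
             generically_identifiable (\<lambda>x. A *v x) X)))
   \<and> (\<forall>X :: (complex ^ 'n) set. model X \<and> model_dim X > 0 \<longrightarrow>
        for_generic_matrix (\<lambda>A :: complex ^ 'n ^ 's.
          (linear_closure X \<longrightarrow>
             (generically_identifiable (\<lambda>x. A *v x) X \<longleftrightarrow> CARD('s) \<ge> model_dim X)) \<and>
          (\<not> vec.subspace X \<and> CARD('s) \<ge> model_dim X + 1 \<longrightarrow>
             generically_identifiable (\<lambda>x. A *v x) X) \<and>
          (\<not> linear_closure X \<longrightarrow>
             (generically_identifiable (\<lambda>x. A *v x) X \<longrightarrow> CARD('s) \<ge> model_dim X + 1))))"
proof (intro conjI allI impI)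
  fix X :: "(real ^ 'n) set"
  assume X: "model X \<and> model_dim X > 0"
  show "for_generic_matrix (\<lambda>A :: real ^ 'n ^ 's.
          (linear_closure X \<longrightarrow>
             (generically_identifiable (\<lambda>x. A *v x) X \<longleftrightarrow> CARD('s) \<ge> model_dim X)) \<and>
          (\<not> vec.subspace X \<and> CARD('s) \<ge> model_dim X + 1 \<longrightarrow>
             generically_identifiable (\<lambda>x. A *v x) X))"
    by (rule for_generic_matrix_mono[OF generic_identifiability]) (use X in auto)
next
  fix X :: "(complex ^ 'n) set"
  assume X: "model X \<and> model_dim X > 0"
  show "for_generic_matrix (\<lambda>A :: complex ^ 'n ^ 's.
          (linear_closure X \<longrightarrow>
             (generically_identifiable (\<lambda>x. A *v x) X \<longleftrightarrow> CARD('s) \<ge> model_dim X)) \<and>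
          (\<not> vec.subspace X \<and> CARD('s) \<ge> model_dim X + 1 \<longrightarrow>
             generically_identifiable (\<lambda>x. A *v x) X) \<and>
          (\<not> linear_closure X \<longrightarrow>
             (generically_identifiable (\<lambda>x. A *v x) X \<longrightarrow> CARD('s) \<ge> model_dim X + 1)))"
  proof (cases "\<not> linear_closure X \<and> CARD('s) \<le> model_dim X")
    case True
    then have "for_generic_matrix (\<lambda>A :: complex ^ 'n ^ 's. \<not> generically_identifiable (\<lambda>x. A *v x) X)"
      using X by (intro nonlinear_case) auto
    then show ?thesis by (rule for_generic_matrix_mono) (use True in auto)
  next
    case False
    show ?thesis
      by (rule for_generic_matrix_mono[OF generic_identifiability]) (use X False in auto)
  qed
qed

end
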